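(* Let $(\mathbf B_t)_{t\ge0}$ and $(\mathbf B'_t)_{t\ge0}$ be any two co-adapted Heisenberg Brownian motions starting respectively in $a=(x,y,z)$ and $a'=(x',y',z')$ with $(x'-x)^2+(y'-y)^2>0$. Then, for every $C>0$, $$\mathbb P\left(\forall t\ge0,\ d_{\mathbb H}(\mathbf B_t,\mathbf B'_t)\le C\right)\neq1.$$
   Context: Heisenberg group: $\mathbb H=\mathbb R^3$ with the group law $(x,y,z)\cdot(x',y',z')=\left(x+x',y+y',z+z'+\tfrac12(xy'-yx')\right)$. Left-invariant vector fields: $X=\partial_x-\tfrac y2\partial_z$, $Y=\partial_y+\tfrac x2\partial_z$. Distance: $d_{\mathbb H}(a,a')=\inf_\gamma\int_0^1|\dot\gamma(t)|_{\mathrm h}\,dt$, the infimum being over horizontal curves $\gamma:[0,1]\to\mathbb H$ from $a$ to $a'$, i.e. absolutely continuous curves with $\dot\gamma(t)\in\mathrm{Vect}(X(\gamma(t)),Y(\gamma(t)))$ for almost every $t$; $|\cdot|_{\mathrm h}$ is the Euclidean norm on $\mathrm{Vect}(X,Y)$ making $(X,Y)$ orthonormal (Carnot–Carathéodory distance). Heisenberg Brownian motion starting in $a\in\mathbb H$: a process with the law of $\mathbf B^a_t=a\cdot\left(B^1_t,B^2_t,\tfrac12\left(\int_0^tB^1_s\,dB^2_s-\int_0^tB^2_s\,dB^1_s\right)\right)$, where $B^1,B^2$ are independent standard one-dimensional Brownian motions starting at $0$. It is a continuous Markov process with generator $\tfrac12(X^2+Y^2)$ and semigroup denoted $(P_t)_{t\ge0}$.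 Two Heisenberg Brownian motions $(\mathbf B_t)_{t\ge 0}$, $(\mathbf B'_t)_{t\ge 0}$ are co-adapted if they are defined on (and adapted to) one filtered probability space $(\Omega,(\mathcal F_t)_t,\mathbb P)$ and each of them is Markov with respect to the common filtration $(\mathcal F_t)$ with its own semigroup: for all $s,t\ge0$ and all bounded measurable $f$, $\mathbb E[f(\mathbf B_{s+t})\mid\mathcal F_s]=(P_tf)(\mathbf B_s)$ and $\mathbb E[f(\mathbf B'_{s+t})\mid\mathcal F_s]=(P_tf)(\mathbf B'_s)$ almost surely. *)

theory Defs
  imports "HOL-Probability.Probability"
begin

section \<open>The Heisenberg group and its Carnot--Caratheodory distance\<close>

type_synonym heis = "real \<times> real \<times> real"

fun heis_mult :: "heis \<Rightarrow> heis \<Rightarrow> heis"  (infixl "\<odot>" 70) where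
  "(x, y, z) \<odot> (x', y', z') = (x + x', y + y', z + z' + (x * y' - y * x') / 2)"

fun heis_X :: "heis \<Rightarrow> heis" where
  "heis_X (x, y, z) = (1, 0, - y / 2)"

fun heis_Y :: "heis \<Rightarrow> heis" where
  "heis_Y (x, y, z) = (0, 1, x / 2)"

text \<open>The norm on the horizontal plane at \<open>p\<close> for which \<open>(X(p), Y(p))\<close> is orthonormal.
  The coefficients are unique; the value is unspecified for non-horizontal \<open>v\<close>.\<close>

definition horizontal_norm :: "heis \<Rightarrow> heis \<Rightarrow> real" where
  "horizontal_norm p v =
     (THE r. \<exists>\<alpha> \<beta>. v = \<alpha> *\<^sub>R heis_X p + \<beta> *\<^sub>R heis_Y p \<and> r = sqrt (\<alpha>\<^sup>2 + \<beta>\<^sup>2))"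

definition abs_continuous_on :: "real set \<Rightarrow> (real \<Rightarrow> 'a::metric_space) \<Rightarrow> bool" where
  "abs_continuous_on S \<gamma> \<longleftrightarrow>
     (\<forall>\<epsilon>>0. \<exists>\<delta>>0. \<forall>(n::nat) l u.
        (\<forall>i<n. l i \<le> u i \<and> {l i..u i} \<subseteq> S) \<longrightarrow>
        (\<forall>i<n. \<forall>j<n. i \<noteq> j \<longrightarrow> {l i<..<u i} \<inter> {l j<..<u j} = {}) \<longrightarrow>
        (\<Sum>i<n. u i - l i) < \<delta> \<longrightarrow>
        (\<Sum>i<n. dist (\<gamma> (l i)) (\<gamma> (u i))) < \<epsilon>)"

definition horizontal_curve :: "(real \<Rightarrow> heis) \<Rightarrow> bool" where
  "horizontal_curve \<gamma> \<longleftrightarrow>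
     abs_continuous_on {0..1} \<gamma> \<and>
     (AE t in lebesgue. t \<in> {0..1} \<longrightarrow>
        \<gamma> differentiable (at t within {0..1}) \<and>
        vector_derivative \<gamma> (at t within {0..1}) \<in> span {heis_X (\<gamma> t), heis_Y (\<gamma> t)})"

text \<open>For a horizontal curve the integrand is Lebesgue integrable, because \<open>\<gamma>\<close> is
  absolutely continuous.\<close>

definition horizontal_length :: "(real \<Rightarrow> heis) \<Rightarrow> real" where
  "horizontal_length \<gamma> =
     (LINT t:{0..1}|lebesgue.
        horizontal_norm (\<gamma> t) (vector_derivative \<gamma> (at t within {0..1})))"

definition cc_dist :: "heis \<Rightarrow> heis \<Rightarrow> real" where
  "cc_dist a a' = Inf {horizontal_length \<gamma> | \<gamma>. horizontal_curve \<gamma> \<and> \<gamma> 0 = a \<and> \<gamma> 1 = a'}"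


section \<open>Brownian motion and Ito integrals\<close>

text \<open>All processes are indexed by \<open>real\<close>; only times \<open>t \<ge> 0\<close> are ever used.\<close>

definition std_brownian_motion :: "'w measure \<Rightarrow> (real \<Rightarrow> 'w \<Rightarrow> real) \<Rightarrow> bool" where
  "std_brownian_motion M W \<longleftrightarrow>
     prob_space M \<and>
     (\<forall>t\<ge>0. W t \<in> borel_measurable M) \<and>
     (AE \<omega> in M. W 0 \<omega> = 0) \<and>
     (\<forall>s t. 0 \<le> s \<longrightarrow> s < t \<longrightarrow>
        distributed M lborel (\<lambda>\<omega>. W t \<omega> - W s \<omega>) (normal_density 0 (sqrt (t - s)))) \<and>
     (\<forall>(n::nat) \<tau>. 0 \<le> \<tau> 0 \<longrightarrow> (\<forall>i<n. \<tau> i \<le> \<tau> (Suc i)) \<longrightarrow>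
        prob_space.indep_vars M (\<lambda>_. borel) (\<lambda>i \<omega>. W (\<tau> (Suc i)) \<omega> - W (\<tau> i) \<omega>) {..<n}) \<and>
     (AE \<omega> in M. continuous_on {0..} (\<lambda>t. W t \<omega>))"

definition indep_processes ::
    "'w measure \<Rightarrow> (real \<Rightarrow> 'w \<Rightarrow> real) \<Rightarrow> (real \<Rightarrow> 'w \<Rightarrow> real) \<Rightarrow> bool" where
  "indep_processes M V W \<longleftrightarrow>
     prob_space.indep_var M
       (PiM {0..} (\<lambda>_. borel)) (\<lambda>\<omega>. \<lambda>t\<in>{0..}. V t \<omega>)
       (PiM {0..} (\<lambda>_. borel)) (\<lambda>\<omega>. \<lambda>t\<in>{0..}. W t \<omega>)"

text \<open>\<open>I\<close> is a version of the Ito integral of \<open>H\<close> against \<open>W\<close> over \<open>[0, t]\<close>, for an adapted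
  integrand \<open>H\<close> with continuous paths: the limit in probability of the left-endpoint Riemann
  sums as the mesh of the partition \<open>0 = p 0 \<le> \<dots> \<le> p n = t\<close> tends to \<open>0\<close>.\<close>

definition has_ito_integral ::
    "'w measure \<Rightarrow> (real \<Rightarrow> 'w \<Rightarrow> real) \<Rightarrow> (real \<Rightarrow> 'w \<Rightarrow> real) \<Rightarrow> real \<Rightarrow> ('w \<Rightarrow> real) \<Rightarrow> bool" where
  "has_ito_integral M H W t I \<longleftrightarrow>
     I \<in> borel_measurable M \<and>
     (\<forall>\<epsilon>>0. \<exists>\<delta>>0. \<forall>n (p :: nat \<Rightarrow> real).
        p 0 = 0 \<longrightarrow> p n = t \<longrightarrow> (\<forall>i<n. p i \<le> p (Suc i) \<and> p (Suc i) - p i < \<delta>) \<longrightarrow>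
        measure M {\<omega> \<in> space M.
          \<bar>(\<Sum>i<n. H (p i) \<omega> * (W (p (Suc i)) \<omega> - W (p i) \<omega>)) - I \<omega>\<bar> > \<epsilon>} < \<epsilon>)"


section \<open>Heisenberg Brownian motion\<close>

text \<open>The explicit process starting at the neutral element, built from two independent
  Brownian motions and their Levy area.  Each Ito integral is fixed up to a null set for
  every single \<open>t\<close>, which determines the law of the process.\<close>

definition canonical_heis_bm :: "'w measure \<Rightarrow> (real \<Rightarrow> 'w \<Rightarrow> heis) \<Rightarrow> bool" where
  "canonical_heis_bm M X \<longleftrightarrow>
     (\<exists>W1 W2 I12 I21.
        std_brownian_motion M W1 \<and> std_brownian_motion M W2 \<and> indep_processes M W1 W2 \<and>
        (\<forall>t\<ge>0. has_ito_integral M W1 W2 t (I12 t) \<and> has_ito_integral M W2 W1 t (I21 t)) \<and>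
        (\<forall>t\<ge>0. \<forall>\<omega>\<in>space M. X t \<omega> = (W1 t \<omega>, W2 t \<omega>, (I12 t \<omega> - I21 t \<omega>) / 2)))"

definition process_law :: "'w measure \<Rightarrow> (real \<Rightarrow> 'w \<Rightarrow> heis) \<Rightarrow> (real \<Rightarrow> heis) measure" where
  "process_law M B = distr M (PiM {0..} (\<lambda>_. borel)) (\<lambda>\<omega>. \<lambda>t\<in>{0..}. B t \<omega>)"

text \<open>A continuous process with the law of \<open>a \<odot> X\<close>, where \<open>X\<close> is as above on a possibly
  different probability space \<open>N\<close>.  That \<open>N\<close> lives on the type of paths is no restriction,
  since \<open>X\<close> can be realised on the space of its own paths.\<close>

definition heis_brownian_motion ::
    "'w measure \<Rightarrow> heis \<Rightarrow> (real \<Rightarrow> 'w \<Rightarrow> heis) \<Rightarrow> bool" where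
  "heis_brownian_motion M a B \<longleftrightarrow>
     prob_space M \<and>
     (\<forall>t\<ge>0. B t \<in> borel_measurable M) \<and>
     (AE \<omega> in M. continuous_on {0..} (\<lambda>t. B t \<omega>)) \<and>
     (\<exists>(N :: (real \<Rightarrow> heis) measure) X. canonical_heis_bm N X \<and>
        process_law M B = process_law N (\<lambda>t \<omega>. a \<odot> X t \<omega>))"

text \<open>The law at time \<open>t\<close> of Heisenberg Brownian motion starting in \<open>a\<close>; it does not depend on
  the choice of \<open>N\<close> and \<open>X\<close>.\<close>

definition heis_law :: "real \<Rightarrow> heis \<Rightarrow> heis measure" where
  "heis_law t a =
     (THE \<mu>. \<exists>(N :: (real \<Rightarrow> heis) measure) X. canonical_heis_bm N X \<and>
        \<mu> = distr N borel (\<lambda>\<omega>. a \<odot> X t \<omega>))"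

definition heis_semigroup :: "real \<Rightarrow> (heis \<Rightarrow> real) \<Rightarrow> heis \<Rightarrow> real" where
  "heis_semigroup t f a = (\<integral>p. f p \<partial>heis_law t a)"


section \<open>Co-adapted processes\<close>

definition filtration_on :: "'w measure \<Rightarrow> (real \<Rightarrow> 'w measure) \<Rightarrow> bool" where
  "filtration_on M F \<longleftrightarrow>
     (\<forall>t\<ge>0. subalgebra M (F t)) \<and> (\<forall>s t. 0 \<le> s \<longrightarrow> s \<le> t \<longrightarrow> subalgebra (F t) (F s))"

definition heis_markov ::
    "'w measure \<Rightarrow> (real \<Rightarrow> 'w measure) \<Rightarrow> (real \<Rightarrow> 'w \<Rightarrow> heis) \<Rightarrow> bool" where
  "heis_markov M F B \<longleftrightarrow>
     (\<forall>s\<ge>0. \<forall>t\<ge>0. \<forall>f \<in> borel_measurable borel. bounded (range f) \<longrightarrow>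
        (AE \<omega> in M. real_cond_exp M (F s) (\<lambda>\<omega>. f (B (s + t) \<omega>)) \<omega>
                     = heis_semigroup t f (B s \<omega>)))"

definition co_adapted ::
    "'w measure \<Rightarrow> (real \<Rightarrow> 'w measure) \<Rightarrow> (real \<Rightarrow> 'w \<Rightarrow> heis) \<Rightarrow> (real \<Rightarrow> 'w \<Rightarrow> heis) \<Rightarrow> bool" where
  "co_adapted M F B B' \<longleftrightarrow>
     prob_space M \<and> filtration_on M F \<and>
     (\<forall>t\<ge>0. B t \<in> borel_measurable (F t) \<and> B' t \<in> borel_measurable (F t)) \<and>
     heis_markov M F B \<and> heis_markov M F B'"

end

theory Submission
  imports Defs
begin

text \<open>Write \<open>B\<^sub>t\<inverse> \<odot> B'\<^sub>t = (U\<^sub>t, A\<^sub>t)\<close> with \<open>U\<^sub>t\<close> in the plane.  Bounded distance means that \<open>U\<close> and \<open>A\<close> are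
  bounded.  Observe both processes at the times \<open>k h\<close> only.  The increments \<open>(e, z)\<close> of \<open>B\<close> and \<open>(f, w)\<close>
  of \<open>B'\<close> over one step are each independent of the past, although their coupling is arbitrary, and
  \<open>U\<close> changes by \<open>f - e\<close> while \<open>A\<close> changes by \<open>U \<and> e + U \<and> (f - e) / 2 + (w - z) - e \<and> f / 2\<close>.  Now
  \<open>U \<and> e\<close> contributes \<open>h |U|\<^sup>2\<close> to the second moment of \<open>A\<close>, the terms \<open>w - z\<close> and \<open>e \<and> f\<close> cost
  only \<open>O(h\<^sup>2)\<close>, and everything quadratic in \<open>f - e\<close> is compensated by the growth of the second
  moment of the martingale \<open>U\<close>.  Since \<open>E|U|\<^sup>2\<close> never drops below its positive initial value, for small
  \<open>h\<close> and large \<open>K\<close> the expectation of \<open>A\<^sup>2 + K |U|\<^sup>2\<close> increases by a fixed amount in each step, which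
  contradicts boundedness.\<close>

section \<open>Absolutely continuous curves and the Carnot--Caratheodory distance\<close>

text \<open>Co-adaptedness leaves the joint law of the two increments of one step arbitrary, so the
  expectation of a mixed term such as \<open>e1 * f2\<close> is out of reach. Only terms in a single
  increment, multiplied by a factor known at the beginning of the step, are ever integrated; mixed
  terms are bounded pointwise beforehand. The delicate one is \<open>A\<close> times
  \<open>e \<and> f\<close>, which is of first order in \<open>h\<close>. It equals \<open>A\<close>
  times \<open>e \<and> (f - e)\<close>, and a weighted Young inequality leaves an arbitrarily small
  multiple of \<open>|e|\<^sup>2\<close> and a large multiple of \<open>|f - e|\<^sup>2\<close>. The
  large multiple is why \<open>K\<close> multiplies the squared norm of \<open>U\<close>, whose mean
  grows in a step by exactly the mean of \<open>|f - e|\<^sup>2\<close>. Two obstacles come from the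
  definitions. The semigroup rests on the definite description \<open>heis_law\<close>, so the
  Markov property yields nothing until the law of the canonical process at a fixed time is known to
  be unique; walks with Gaussian steps give this. And \<open>cc_dist\<close> is an infimum of reals,
  which bounds no curve unless some horizontal curve joins the two points.\<close>

lemma abs_continuous_on_finite_family:
  assumes "abs_continuous_on S \<gamma>" "\<epsilon> > 0"
  shows "\<exists>\<delta>>0. \<forall>(I::'i set) l u. finite I \<longrightarrow>
     (\<forall>i\<in>I. l i \<le> u i \<and> {l i..u i} \<subseteq> S) \<longrightarrow>
     (\<forall>i\<in>I. \<forall>j\<in>I. i \<noteq> j \<longrightarrow> {l i<..<u i} \<inter> {l j<..<u j} = {}) \<longrightarrow>
     (\<Sum>i\<in>I. u i - l i) < \<delta> \<longrightarrow> (\<Sum>i\<in>I. dist (\<gamma> (l i)) (\<gamma> (u i))) < \<epsilon>"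
proof -
  from assms(1)[unfolded abs_continuous_on_def, THEN spec, THEN mp, OF assms(2)]
  obtain \<delta> where \<delta>: "\<delta> > 0" and
    ac: "\<forall>(n::nat) l u. (\<forall>i<n. l i \<le> u i \<and> {l i..u i} \<subseteq> S) \<longrightarrow>
        (\<forall>i<n. \<forall>j<n. i \<noteq> j \<longrightarrow> {l i<..<u i} \<inter> {l j<..<u j} = {}) \<longrightarrow>
        (\<Sum>i<n. u i - l i) < \<delta> \<longrightarrow> (\<Sum>i<n. dist (\<gamma> (l i)) (\<gamma> (u i))) < \<epsilon>"
    by (elim exE conjE) (rule that)
  show ?thesis
  proof (intro exI[of _ \<delta>] conjI allI impI \<delta>)
    fix I :: "'i set" and l u
    assume I: "finite I" and lu: "\<forall>i\<in>I. l i \<le> u i \<and> {l i..u i} \<subseteq> S"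
      and dj: "\<forall>i\<in>I. \<forall>j\<in>I. i \<noteq> j \<longrightarrow> {l i<..<u i} \<inter> {l j<..<u j} = {}"
      and small: "(\<Sum>i\<in>I. u i - l i) < \<delta>"
    \<comment> \<open>Divisions come as finite sets, whereas the definition numbers the intervals by
      an initial segment of the naturals; an enumeration passes from one to the other.\<close>
    obtain e where e: "bij_betw e {..<card I} I"
      using ex_bij_betw_nat_finite[OF I] by (auto simp: atLeast0LessThan)
    have eI: "e i \<in> I" if "i < card I" for i
      using e that by (auto simp: bij_betw_def)
    have einj: "e i \<noteq> e j" if "i < card I" "j < card I" "i \<noteq> j" for i j
      using e that by (auto simp: bij_betw_def inj_on_def)
    have "(\<Sum>i<card I. dist (\<gamma> (l (e i))) (\<gamma> (u (e i)))) < \<epsilon>"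
    proof (rule ac[THEN spec, THEN spec, THEN spec, THEN mp, THEN mp, THEN mp])
      show "\<forall>i<card I. l (e i) \<le> u (e i) \<and> {l (e i)..u (e i)} \<subseteq> S" using lu eI by blast
      show "\<forall>i<card I. \<forall>j<card I. i \<noteq> j \<longrightarrow> {l (e i)<..<u (e i)} \<inter> {l (e j)<..<u (e j)} = {}"
        using dj eI einj by blast
      show "(\<Sum>i<card I. u (e i) - l (e i)) < \<delta>"
        using small sum.reindex_bij_betw[OF e, of "\<lambda>i. u i - l i"] by simp
    qed
    then show "(\<Sum>i\<in>I. dist (\<gamma> (l i)) (\<gamma> (u i))) < \<epsilon>"
      using sum.reindex_bij_betw[OF e, of "\<lambda>i. dist (\<gamma> (l i)) (\<gamma> (u i))"] by simp
  qed
qed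

lemma abs_continuous_on_subset:
  assumes "abs_continuous_on S \<gamma>" "T \<subseteq> S"
  shows "abs_continuous_on T \<gamma>"
  unfolding abs_continuous_on_def
proof (intro allI impI)
  fix \<epsilon> :: real assume "\<epsilon> > 0"
  from assms(1)[unfolded abs_continuous_on_def, THEN spec, THEN mp, OF this]
  obtain \<delta> where \<delta>: "\<delta> > 0" and
    ac: "\<forall>(n::nat) l u. (\<forall>i<n. l i \<le> u i \<and> {l i..u i} \<subseteq> S) \<longrightarrow>
        (\<forall>i<n. \<forall>j<n. i \<noteq> j \<longrightarrow> {l i<..<u i} \<inter> {l j<..<u j} = {}) \<longrightarrow>
        (\<Sum>i<n. u i - l i) < \<delta> \<longrightarrow> (\<Sum>i<n. dist (\<gamma> (l i)) (\<gamma> (u i))) < \<epsilon>"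
    by (elim exE conjE) (rule that)
  show "\<exists>\<delta>>0. \<forall>(n::nat) l u. (\<forall>i<n. l i \<le> u i \<and> {l i..u i} \<subseteq> T) \<longrightarrow>
        (\<forall>i<n. \<forall>j<n. i \<noteq> j \<longrightarrow> {l i<..<u i} \<inter> {l j<..<u j} = {}) \<longrightarrow>
        (\<Sum>i<n. u i - l i) < \<delta> \<longrightarrow> (\<Sum>i<n. dist (\<gamma> (l i)) (\<gamma> (u i))) < \<epsilon>"
  proof (intro exI[of _ \<delta>] conjI allI impI \<delta>)
    fix n :: nat and l u :: "nat \<Rightarrow> real"
    assume lu: "\<forall>i<n. l i \<le> u i \<and> {l i..u i} \<subseteq> T"
    show "(\<Sum>i<n. dist (\<gamma> (l i)) (\<gamma> (u i))) < \<epsilon>"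
      if "\<forall>i<n. \<forall>j<n. i \<noteq> j \<longrightarrow> {l i<..<u i} \<inter> {l j<..<u j} = {}" "(\<Sum>i<n. u i - l i) < \<delta>"
      by (rule ac[THEN spec, THEN spec, THEN spec, THEN mp, THEN mp, THEN mp])
        (use lu that assms(2) in \<open>simp_all add: subset_trans[OF _ assms(2)]\<close>)
  qed
qed

text \<open>Tags in the exceptional null set are confined to an open set of small measure, where
  absolute continuity controls the increments; at the other tags the derivative does.\<close>

lemma ftc_abs_continuous_strong:
  fixes \<gamma> :: "real \<Rightarrow> 'a::banach"
  assumes "a \<le> b" and ac: "abs_continuous_on {a..b} \<gamma>" and N: "negligible N"
    and deriv: "\<And>x. x \<in> {a..b} - N \<Longrightarrow> (\<gamma> has_vector_derivative g x) (at x within {a..b})"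
    and gN: "\<And>x. x \<in> N \<Longrightarrow> g x = 0"
  shows "(g has_integral (\<gamma> b - \<gamma> a)) {a..b}"
  unfolding has_integral_real
proof (intro allI impI)
  fix e :: real assume e: "e > 0"
  \<comment> \<open>The summand \<open>1\<close> keeps the denominator positive for
    \<open>a = b\<close> and makes the bound \<open>e1 * (b - a) < e / 2\<close> strict.\<close>
  define e1 where "e1 = e / (2 * (b - a + 1))"
  have e1: "e1 > 0" "e1 * (b - a) < e / 2"
    using e \<open>a \<le> b\<close> by (auto simp: e1_def field_simps)
  have "\<forall>x. \<exists>d>0. x \<in> {a..b} - N \<longrightarrow>
         (\<forall>y\<in>{a..b}. norm (y-x) < d \<longrightarrow> norm (\<gamma> y - \<gamma> x - (y-x) *\<^sub>R g x) \<le> e1 * norm (y-x))"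
    using deriv[unfolded has_vector_derivative_def has_derivative_within_alt] e1 by blast
  then obtain d where d: "\<And>x. 0 < d x" and
     dd: "\<And>x y. \<lbrakk>x \<in> {a..b} - N; y \<in> {a..b}; norm (y-x) < d x\<rbrakk>
                        \<Longrightarrow> norm (\<gamma> y - \<gamma> x - (y-x) *\<^sub>R g x) \<le> e1 * norm (y-x)"
    by metis
  from abs_continuous_on_finite_family[OF ac half_gt_zero[OF e], where ?'i="real \<times> real set"]
  obtain \<delta> where \<delta>: "\<delta> > 0" and
    ac: "\<forall>(I::(real \<times> real set) set) l u. finite I \<longrightarrow> (\<forall>i\<in>I. l i \<le> u i \<and> {l i..u i} \<subseteq> {a..b}) \<longrightarrow>
        (\<forall>i\<in>I. \<forall>j\<in>I. i \<noteq> j \<longrightarrow> {l i<..<u i} \<inter> {l j<..<u j} = {}) \<longrightarrow>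
        (\<Sum>i\<in>I. u i - l i) < \<delta> \<longrightarrow> (\<Sum>i\<in>I. dist (\<gamma> (l i)) (\<gamma> (u i))) < e/2"
    by (elim exE conjE) (rule that)
  have "N \<in> sets lebesgue" using N by (simp add: negligible_iff_null_sets null_setsD2)
  then obtain U where U: "open U" "N \<subseteq> U" "U - N \<in> lmeasurable" "emeasure lebesgue (U - N) < ennreal \<delta>"
    using sets_lebesgue_outer_open[OF _ \<delta>] by metis
  have Um: "U \<in> lmeasurable" "measure lebesgue U < \<delta>"
  proof -
    have "emeasure lebesgue U = emeasure lebesgue (U - N)"
      using N U by (simp add: emeasure_Diff_null_set negligible_iff_null_sets)
    then show "U \<in> lmeasurable" "measure lebesgue U < \<delta>"
      using U \<delta> by (auto simp: fmeasurable_def measure_def less_top[symmetric] enn2real_less_iff)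
  qed
  have "\<forall>x. \<exists>r>0. x \<in> N \<longrightarrow> ball x r \<subseteq> U"
    using U by (meson open_contains_ball subsetD zero_less_one)
  then obtain r where r: "\<And>x. r x > 0" "\<And>x. x \<in> N \<Longrightarrow> ball x (r x) \<subseteq> U" by metis
  define G where "G x = (if x \<in> N then ball x (r x) else ball x (d x))" for x
  show "\<exists>G. gauge G \<and> (\<forall>p. p tagged_division_of {a..b} \<and> G fine p \<longrightarrow>
        norm ((\<Sum>(x, k)\<in>p. measure lborel k *\<^sub>R g x) - (\<gamma> b - \<gamma> a)) < e)"
  proof (intro exI[of _ G] conjI allI impI)
    show "gauge G" using r d by (auto simp: gauge_def G_def)
  next
    fix p assume p: "p tagged_division_of {a..b} \<and> G fine p"
    then have pt: "p tagged_division_of {a..b}" and fine: "G fine p" by auto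
    have fin: "finite p" using pt by blast
    define bad where "bad = {q \<in> p. fst q \<in> N}"
    define good where "good = {q \<in> p. fst q \<notin> N}"
    have pu: "p = good \<union> bad" "good \<inter> bad = {}" "finite good" "finite bad"
      using fin by (auto simp: good_def bad_def)
    have tel: "\<gamma> b - \<gamma> a = (\<Sum>(x,K)\<in>p. \<gamma>(Sup K) - \<gamma>(Inf K))" "b - a = (\<Sum>(x,K)\<in>p. Sup K - Inf K)"
      using additive_tagged_division_1[OF \<open>a \<le> b\<close> pt, of \<gamma>]
        additive_tagged_division_1[OF \<open>a \<le> b\<close> pt, of "\<lambda>x. x"] by auto
    have K: "\<exists>u v. K = {u..v} \<and> u \<le> v \<and> x \<in> K \<and> a \<le> u \<and> v \<le> b \<and> Inf K = u \<and> Sup K = v \<and> measure lborel K = v - u"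
      if xK: "(x, K) \<in> p" for x K
    proof -
      obtain u v where uv: "K = cbox u v" using tagged_division_ofD(4)[OF pt xK] by blast
      have "x \<in> K" "K \<subseteq> {a..b}" using tagged_division_ofD(2,3)[OF pt xK] by auto
      then show ?thesis using uv by (intro exI[of _ u] exI[of _ v]) auto
    qed
    define w where "w = (\<lambda>(x,K). measure lborel K *\<^sub>R g x - (\<gamma>(Sup K) - \<gamma>(Inf K)))"
    have "(\<Sum>(x, k)\<in>p. measure lborel k *\<^sub>R g x) - (\<gamma> b - \<gamma> a) = (\<Sum>q\<in>p. w q)"
      by (simp add: tel w_def sum_subtractf[symmetric] case_prod_unfold)
    also have "\<dots> = (\<Sum>q\<in>good. w q) + (\<Sum>q\<in>bad. w q)"
      using pu by (metis sum.union_disjoint)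
    finally have eq: "(\<Sum>(x, k)\<in>p. measure lborel k *\<^sub>R g x) - (\<gamma> b - \<gamma> a) = \<dots>" .
    \<comment> \<open>Each interval is cut at its tag, and both halves are compared with the
      derivative there; the two errors add up to at most \<open>e1\<close> times the length.\<close>
    have "norm (\<Sum>q\<in>good. w q) \<le> (\<Sum>q\<in>good. e1 * (case q of (x,K) \<Rightarrow> Sup K - Inf K))"
    proof (rule sum_norm_le)
      fix q assume q: "q \<in> good"
      obtain x K where xK: "q = (x, K)" by (cases q)
      with q have xp: "(x, K) \<in> p" and xN: "x \<notin> N" by (auto simp: good_def)
      from K[OF xp] obtain u v where uv: "K = {u..v}" "u \<le> v" "x \<in> K" "a \<le> u" "v \<le> b"
        "Inf K = u" "Sup K = v" "measure lborel K = v - u" by blast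
      have "K \<subseteq> ball x (d x)" using fineD[OF fine xp] xN by (simp add: G_def)
      then have "u \<in> ball x (d x)" "v \<in> ball x (d x)" using uv(1,2) subsetD by (metis atLeastAtMost_iff order_refl)+
      then have "norm (u - x) < d x" "norm (v - x) < d x" by (auto simp: dist_real_def)
      then have "norm (\<gamma> u - \<gamma> x - (u-x) *\<^sub>R g x) \<le> e1 * norm (u-x)"
        "norm (\<gamma> v - \<gamma> x - (v-x) *\<^sub>R g x) \<le> e1 * norm (v-x)"
        using dd[of x u] dd[of x v] uv xN by auto
      moreover have "w q = (\<gamma> u - \<gamma> x - (u-x) *\<^sub>R g x) - (\<gamma> v - \<gamma> x - (v-x) *\<^sub>R g x)"
        using uv by (simp add: w_def xK algebra_simps)
      ultimately have "norm (w q) \<le> e1 * norm (u-x) + e1 * norm (v-x)"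
        by (metis add_mono norm_triangle_ineq4 order_trans)
      also have "\<dots> = e1 * (v - u)" using uv by (auto simp: algebra_simps)
      finally show "norm (w q) \<le> e1 * (case q of (x,K) \<Rightarrow> Sup K - Inf K)" using uv xK by simp
    qed
    also have "\<dots> \<le> (\<Sum>q\<in>p. e1 * (case q of (x,K) \<Rightarrow> Sup K - Inf K))"
    proof (rule sum_mono2[OF fin])
      show "0 \<le> e1 * (case q of (x, K) \<Rightarrow> Sup K - Inf K)" if "q \<in> p - good" for q
        using K[of "fst q" "snd q"] that e1 by (auto simp: case_prod_unfold)
    qed (use pu in auto)
    also have "\<dots> = e1 * (b - a)" by (simp add: tel sum_distrib_left)
    also note e1(2)
    finally have 1: "norm (\<Sum>q\<in>good. w q) < e / 2" .
    \<comment> \<open>At a bad tag \<open>g\<close> is zero by \<open>gN\<close>, so only the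
      increment of \<open>\<gamma>\<close> remains.\<close>
    have "norm (\<Sum>q\<in>bad. w q) \<le> (\<Sum>q\<in>bad. dist (\<gamma> (Inf (snd q))) (\<gamma> (Sup (snd q))))"
    proof (rule sum_norm_le)
      fix q assume "q \<in> bad"
      then show "norm (w q) \<le> dist (\<gamma> (Inf (snd q))) (\<gamma> (Sup (snd q)))"
        using gN by (auto simp: bad_def w_def case_prod_unfold dist_norm norm_minus_commute)
    qed
    also have "\<dots> < e / 2"
    proof (rule ac[THEN spec, THEN spec, THEN spec, THEN mp, THEN mp, THEN mp, THEN mp])
      show "finite bad" by (rule pu)
      have Kb: "\<exists>u v. snd q = {u..v} \<and> u \<le> v \<and> fst q \<in> snd q \<and> a \<le> u \<and> v \<le> b \<and> Inf (snd q) = u \<and> Sup (snd q) = v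
         \<and> measure lborel (snd q) = v - u \<and> snd q \<subseteq> U"
        if "q \<in> bad" for q
      proof -
        have q: "(fst q, snd q) \<in> p" "fst q \<in> N" using that by (auto simp: bad_def)
        then have "snd q \<subseteq> U" using fineD[OF fine q(1)] r(2)[OF q(2)] by (simp add: G_def)
        then show ?thesis using K[OF q(1)] by blast
      qed
      show "\<forall>i\<in>bad. Inf (snd i) \<le> Sup (snd i) \<and> {Inf (snd i)..Sup (snd i)} \<subseteq> {a..b}"
        using Kb by fastforce
      have int: "interior (snd i) = {Inf (snd i)<..<Sup (snd i)}" if "i \<in> bad" for i
        using Kb[OF that] by (metis interior_atLeastAtMost_real)
      show dj: "\<forall>i\<in>bad. \<forall>j\<in>bad. i \<noteq> j \<longrightarrow>
          {Inf (snd i)<..<Sup (snd i)} \<inter> {Inf (snd j)<..<Sup (snd j)} = {}"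
      proof (intro ballI impI)
        fix i j assume ij: "i \<in> bad" "j \<in> bad" "i \<noteq> j"
        have "interior (snd i) \<inter> interior (snd j) = {}"
          using tagged_division_ofD(5)[OF pt, of "fst i" "snd i" "fst j" "snd j"] ij
          by (auto simp: bad_def prod_eq_iff)
        then show "{Inf (snd i)<..<Sup (snd i)} \<inter> {Inf (snd j)<..<Sup (snd j)} = {}"
          using int ij by simp
      qed
      \<comment> \<open>The open interiors are disjoint and lie in \<open>U\<close>, so their total
        length is at most the measure of \<open>U\<close>, hence below
        \<open>\<delta>\<close>.\<close>
      have "(\<Sum>i\<in>bad. Sup (snd i) - Inf (snd i)) = (\<Sum>i\<in>bad. measure lebesgue {Inf (snd i)<..<Sup (snd i)})"
        using Kb by (intro sum.cong) fastforce+
      also have "\<dots> = measure lebesgue (\<Union>i\<in>bad. {Inf (snd i)<..<Sup (snd i)})"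
      proof (rule measure_finite_Union[symmetric])
        show "emeasure lebesgue {Inf (snd i)<..<Sup (snd i)} \<noteq> \<infinity>" for i :: "real \<times> real set"
          by (cases "Inf (snd i) \<le> Sup (snd i)") auto
      qed (use pu dj in \<open>auto simp: disjoint_family_on_def\<close>)
      also have "\<dots> \<le> measure lebesgue U"
      proof (rule measure_mono_fmeasurable)
        show "(\<Union>i\<in>bad. {Inf (snd i)<..<Sup (snd i)}) \<subseteq> U"
          using Kb by fastforce
      qed (use Um pu in auto)
      also note Um(2)
      finally show "(\<Sum>i\<in>bad. Sup (snd i) - Inf (snd i)) < \<delta>" .
    qed
    finally have 2: "norm (\<Sum>q\<in>bad. w q) < e / 2" .
    show "norm ((\<Sum>(x, k)\<in>p. measure lborel k *\<^sub>R g x) - (\<gamma> b - \<gamma> a)) < e"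
      unfolding eq using norm_triangle_lt[of "\<Sum>q\<in>good. w q" "\<Sum>q\<in>bad. w q" e] 1 2 by linarith
  qed
qed

lemma ftc_abs_continuous:
  fixes \<gamma> :: "real \<Rightarrow> 'a::banach"
  assumes "a \<le> b" and ac: "abs_continuous_on {a..b} \<gamma>" and N: "negligible N"
    and deriv: "\<And>x. x \<in> {a..b} - N \<Longrightarrow> (\<gamma> has_vector_derivative g x) (at x within {a..b})"
  shows "(g has_integral (\<gamma> b - \<gamma> a)) {a..b}"
proof (rule has_integral_spike[OF N])
  show "((\<lambda>x. if x \<in> N then 0 else g x) has_integral (\<gamma> b - \<gamma> a)) {a..b}"
    by (rule ftc_abs_continuous_strong[OF \<open>a \<le> b\<close> ac N]) (use deriv in auto)
qed auto

text \<open>The integral of \<open>g\<close> over a subinterval is the increment of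
  \<open>\<gamma>\<close>. On an interval shorter than the \<open>\<delta>\<close> belonging to
  \<open>\<epsilon> = 1\<close> these increments have norms of sum below \<open>1\<close> for every
  division, and an integrable function whose indefinite integral has bounded variation is absolutely
  integrable.\<close>

lemma abs_continuous_deriv_absolutely_integrable_short:
  fixes \<gamma> :: "real \<Rightarrow> 'a::euclidean_space"
  assumes ac: "abs_continuous_on S \<gamma>" and N: "negligible N"
  shows "\<exists>\<delta>>0. \<forall>a b. a \<le> b \<longrightarrow> b - a < \<delta> \<longrightarrow> {a..b} \<subseteq> S \<longrightarrow>
    (\<forall>x \<in> {a..b} - N. (\<gamma> has_vector_derivative g x) (at x within {a..b})) \<longrightarrow>
    g absolutely_integrable_on {a..b}"
proof -
  from abs_continuous_on_finite_family[OF ac zero_less_one, where ?'i="real set"]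
  obtain \<delta> where \<delta>: "\<delta> > 0" and
    d: "\<forall>(I::(real set) set) l u. finite I \<longrightarrow> (\<forall>i\<in>I. l i \<le> u i \<and> {l i..u i} \<subseteq> S) \<longrightarrow>
        (\<forall>i\<in>I. \<forall>j\<in>I. i \<noteq> j \<longrightarrow> {l i<..<u i} \<inter> {l j<..<u j} = {}) \<longrightarrow>
        (\<Sum>i\<in>I. u i - l i) < \<delta> \<longrightarrow> (\<Sum>i\<in>I. dist (\<gamma> (l i)) (\<gamma> (u i))) < 1"
    by (elim exE conjE) (rule that)
  show ?thesis
  proof (intro exI[of _ \<delta>] conjI allI impI \<delta>)
    fix a b assume ab: "a \<le> b" "b - a < \<delta>" "{a..b} \<subseteq> S"
      and der: "\<forall>x \<in> {a..b} - N. (\<gamma> has_vector_derivative g x) (at x within {a..b})"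
    have ftc: "(g has_integral (\<gamma> v - \<gamma> u)) {u..v}" if "u \<le> v" "a \<le> u" "v \<le> b" for u v
    proof (rule ftc_abs_continuous[OF \<open>u \<le> v\<close> _ N])
      show "abs_continuous_on {u..v} \<gamma>"
        by (rule abs_continuous_on_subset[OF ac]) (use ab that in auto)
      show "(\<gamma> has_vector_derivative g x) (at x within {u..v})" if "x \<in> {u..v} - N" for x
      proof (rule has_vector_derivative_within_subset)
        show "(\<gamma> has_vector_derivative g x) (at x within {a..b})"
          using that \<open>a \<le> u\<close> \<open>v \<le> b\<close> by (intro der[rule_format]) simp
        show "{u..v} \<subseteq> {a..b}" using \<open>a \<le> u\<close> \<open>v \<le> b\<close> by simp
      qed
    qed
    show "g absolutely_integrable_on {a..b}"
      unfolding box_real(2)[symmetric]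
    proof (rule bounded_variation_absolutely_integrable_interval)
      show "g integrable_on cbox a b" using ftc[of a b] ab by auto
      fix D assume D: "D division_of cbox a b"
      then have fin: "finite D" by blast
      have K: "\<exists>u v. K = {u..v} \<and> u \<le> v \<and> a \<le> u \<and> v \<le> b \<and> Inf K = u \<and> Sup K = v \<and> measure lborel K = v - u"
        if KD: "K \<in> D" for K
      proof -
        obtain u v where uv: "K = cbox u v" using division_ofD(4)[OF D KD] by blast
        have "K \<noteq> {}" "K \<subseteq> cbox a b" using division_ofD(2,3)[OF D KD] by auto
        then show ?thesis using uv by (intro exI[of _ u] exI[of _ v]) auto
      qed
      have "(\<Sum>K\<in>D. norm (integral K g)) = (\<Sum>K\<in>D. dist (\<gamma> (Inf K)) (\<gamma> (Sup K)))"
      proof (rule sum.cong[OF refl])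
        fix k assume "k \<in> D"
        then show "norm (integral k g) = dist (\<gamma> (Inf k)) (\<gamma> (Sup k))"
          using K[of k] ftc by (metis dist_commute dist_norm integral_unique)
      qed
      also have "\<dots> < 1"
      proof (rule d[THEN spec, THEN spec, THEN spec, THEN mp, THEN mp, THEN mp, THEN mp, OF fin])
        show "\<forall>i\<in>D. Inf i \<le> Sup i \<and> {Inf i..Sup i} \<subseteq> S" using K ab(3) by fastforce
        show "\<forall>i\<in>D. \<forall>j\<in>D. i \<noteq> j \<longrightarrow> {Inf i<..<Sup i} \<inter> {Inf j<..<Sup j} = {}"
        proof (intro ballI impI)
          fix i j assume ij: "i \<in> D" "j \<in> D" "i \<noteq> j"
          then have "interior i \<inter> interior j = {}" using D by (meson division_ofD(5))
          then show "{Inf i<..<Sup i} \<inter> {Inf j<..<Sup j} = {}"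
            using K[OF ij(1)] K[OF ij(2)] by (metis interior_atLeastAtMost_real)
        qed
        have "(\<Sum>i\<in>D. Sup i - Inf i) = (\<Sum>i\<in>D. measure lborel i)" using K by (intro sum.cong) fastforce+
        also have "\<dots> = measure lborel (cbox a b)" using additive_content_division[OF D] .
        finally show "(\<Sum>i\<in>D. Sup i - Inf i) < \<delta>" using ab by simp
      qed
      finally show "(\<Sum>K\<in>D. norm (integral K g)) \<le> 1" by simp
    qed
  qed
qed

text \<open>The interval is cut into \<open>n\<close> equal pieces shorter than the
  \<open>\<delta>\<close> of the local version, which are then joined one by one.\<close>

lemma abs_continuous_deriv_absolutely_integrable:
  fixes \<gamma> :: "real \<Rightarrow> 'a::euclidean_space"
  assumes ab: "a \<le> b" and ac: "abs_continuous_on {a..b} \<gamma>" and N: "negligible N"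
    and deriv: "\<And>x. x \<in> {a..b} - N \<Longrightarrow> (\<gamma> has_vector_derivative g x) (at x within {a..b})"
  shows "g absolutely_integrable_on {a..b}"
proof -
  from abs_continuous_deriv_absolutely_integrable_short[OF ac N, of g]
  obtain \<delta> where \<delta>: "\<delta> > 0" and
    s: "\<And>u v. \<lbrakk>u \<le> v; v - u < \<delta>; {u..v} \<subseteq> {a..b};
       \<forall>x \<in> {u..v} - N. (\<gamma> has_vector_derivative g x) (at x within {u..v})\<rbrakk> \<Longrightarrow>
    g absolutely_integrable_on {u..v}" by blast
  obtain m :: nat where m: "(b - a) / \<delta> < m" using reals_Archimedean2 by blast
  define n where "n = Suc m"
  have n: "(b - a) / n < \<delta>" "n > 0"
    using m \<delta> by (auto simp: n_def field_simps intro: less_trans)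
  define c where "c i = a + real i * ((b - a) / n)" for i
  have c0: "c 0 = a" and cn: "c n = b" using n by (auto simp: c_def)
  have cb: "c i \<le> b" if "i \<le> n" for i
  proof -
    have "real i * ((b - a) / n) \<le> real n * ((b - a) / n)"
      using that ab by (intro mult_right_mono) auto
    then show ?thesis using n by (simp add: c_def)
  qed
  have ca: "a \<le> c i" for i using ab by (simp add: c_def)
  have step: "c (Suc i) - c i = (b - a) / n" for i by (simp only: c_def of_nat_Suc) algebra
  have "(b - a) / n \<ge> 0" using ab by simp
  then have cs: "c i \<le> c (Suc i)" "c (Suc i) - c i < \<delta>" for i
    using n(1) step[of i] by linarith+
  have "i \<le> n \<Longrightarrow> g absolutely_integrable_on {a..c i}" for i
  proof (induction i)
    case 0 then show ?case by (simp add: c0 absolutely_integrable_negligible)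
  next
    case (Suc i)
    have "g absolutely_integrable_on {c i..c (Suc i)}"
    proof (rule s)
      show sub: "{c i..c (Suc i)} \<subseteq> {a..b}" using ca[of i] cb[OF Suc.prems] by auto
      show "\<forall>x \<in> {c i..c (Suc i)} - N. (\<gamma> has_vector_derivative g x) (at x within {c i..c (Suc i)})"
        using deriv sub has_vector_derivative_within_subset by (metis Diff_iff subsetD)
    qed (use cs in auto)
    then show ?case using Suc cs ca absolutely_integrable_on_combine by (metis Suc_leD)
  qed
  from this[of n] show ?thesis using cn by simp
qed


section \<open>Existence of horizontal curves and bounds in terms of their length\<close>

lemma lipschitz_imp_abs_continuous_on:
  assumes "\<And>s t. s \<in> S \<Longrightarrow> t \<in> S \<Longrightarrow> dist (\<gamma> s) (\<gamma> t) \<le> B * \<bar>t - s\<bar>"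
  shows "abs_continuous_on S \<gamma>"
  unfolding abs_continuous_on_def
proof (intro allI impI)
  fix \<epsilon> :: real assume \<epsilon>: "\<epsilon> > 0"
  define K where "K = \<bar>B\<bar> + 1"
  have K: "K > 0" "B \<le> K" by (auto simp: K_def)
  show "\<exists>\<delta>>0. \<forall>(n::nat) l u. (\<forall>i<n. l i \<le> u i \<and> {l i..u i} \<subseteq> S) \<longrightarrow>
        (\<forall>i<n. \<forall>j<n. i \<noteq> j \<longrightarrow> {l i<..<u i} \<inter> {l j<..<u j} = {}) \<longrightarrow>
        (\<Sum>i<n. u i - l i) < \<delta> \<longrightarrow> (\<Sum>i<n. dist (\<gamma> (l i)) (\<gamma> (u i))) < \<epsilon>"
  proof (intro exI[of _ "\<epsilon> / K"] conjI allI impI)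
    show "\<epsilon> / K > 0" using \<epsilon> K by simp
    fix n :: nat and l u :: "nat \<Rightarrow> real"
    assume lu: "\<forall>i<n. l i \<le> u i \<and> {l i..u i} \<subseteq> S" and s: "(\<Sum>i<n. u i - l i) < \<epsilon> / K"
    have "(\<Sum>i<n. dist (\<gamma> (l i)) (\<gamma> (u i))) \<le> (\<Sum>i<n. K * (u i - l i))"
    proof (rule sum_mono)
      fix i assume "i \<in> {..<n}"
      then have i: "l i \<le> u i" "{l i..u i} \<subseteq> S" using lu by auto
      then have "dist (\<gamma> (l i)) (\<gamma> (u i)) \<le> B * \<bar>u i - l i\<bar>" by (intro assms) auto
      also have "\<dots> \<le> K * (u i - l i)" using i K by (simp add: mult_right_mono)
      finally show "dist (\<gamma> (l i)) (\<gamma> (u i)) \<le> K * (u i - l i)" .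
    qed
    also have "\<dots> = K * (\<Sum>i<n. u i - l i)" by (simp only: sum_distrib_left)
    also have "\<dots> < \<epsilon>" using s K by (simp add: pos_less_divide_eq mult.commute)
    finally show "(\<Sum>i<n. dist (\<gamma> (l i)) (\<gamma> (u i))) < \<epsilon>" .
  qed
qed

lemma C1_imp_abs_continuous_on:
  fixes \<gamma> :: "real \<Rightarrow> 'a::euclidean_space"
  assumes d: "\<And>t. t \<in> {a..b} \<Longrightarrow> (\<gamma> has_vector_derivative g t) (at t within {a..b})"
    and c: "continuous_on {a..b} g"
  shows "abs_continuous_on {a..b} \<gamma>"
proof -
  have "bounded (g ` {a..b})" using c by (intro compact_imp_bounded compact_continuous_image) auto
  then obtain B where B: "\<And>t. t \<in> {a..b} \<Longrightarrow> norm (g t) \<le> B" unfolding bounded_iff by blast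
  show ?thesis
  proof (rule lipschitz_imp_abs_continuous_on[of _ _ B])
    fix s t assume st: "s \<in> {a..b}" "t \<in> {a..b}"
    have "norm (\<gamma> s - \<gamma> t) \<le> B * norm (s - t)"
    proof (rule differentiable_bound[of "{a..b}" \<gamma> "\<lambda>x h. h *\<^sub>R g x"])
      show "(\<gamma> has_derivative (\<lambda>h. h *\<^sub>R g x)) (at x within {a..b})" if "x \<in> {a..b}" for x
        using d[OF that] by (simp add: has_vector_derivative_def)
      show "onorm (\<lambda>h. h *\<^sub>R g x) \<le> B" if "x \<in> {a..b}" for x
        by (rule onorm_le) (use mult_left_mono[OF B[OF that] abs_ge_zero] in \<open>simp add: mult.commute\<close>)
    qed (use st in auto)
    then show "dist (\<gamma> s) (\<gamma> t) \<le> B * \<bar>t - s\<bar>" by (simp add: dist_norm abs_minus_commute)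
  qed
qed

text \<open>The horizontal plane is the kernel of the contact form
  \<open>dz - (x dy - y dx) / 2\<close>.\<close>

lemma horizontal_iff:
  "v \<in> span {heis_X p, heis_Y p} \<longleftrightarrow> snd (snd v) = (fst p * fst (snd v) - fst (snd p) * fst v) / 2"
proof -
  obtain x y z where p: "p = (x, y, z)" by (cases p)
  obtain v1 v2 v3 where v: "v = (v1, v2, v3)" by (cases v)
  have "v \<in> span {heis_X p, heis_Y p} \<longleftrightarrow> (\<exists>\<alpha> \<beta>. v = \<alpha> *\<^sub>R heis_X p + \<beta> *\<^sub>R heis_Y p)"
    by (auto simp: span_insert span_singleton algebra_simps)
  also have "\<dots> \<longleftrightarrow> v3 = (x * v2 - y * v1) / 2"
    by (auto simp: p v field_simps)
  finally show ?thesis by (simp add: p v)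
qed

text \<open>The first two coordinates of \<open>X\<close> and \<open>Y\<close> form the standard
  basis of the plane, so the coefficients of a horizontal vector are its own first two
  coordinates.\<close>

lemma horizontal_norm_eq:
  assumes "v \<in> span {heis_X p, heis_Y p}"
  shows "horizontal_norm p v = norm (fst v, fst (snd v))"
proof -
  obtain x y z where p: "p = (x, y, z)" by (cases p)
  obtain v1 v2 v3 where v: "v = (v1, v2, v3)" by (cases v)
  have "v3 = (x * v2 - y * v1) / 2" using assms[unfolded horizontal_iff] by (simp add: p v)
  then have "(\<exists>\<alpha> \<beta>. v = \<alpha> *\<^sub>R heis_X p + \<beta> *\<^sub>R heis_Y p \<and> r = sqrt (\<alpha>\<^sup>2 + \<beta>\<^sup>2)) \<longleftrightarrow> r = sqrt (v1\<^sup>2 + v2\<^sup>2)"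
    for r by (auto simp: p v field_simps)
  then show ?thesis by (simp add: horizontal_norm_def v norm_Pair)
qed

text \<open>This makes the set of lengths in \<open>cc_dist\<close> nonempty; the infimum of the
  empty set of reals is an unspecified number, and a bound on it would say nothing.\<close>

lemma horizontal_curve_ex:
  "\<exists>\<gamma>. horizontal_curve \<gamma> \<and> \<gamma> 0 = a \<and> \<gamma> 1 = b"
proof -
  obtain x y z where a: "a = (x, y, z)" by (cases a)
  obtain x' y' z' where b: "b = (x', y', z')" by (cases b)
  txt \<open>The loops \<open>t - t\<^sup>2\<close> and \<open>t - 3 t\<^sup>2 + 2 t\<^sup>3\<close> added to the two coordinates of a segment enclose
    a nonzero signed area proportional to \<open>q\<close>, so \<open>q\<close> can be adjusted to reach the height \<open>z'\<close>.\<close>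
  define u v where "u = x' - x" and "v = y' - y"
  \<comment> \<open>The solution of \<open>p3 1 = z'\<close>. At time \<open>1\<close> the bracket
    multiplied by \<open>q\<close> in the last line of \<open>p3\<close> is
    \<open>- 2 / 3 + 1 - 2 / 5 = - 1 / 15\<close>, whence the factor \<open>15\<close>.\<close>
  define q where "q = 15 * (v / 3 + x * v - y * u - 2 * (z' - z))"
  define p1 where "p1 t = x + u * t + t - t^2" for t :: real
  define p2 where "p2 t = y + v * t + q * (t - 3 * t^2 + 2 * t^3)" for t :: real
  \<comment> \<open>The antiderivative, with value \<open>z\<close> at time \<open>0\<close>, of the
    third speed \<open>g3\<close> that horizontality dictates.\<close>
  define p3 where "p3 t = z + (x * (p2 t - y) - y * (p1 t - x) + u * q * (t^4 - t^3) + v * t^3 / 3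
     + q * (- 2 * t^3 / 3 + t^4 - 2 * t^5 / 5)) / 2" for t :: real
  define g1 where "g1 t = u + 1 - 2 * t" for t :: real
  define g2 where "g2 t = v + q * (1 - 6 * t + 6 * t^2)" for t :: real
  define g3 where "g3 t = (p1 t * g2 t - p2 t * g1 t) / 2" for t :: real
  have d1: "(p1 has_vector_derivative g1 t) (at t within S)" for t S
    unfolding has_real_derivative_iff_has_vector_derivative[symmetric] p1_def g1_def
    by (rule derivative_eq_intros refl | simp)+
  have d2: "(p2 has_vector_derivative g2 t) (at t within S)" for t S
    unfolding has_real_derivative_iff_has_vector_derivative[symmetric] p2_def g2_def
    by (rule derivative_eq_intros refl | simp)+
  have d3: "(p3 has_vector_derivative g3 t) (at t within S)" for t S
    unfolding has_real_derivative_iff_has_vector_derivative[symmetric] p3_def g3_def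
    apply (rule derivative_eq_intros refl d1[unfolded has_real_derivative_iff_has_vector_derivative[symmetric]]
       d2[unfolded has_real_derivative_iff_has_vector_derivative[symmetric]] | simp)+
    apply (simp add: g1_def g2_def p1_def p2_def field_simps)
    apply algebra
    done
  define \<gamma> where "\<gamma> t = (p1 t, p2 t, p3 t)" for t
  have d: "(\<gamma> has_vector_derivative (g1 t, g2 t, g3 t)) (at t within S)" for t S
    unfolding \<gamma>_def by (intro has_vector_derivative_Pair d1 d2 d3)
  have "horizontal_curve \<gamma>"
    unfolding horizontal_curve_def
  proof
    show "abs_continuous_on {0..1} \<gamma>"
      by (rule C1_imp_abs_continuous_on[OF d])
        (auto simp: g1_def g2_def g3_def p1_def p2_def intro!: continuous_intros)
    have "vector_derivative \<gamma> (at t within {0..1}) = (g1 t, g2 t, g3 t)" if "t \<in> {0..1}" for t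
      using vector_derivative_within_cbox[of 0 1 t \<gamma> "(g1 t, g2 t, g3 t)"] that d by simp
    then show "AE t in lebesgue. t \<in> {0..1} \<longrightarrow>
        \<gamma> differentiable (at t within {0..1}) \<and>
        vector_derivative \<gamma> (at t within {0..1}) \<in> span {heis_X (\<gamma> t), heis_Y (\<gamma> t)}"
      using d unfolding horizontal_iff by (intro AE_I2 impI conjI)
        (auto simp: \<gamma>_def g3_def intro: differentiableI_vector)
  qed
  moreover have "\<gamma> 0 = a" by (simp add: \<gamma>_def p1_def p2_def p3_def a)
  moreover have "\<gamma> 1 = b"
    by (simp add: \<gamma>_def p1_def p2_def p3_def b u_def v_def q_def field_simps)
  ultimately show ?thesis by blast
qed

text \<open>The horizontal coordinates move no faster than the horizontal speed, so along the whole
  curve they stay within \<open>L\<close> of the start. The third expression is the last coordinate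
  of the endpoint after the start has been translated to the neutral element. Its speed is at most
  \<open>L\<close> times the horizontal speed, which integrates to \<open>L\<^sup>2\<close>.\<close>

lemma horizontal_length_bounds:
  assumes h: "horizontal_curve \<gamma>" and e: "\<gamma> 0 = (x, y, z)" "\<gamma> 1 = (x', y', z')"
    and L: "horizontal_length \<gamma> = L"
  shows "\<bar>x' - x\<bar> \<le> L" "\<bar>y' - y\<bar> \<le> L" "\<bar>z' - z - (x * y' - y * x') / 2\<bar> \<le> L\<^sup>2"
proof -
  define g where "g t = vector_derivative \<gamma> (at t within {0..1})" for t
  have ac: "abs_continuous_on {0..1} \<gamma>" using h by (simp add: horizontal_curve_def)
  have "AE t in lebesgue. t \<in> {0..1} \<longrightarrow> \<gamma> differentiable (at t within {0..1}) \<and>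
        g t \<in> span {heis_X (\<gamma> t), heis_Y (\<gamma> t)}"
    using h by (simp add: horizontal_curve_def g_def)
  then obtain N where N: "N \<in> null_sets lebesgue" and
    NN: "{t \<in> space lebesgue. \<not> (t \<in> {0..1} \<longrightarrow> \<gamma> differentiable (at t within {0..1}) \<and>
        g t \<in> span {heis_X (\<gamma> t), heis_Y (\<gamma> t)})} \<subseteq> N"
    unfolding eventually_ae_filter by blast
  have neg: "negligible N" using N by (simp add: negligible_iff_null_sets)
  have dg: "(\<gamma> has_vector_derivative g t) (at t within {0..1})" if "t \<in> {0..1} - N" for t
    using NN that by (auto simp: g_def vector_derivative_works)
  have sp: "g t \<in> span {heis_X (\<gamma> t), heis_Y (\<gamma> t)}" if "t \<in> {0..1} - N" for t
    using NN that by auto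
  have ig: "(g has_integral (\<gamma> s - \<gamma> 0)) {0..s}" if "0 \<le> s" "s \<le> 1" for s
  proof (rule ftc_abs_continuous[OF that(1) _ neg])
    show "abs_continuous_on {0..s} \<gamma>" by (rule abs_continuous_on_subset[OF ac]) (use that in auto)
    show "(\<gamma> has_vector_derivative g t) (at t within {0..s})" if "t \<in> {0..s} - N" for t
      by (rule has_vector_derivative_within_subset[OF dg]) (use that \<open>s \<le> 1\<close> in auto)
  qed
  have ag: "g absolutely_integrable_on {0..1}"
    by (rule abs_continuous_deriv_absolutely_integrable[OF _ ac neg dg]) auto
  define \<rho> where "\<rho> t = norm (fst (g t), fst (snd (g t)))" for t
  have a\<rho>: "\<rho> absolutely_integrable_on {0..1}"
  proof -
    have "bounded_linear (\<lambda>v::heis. (fst v, fst (snd v)))"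
      by (intro bounded_linear_Pair bounded_linear_fst bounded_linear_fst_comp bounded_linear_snd)
    from absolutely_integrable_norm[OF absolutely_integrable_linear[OF ag this]]
    show ?thesis by (simp add: \<rho>_def[abs_def] o_def)
  qed
  have i\<rho>: "\<rho> integrable_on {0..1}" using a\<rho> by (rule absolutely_integrable_on_def[THEN iffD1, THEN conjunct1])
  have \<rho>0: "\<rho> t \<ge> 0" for t by (simp add: \<rho>_def)
  have \<rho>1: "\<bar>fst (g t)\<bar> \<le> \<rho> t" "\<bar>fst (snd (g t))\<bar> \<le> \<rho> t" for t
    using norm_fst_le[of "fst (g t)" "fst (snd (g t))"] norm_snd_le[of "fst (snd (g t))" "fst (g t)"]
    by (auto simp: \<rho>_def)
  have Li: "L = integral {0..1} \<rho>"
  proof -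
    have eq: "horizontal_norm (\<gamma> t) (g t) = \<rho> t" if "t \<in> {0..1} - N" for t
      using horizontal_norm_eq[OF sp[OF that]] by (simp add: \<rho>_def)
    \<comment> \<open>Absolute integrability comes first, because a Lebesgue integral that does not
      exist has the default value zero and would not dominate anything.\<close>
    have "(\<lambda>t. horizontal_norm (\<gamma> t) (g t)) absolutely_integrable_on {0..1}"
      by (rule absolutely_integrable_spike[OF a\<rho> neg]) (use eq in auto)
    then have "L = integral {0..1} (\<lambda>t. horizontal_norm (\<gamma> t) (g t))"
      by (simp add: L[symmetric] horizontal_length_def g_def set_lebesgue_integral_eq_integral(2))
    also have "\<dots> = integral {0..1} \<rho>"
      by (rule integral_spike[OF neg]) (use eq in auto)
    finally show ?thesis .
  qed
  have sub: "\<bar>fst (\<gamma> s) - x\<bar> \<le> L \<and> \<bar>fst (snd (\<gamma> s)) - y\<bar> \<le> L" if s: "0 \<le> s" "s \<le> 1" for s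
  proof -
    have i\<rho>s: "\<rho> integrable_on {0..s}"
      by (rule integrable_on_subinterval[OF i\<rho>]) (use s in auto)
    have le: "integral {0..s} \<rho> \<le> L"
      unfolding Li by (rule integral_subset_le) (use s i\<rho> i\<rho>s \<rho>0 in auto)
    have "((\<lambda>t. fst (g t)) has_integral fst (\<gamma> s - \<gamma> 0)) {0..s}"
      using has_integral_linear[OF ig[OF s] bounded_linear_fst] by (simp add: o_def)
    then have "\<bar>fst (\<gamma> s - \<gamma> 0)\<bar> \<le> integral {0..s} \<rho>"
      using integral_norm_bound_integral[of "\<lambda>t. fst (g t)" "{0..s}" \<rho>] i\<rho>s \<rho>1
      by (auto simp: integral_unique has_integral_integrable)
    moreover have "((\<lambda>t. fst (snd (g t))) has_integral fst (snd (\<gamma> s - \<gamma> 0))) {0..s}"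
      using has_integral_linear[OF ig[OF s] bounded_linear_fst_comp[OF bounded_linear_snd]] by (simp add: o_def)
    then have "\<bar>fst (snd (\<gamma> s - \<gamma> 0))\<bar> \<le> integral {0..s} \<rho>"
      using integral_norm_bound_integral[of "\<lambda>t. fst (snd (g t))" "{0..s}" \<rho>] i\<rho>s \<rho>1
      by (auto simp: integral_unique has_integral_integrable)
    ultimately show ?thesis using le e by auto
  qed
  show "\<bar>x' - x\<bar> \<le> L" "\<bar>y' - y\<bar> \<le> L" using sub[of 1] e by auto
  \<comment> \<open>The speed of the last coordinate of the translated curve. By horizontality it
    involves only the displacement from the start; \<open>k'\<close> is set to zero on the null set
    where horizontality is not known.\<close>
  define k where "k t = snd (snd (g t)) - (x * fst (snd (g t)) - y * fst (g t)) / 2" for t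
  define A where "A = z' - z - (x * y' - y * x') / 2"
  have kint: "(k has_integral A) {0..1}"
  proof -
    have bl: "bounded_linear (\<lambda>v::heis. snd (snd v) - (x * fst (snd v) - y * fst v) / 2)"
      by (intro bounded_linear_sub bounded_linear_divide[THEN bounded_linear_compose] bounded_linear_const_mult
         bounded_linear_fst bounded_linear_fst_comp bounded_linear_snd_comp bounded_linear_snd)
    show ?thesis
      using has_integral_linear[OF ig[of 1] bl] by (simp add: o_def k_def[abs_def] e A_def algebra_simps diff_divide_distrib)
  qed
  define k' where "k' t = (if t \<in> N then 0 else k t)" for t
  have k'int: "(k' has_integral A) {0..1}"
    by (rule has_integral_spike[OF neg _ kint]) (auto simp: k'_def)
  have "norm (k' t) \<le> L * \<rho> t" if t: "t \<in> {0..1}" for t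
  proof (cases "t \<in> N")
    case True
    have "0 \<le> L" using sub[of 0] by auto
    with True show ?thesis using \<rho>0[of t] by (simp add: k'_def)
  next
    case False
    obtain c1 c2 c3 where c: "\<gamma> t = (c1, c2, c3)" by (cases "\<gamma> t")
    obtain v1 v2 v3 where v: "g t = (v1, v2, v3)" by (cases "g t")
    have v3: "v3 = (c1 * v2 - c2 * v1) / 2" using sp[of t, unfolded horizontal_iff] t False by (simp add: c v)
    have b: "\<bar>c1 - x\<bar> \<le> L" "\<bar>c2 - y\<bar> \<le> L" "\<bar>v1\<bar> \<le> \<rho> t" "\<bar>v2\<bar> \<le> \<rho> t"
      using sub[of t] \<rho>1[of t] t c v by auto
    have "k' t = ((c1 - x) * v2 - (c2 - y) * v1) / 2"
      using False by (simp add: k'_def k_def v v3 algebra_simps diff_divide_distrib)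
    also have "\<bar>\<dots>\<bar> \<le> (\<bar>c1 - x\<bar> * \<bar>v2\<bar> + \<bar>c2 - y\<bar> * \<bar>v1\<bar>) / 2"
      using abs_triangle_ineq4[of "(c1 - x) * v2" "(c2 - y) * v1"] by (simp add: abs_mult)
    also have "\<dots> \<le> (L * \<rho> t + L * \<rho> t) / 2"
      using b by (intro divide_right_mono add_mono mult_mono) auto
    finally show ?thesis by simp
  qed
  then have "norm (integral {0..1} k') \<le> integral {0..1} (\<lambda>t. L * \<rho> t)"
    using k'int i\<rho> by (intro integral_norm_bound_integral) (auto intro: has_integral_integrable integrable_on_mult_right)
  then show "\<bar>z' - z - (x * y' - y * x') / 2\<bar> \<le> L\<^sup>2"
    using k'int by (simp add: integral_unique A_def Li[symmetric] power2_eq_square)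
qed

text \<open>Passing from \<open>C\<close> to \<open>C + 1\<close> provides an actual curve, as the
  infimum need not be known to be attained.\<close>

lemma cc_dist_bounds:
  assumes "cc_dist (x, y, z) (x', y', z') \<le> C"
  shows "\<bar>x' - x\<bar> \<le> C + 1" "\<bar>y' - y\<bar> \<le> C + 1" "\<bar>z' - z - (x * y' - y * x') / 2\<bar> \<le> (C + 1)\<^sup>2"
proof -
  let ?S = "{horizontal_length \<gamma> | \<gamma>. horizontal_curve \<gamma> \<and> \<gamma> 0 = (x, y, z) \<and> \<gamma> 1 = (x', y', z')}"
  have "?S \<noteq> {}" using horizontal_curve_ex[of "(x, y, z)" "(x', y', z')"] by blast
  moreover have "Inf ?S < C + 1" using assms unfolding cc_dist_def by linarith
  ultimately obtain \<gamma> where \<gamma>: "horizontal_curve \<gamma>" "\<gamma> 0 = (x, y, z)" "\<gamma> 1 = (x', y', z')"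
      "horizontal_length \<gamma> < C + 1"
    using cInf_lessD[of ?S "C + 1"] by blast
  note b = horizontal_length_bounds[OF \<gamma>(1-3) refl]
  show "\<bar>x' - x\<bar> \<le> C + 1" "\<bar>y' - y\<bar> \<le> C + 1" using b \<gamma>(4) by auto
  have "(horizontal_length \<gamma>)\<^sup>2 \<le> (C + 1)\<^sup>2" using b(1) \<gamma>(4) by (intro power_mono) auto
  then show "\<bar>z' - z - (x * y' - y * x') / 2\<bar> \<le> (C + 1)\<^sup>2" using b(3) by linarith
qed

section \<open>The law of Heisenberg Brownian motion at a fixed time\<close>

lemma heis_mult_eq:
  "a \<odot> b = (fst a + fst b, fst (snd a) + fst (snd b),
     snd (snd a) + snd (snd b) + (fst a * fst (snd b) - fst (snd a) * fst b) / 2)"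
  by (cases a; cases b) simp

lemma continuous_on_heis_mult: "continuous_on S (\<lambda>b. a \<odot> b)"
  unfolding heis_mult_eq by (intro continuous_intros) auto

lemma measurable_heis_coords [measurable]:
  "(fst :: heis \<Rightarrow> real) \<in> borel_measurable borel"
  "(\<lambda>p::heis. fst (snd p)) \<in> borel_measurable borel"
  "(\<lambda>p::heis. snd (snd p)) \<in> borel_measurable borel"
  by (intro borel_measurable_continuous_onI continuous_intros)+

lemma measurable_heis_mult [measurable]:
  assumes [measurable]: "f \<in> borel_measurable M" "g \<in> borel_measurable M"
  shows "(\<lambda>x. f x \<odot> g x) \<in> borel_measurable M"
proof -
  have [measurable]: "(\<lambda>x. fst (f x)) \<in> borel_measurable M" "(\<lambda>x. fst (snd (f x))) \<in> borel_measurable M"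
    "(\<lambda>x. snd (snd (f x))) \<in> borel_measurable M" "(\<lambda>x. fst (g x)) \<in> borel_measurable M"
    "(\<lambda>x. fst (snd (g x))) \<in> borel_measurable M" "(\<lambda>x. snd (snd (g x))) \<in> borel_measurable M"
    by (rule measurable_compose[OF assms(1)] measurable_compose[OF assms(2)], rule measurable_heis_coords)+
  show ?thesis unfolding heis_mult_eq by (intro borel_measurable_Pair) measurable
qed

lemma integrable_mult_square:
  fixes f g :: "'a \<Rightarrow> real"
  assumes [measurable]: "f \<in> borel_measurable M" "g \<in> borel_measurable M"
    and "integrable M (\<lambda>x. (f x)\<^sup>2)" "integrable M (\<lambda>x. (g x)\<^sup>2)"
  shows "integrable M (\<lambda>x. f x * g x)"
proof (rule Bochner_Integration.integrable_bound[of M "\<lambda>x. (f x)\<^sup>2 + (g x)\<^sup>2"])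
  show "integrable M (\<lambda>x. (f x)\<^sup>2 + (g x)\<^sup>2)" using assms by simp
  show "AE x in M. norm (f x * g x) \<le> norm ((f x)\<^sup>2 + (g x)\<^sup>2)"
  proof (intro AE_I2)
    fix x
    have "2 * \<bar>f x * g x\<bar> \<le> (f x)\<^sup>2 + (g x)\<^sup>2"
      using sum_squares_bound[of "\<bar>f x\<bar>" "\<bar>g x\<bar>"] by (simp add: abs_mult)
    then show "norm (f x * g x) \<le> norm ((f x)\<^sup>2 + (g x)\<^sup>2)" by simp
  qed
qed measurable

text \<open>The indicator of an open set \<open>U\<close> is the pointwise limit of the continuous
  functions \<open>min 1 (n * infdist x (- U))\<close>, so the measures agree on open sets, and
  these form a generator stable under intersection.\<close>

lemma prob_borel_measure_eqI:
  fixes \<mu> \<nu> :: "'a::metric_space measure"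
  assumes "prob_space \<mu>" "prob_space \<nu>" and sets: "sets \<mu> = sets borel" "sets \<nu> = sets borel"
    and eq: "\<And>f :: 'a \<Rightarrow> real. \<lbrakk>continuous_on UNIV f; \<And>x. 0 \<le> f x; \<And>x. f x \<le> 1\<rbrakk> \<Longrightarrow>
        (\<integral>x. f x \<partial>\<mu>) = (\<integral>x. f x \<partial>\<nu>)"
  shows "\<mu> = \<nu>"
proof -
  interpret \<mu>: prob_space \<mu> by fact
  interpret \<nu>: prob_space \<nu> by fact
  have [measurable_cong]: "sets \<mu> = sets borel" "sets \<nu> = sets borel" by fact+
  have open_eq: "emeasure \<mu> U = emeasure \<nu> U" if U: "open U" for U
  \<comment> \<open>The whole space is treated apart: its complement is empty, and
    \<open>infdist\<close> to the empty set is zero by convention.\<close>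
  proof (cases "U = UNIV")
    case True
    then show ?thesis using \<mu>.emeasure_space_1 \<nu>.emeasure_space_1 sets_eq_imp_space_eq[OF sets(1)]
      sets_eq_imp_space_eq[OF sets(2)] by simp
  next
    case False
    define f where "f n x = min 1 (real n * infdist x (- U))" for n x
    have fc: "continuous_on UNIV (f n)" for n
      unfolding f_def by (intro continuous_intros)
    have f01: "0 \<le> f n x" "f n x \<le> 1" for n x
      by (auto simp: f_def infdist_nonneg)
    have lim: "(\<lambda>n. f n x) \<longlonglongrightarrow> indicator U x" for x
    proof (cases "x \<in> U")
      case True
      have "closed (- U)" using U by (rule closed_Compl)
      then have pos: "infdist x (- U) > 0"
        using in_closed_iff_infdist_zero[of "- U" x] False True infdist_nonneg[of x "- U"] by fastforce
      obtain N :: nat where N: "1 / infdist x (- U) < N" using reals_Archimedean2 by blast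
      have "\<forall>\<^sub>F n in sequentially. f n x = indicator U x"
      proof (rule eventually_sequentiallyI[of N])
        fix n assume "N \<le> n"
        then have "1 / infdist x (- U) < real n" using N by linarith
        then have "1 < real n * infdist x (- U)" using pos by (simp add: field_simps)
        then show "f n x = indicator U x" using True by (simp add: f_def)
      qed
      then show ?thesis by (rule tendsto_eventually)
    next
      case nU: False
      then have "infdist x (- U) = 0" by (intro infdist_zero) simp
      then show ?thesis using nU by (simp add: f_def)
    qed
    have *: "(\<lambda>n. \<integral>x. f n x \<partial>M) \<longlonglongrightarrow> measure M U" if M: "prob_space M" "sets M = sets borel" for M
    proof -
      interpret M: prob_space M by (rule M)
      have [measurable_cong]: "sets M = sets borel" by (rule M)
      have "(\<lambda>n. \<integral>x. f n x \<partial>M) \<longlonglongrightarrow> (\<integral>x. indicator U x \<partial>M)"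
      proof (rule integral_dominated_convergence[where w="\<lambda>_. 1"])
        show "f n \<in> borel_measurable M" for n
          using borel_measurable_continuous_onI[OF fc] by measurable
        show "(indicator U :: 'a \<Rightarrow> real) \<in> borel_measurable M"
          by (rule borel_measurable_indicator) (use U M(2) in auto)
      qed (use lim f01 in auto)
      moreover have "(\<integral>x. indicator U x \<partial>M) = measure M U"
        using U M(2) by (simp add: sets_eq_imp_space_eq[OF M(2)])
      ultimately show ?thesis by simp
    qed
    have "(\<lambda>n. \<integral>x. f n x \<partial>\<mu>) = (\<lambda>n. \<integral>x. f n x \<partial>\<nu>)"
      using eq[OF fc f01] by blast
    then have "measure \<mu> U = measure \<nu> U"
      using *[OF assms(1) sets(1)] *[OF assms(2) sets(2)] by (metis LIMSEQ_unique)
    then show ?thesis by (simp add: \<mu>.emeasure_eq_measure \<nu>.emeasure_eq_measure)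
  qed
  show ?thesis
  proof (rule measure_eqI_generator_eq[where E="{U. open U}" and \<Omega>=UNIV and A="\<lambda>_. UNIV"])
    show "Int_stable {U::'a set. open U}" by (auto simp: Int_stable_def)
    show "sets \<mu> = sigma_sets UNIV {U. open U}" "sets \<nu> = sigma_sets UNIV {U. open U}"
      using sets by (simp_all add: sets_borel)
  qed (use open_eq \<mu>.emeasure_finite in auto)
qed

text \<open>Borel--Cantelli with the summable bounds \<open>(1/2)^k\<close>. The result is a
  threshold \<open>R\<close> above which every \<open>r\<close> works, rather than one subsequence,
  so that several convergences can be realised along a common sequence.\<close>

lemma (in prob_space) tendsto_prob_imp_AE_subseq:
  fixes S :: "nat \<Rightarrow> 'a \<Rightarrow> real"
  assumes S[measurable]: "\<And>n. S n \<in> borel_measurable M" and [measurable]: "I \<in> borel_measurable M"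
    and conv: "\<And>\<epsilon>. \<epsilon> > 0 \<Longrightarrow> \<exists>n0. \<forall>n\<ge>n0. prob {\<omega> \<in> space M. \<bar>S n \<omega> - I \<omega>\<bar> > \<epsilon>} < \<epsilon>"
  shows "\<exists>R :: nat \<Rightarrow> nat. \<forall>r. (\<forall>k. R k \<le> r k) \<longrightarrow> (AE \<omega> in M. (\<lambda>k. S (r k) \<omega>) \<longlonglongrightarrow> I \<omega>)"
proof -
  have "\<forall>k::nat. \<exists>n0. \<forall>n\<ge>n0. prob {\<omega> \<in> space M. \<bar>S n \<omega> - I \<omega>\<bar> > (1/2)^k} < (1/2)^k"
    using conv by simp
  then obtain R :: "nat \<Rightarrow> nat" where
    R: "\<And>k n. n \<ge> R k \<Longrightarrow> prob {\<omega> \<in> space M. \<bar>S n \<omega> - I \<omega>\<bar> > (1/2)^k} < (1/2)^k" by metis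
  show ?thesis
  proof (intro exI[of _ R] allI impI)
    fix r :: "nat \<Rightarrow> nat" assume r: "\<forall>k. R k \<le> r k"
    define A where "A k = {\<omega> \<in> space M. \<bar>S (r k) \<omega> - I \<omega>\<bar> > (1/2)^k}" for k
    have "AE \<omega> in M. \<forall>\<^sub>F k in sequentially. \<omega> \<in> space M - A k"
    proof (rule borel_cantelli_AE1)
      show "A k \<in> sets M" for k unfolding A_def by measurable
      show "summable (\<lambda>k. prob (A k))"
        by (rule summable_comparison_test'[of "\<lambda>k. (1/2::real)^k" 0])
          (use R r in \<open>auto simp: A_def less_imp_le intro: summable_geometric\<close>)
    qed (simp add: emeasure_eq_measure)
    then show "AE \<omega> in M. (\<lambda>k. S (r k) \<omega>) \<longlonglongrightarrow> I \<omega>"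
    proof eventually_elim
      case (elim \<omega>)
      have "(\<lambda>k. (1/2::real)^k) \<longlonglongrightarrow> 0" by (rule LIMSEQ_power_zero) simp
      moreover have "\<forall>\<^sub>F k in sequentially. norm (S (r k) \<omega> - I \<omega>) \<le> (1/2)^k"
        using elim by eventually_elim (auto simp: A_def)
      ultimately have "(\<lambda>k. S (r k) \<omega> - I \<omega>) \<longlonglongrightarrow> 0"
        by (rule Lim_null_comparison[rotated])
      then show ?case by (simp add: LIM_zero_iff)
    qed
  qed
qed

section \<open>Gaussian moments of Brownian increments\<close>

lemma std_brownian_motionD:
  assumes "std_brownian_motion M W"
  shows "prob_space M" "\<And>t. t \<ge> 0 \<Longrightarrow> W t \<in> borel_measurable M" "AE \<omega> in M. W 0 \<omega> = 0"
    "\<And>s t. 0 \<le> s \<Longrightarrow> s < t \<Longrightarrow>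
        distributed M lborel (\<lambda>\<omega>. W t \<omega> - W s \<omega>) (normal_density 0 (sqrt (t - s)))"
    "\<And>n \<tau>. 0 \<le> \<tau> 0 \<Longrightarrow> (\<forall>i<n. \<tau> i \<le> \<tau> (Suc i)) \<Longrightarrow>
        prob_space.indep_vars M (\<lambda>_. borel) (\<lambda>i \<omega>. W (\<tau> (Suc i)) \<omega> - W (\<tau> i) \<omega>) {..<n::nat}"
  using assms unfolding std_brownian_motion_def by blast+

lemma has_bochner_integral_normal_moment:
  assumes "distributed M lborel X (normal_density 0 \<sigma>)" "\<sigma> > 0"
    "has_bochner_integral lborel (\<lambda>x. normal_density 0 \<sigma> x * x ^ k) c"
  shows "has_bochner_integral M (\<lambda>\<omega>. X \<omega> ^ k) c"
  using assms distributed_integral[OF assms(1), of "\<lambda>x. x ^ k"] distributed_integrable[OF assms(1), of "\<lambda>x. x ^ k"]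
  by (simp add: has_bochner_integral_iff normal_density_nonneg)

lemma brownian_increment_moments:
  assumes W: "std_brownian_motion M W" and st: "0 \<le> s" "s < t"
  shows "has_bochner_integral M (\<lambda>\<omega>. W t \<omega> - W s \<omega>) 0"
    "has_bochner_integral M (\<lambda>\<omega>. (W t \<omega> - W s \<omega>)\<^sup>2) (t - s)"
    "has_bochner_integral M (\<lambda>\<omega>. (W t \<omega> - W s \<omega>) ^ 4) (3 * (t - s)\<^sup>2)"
proof -
  have \<sigma>: "sqrt (t - s) > 0" using st by simp
  note D = std_brownian_motionD(4)[OF W st]
  note H = has_bochner_integral_normal_moment[OF D \<sigma>]
  show "has_bochner_integral M (\<lambda>\<omega>. W t \<omega> - W s \<omega>) 0"
    using H[of 1 0] normal_moment_odd[OF \<sigma>, of 0 0] by simp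
  show "has_bochner_integral M (\<lambda>\<omega>. (W t \<omega> - W s \<omega>)\<^sup>2) (t - s)"
    using H[of 2 "t - s"] normal_moment_even[OF \<sigma>, of 0 1] st by (simp add: diff_divide_distrib)
  have "fact 4 / ((2 / (t - s))\<^sup>2 * fact 2) = 3 * (t - s)\<^sup>2"
    using st by (simp add: fact_numeral field_simps power2_eq_square)
  then show "has_bochner_integral M (\<lambda>\<omega>. (W t \<omega> - W s \<omega>) ^ 4) (3 * (t - s)\<^sup>2)"
    using H[of 4 "3 * (t - s)\<^sup>2"] normal_moment_even[OF \<sigma>, of 0 2] st by simp
qed

lemma brownian_moments:
  assumes W: "std_brownian_motion M W" and t: "0 < t"
  shows "has_bochner_integral M (W t) 0"
    "has_bochner_integral M (\<lambda>\<omega>. (W t \<omega>)\<^sup>2) t"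
    "has_bochner_integral M (\<lambda>\<omega>. (W t \<omega>) ^ 4) (3 * t\<^sup>2)"
proof -
  note [measurable] = std_brownian_motionD(2)[OF W] 
  have [measurable]: "W 0 \<in> borel_measurable M" "W t \<in> borel_measurable M" using t by auto
  have ae: "AE \<omega> in M. W t \<omega> - W 0 \<omega> = W t \<omega>" using std_brownian_motionD(3)[OF W] by auto
  note m = brownian_increment_moments[OF W order_refl t]
  show "has_bochner_integral M (W t) 0"
    using m(1) ae by (subst (asm) has_bochner_integral_cong_AE[where g="W t"]) auto
  show "has_bochner_integral M (\<lambda>\<omega>. (W t \<omega>)\<^sup>2) t"
    using m(2) ae by (subst (asm) has_bochner_integral_cong_AE[where g="\<lambda>\<omega>. (W t \<omega>)\<^sup>2"]) auto
  show "has_bochner_integral M (\<lambda>\<omega>. (W t \<omega>) ^ 4) (3 * t\<^sup>2)"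
    using m(3) ae by (subst (asm) has_bochner_integral_cong_AE[where g="\<lambda>\<omega>. (W t \<omega>) ^ 4"]) auto
qed

section \<open>Approximation of the canonical process by random walks in the group\<close>

definition incr :: "real \<Rightarrow> nat \<Rightarrow> (real \<Rightarrow> 'w \<Rightarrow> real) \<Rightarrow> 'w \<Rightarrow> nat \<Rightarrow> real" where
  "incr t n W \<omega> i = W (t * real (Suc i) / real n) \<omega> - W (t * real i / real n) \<omega>"

text \<open>Left-endpoint sum for the Ito integral, expressed through increments alone so that it
  becomes a function of two finite Gaussian vectors.\<close>

definition riemann :: "nat \<Rightarrow> (nat \<Rightarrow> real) \<Rightarrow> (nat \<Rightarrow> real) \<Rightarrow> real" where
  "riemann n u v = (\<Sum>i<n. (\<Sum>j<i. u j) * v i)"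

text \<open>This is the group product of the \<open>n\<close> horizontal steps
  \<open>(u i, v i, 0)\<close>, taken in order.\<close>

definition heis_walk :: "nat \<Rightarrow> (nat \<Rightarrow> real) \<Rightarrow> (nat \<Rightarrow> real) \<Rightarrow> heis" where
  "heis_walk n u v = (\<Sum>i<n. u i, \<Sum>i<n. v i, (riemann n u v - riemann n v u) / 2)"

lemma sum_incr: "(\<Sum>j<i. incr t n W \<omega> j) = W (t * real i / real n) \<omega> - W 0 \<omega>"
  unfolding incr_def using sum_lessThan_telescope[of "\<lambda>j. W (t * real j / real n) \<omega>" i] by simp

lemma measurable_incr:
  assumes "std_brownian_motion M W" "t > 0"
  shows "(\<lambda>\<omega>. incr t n W \<omega> i) \<in> borel_measurable M"
  unfolding incr_def using assms
  by (intro borel_measurable_diff std_brownian_motionD(2)) (auto intro: divide_nonneg_nonneg)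

lemma measurable_riemann:
  assumes "std_brownian_motion M V" "std_brownian_motion M W" "t > 0"
  shows "(\<lambda>\<omega>. riemann n (incr t n V \<omega>) (incr t n W \<omega>)) \<in> borel_measurable M"
  unfolding riemann_def using assms
  by (intro borel_measurable_sum borel_measurable_times measurable_incr)

lemma riemann_tendsto_ito:
  assumes V: "std_brownian_motion M V" and W: "std_brownian_motion M W"
    and t: "t > 0" and I: "has_ito_integral M V W t I" and \<epsilon>: "\<epsilon> > 0"
  shows "\<exists>n0. \<forall>n\<ge>n0. measure M {\<omega> \<in> space M. \<bar>riemann n (incr t n V \<omega>) (incr t n W \<omega>) - I \<omega>\<bar> > \<epsilon>} < \<epsilon>"
proof -
  interpret prob_space M by (rule std_brownian_motionD[OF V])
  have Im[measurable]: "I \<in> borel_measurable M" using I by (simp add: has_ito_integral_def)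
  from I \<epsilon> obtain \<delta> where \<delta>: "\<delta> > 0" and lim: "\<forall>n (p :: nat \<Rightarrow> real).
        p 0 = 0 \<longrightarrow> p n = t \<longrightarrow> (\<forall>i<n. p i \<le> p (Suc i) \<and> p (Suc i) - p i < \<delta>) \<longrightarrow>
        measure M {\<omega> \<in> space M.
          \<bar>(\<Sum>i<n. V (p i) \<omega> * (W (p (Suc i)) \<omega> - W (p i) \<omega>)) - I \<omega>\<bar> > \<epsilon>} < \<epsilon>"
    unfolding has_ito_integral_def by blast
  obtain m :: nat where m: "t / \<delta> < m" using reals_Archimedean2 by blast
  show ?thesis
  proof (intro exI[of _ "Suc m"] allI impI)
    fix n assume n: "n \<ge> Suc m"
    then have n0: "n > 0" by simp
    have tn: "t / real n < \<delta>"
    proof -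
      have "t / \<delta> < real n" using m n by linarith
      then show ?thesis using \<delta> n0 by (simp add: field_simps)
    qed
    define p where "p i = t * real i / real n" for i
    have step: "p (Suc i) - p i = t / n" for i
      by (simp add: p_def distrib_left add_divide_distrib)
    have p0: "p i \<ge> 0" for i using t by (simp add: p_def)
    have tn0: "t / n \<ge> 0" using t by simp
    have "p i \<le> p (Suc i) \<and> p (Suc i) - p i < \<delta>" for i
      using step[of i] tn tn0 by linarith
    moreover have "p 0 = 0" "p n = t" using n0 by (auto simp: p_def)
    ultimately have "prob {\<omega> \<in> space M.
          \<bar>(\<Sum>i<n. V (p i) \<omega> * (W (p (Suc i)) \<omega> - W (p i) \<omega>)) - I \<omega>\<bar> > \<epsilon>} < \<epsilon>"
      using lim by blast
    \<comment> \<open>The integrand is \<open>V (p i) - V 0\<close> in \<open>riemann\<close> but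
      \<open>V (p i)\<close> in the definition of the integral; \<open>V 0\<close> vanishes only
      almost surely.\<close>
    moreover have "prob {\<omega> \<in> space M. \<bar>riemann n (incr t n V \<omega>) (incr t n W \<omega>) - I \<omega>\<bar> > \<epsilon>}
      = prob {\<omega> \<in> space M. \<bar>(\<Sum>i<n. V (p i) \<omega> * (W (p (Suc i)) \<omega> - W (p i) \<omega>)) - I \<omega>\<bar> > \<epsilon>}"
    proof (rule finite_measure_eq_AE)
      note [measurable] = std_brownian_motionD(2)[OF V p0] std_brownian_motionD(2)[OF W p0]
        measurable_riemann[OF V W t]
      show "{\<omega> \<in> space M. \<bar>riemann n (incr t n V \<omega>) (incr t n W \<omega>) - I \<omega>\<bar> > \<epsilon>} \<in> sets M"
        by measurable
      show "{\<omega> \<in> space M. \<bar>(\<Sum>i<n. V (p i) \<omega> * (W (p (Suc i)) \<omega> - W (p i) \<omega>)) - I \<omega>\<bar> > \<epsilon>} \<in> sets M"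
        by measurable
      show "AE \<omega> in M. \<omega> \<in> {\<omega> \<in> space M. \<bar>riemann n (incr t n V \<omega>) (incr t n W \<omega>) - I \<omega>\<bar> > \<epsilon>} \<longleftrightarrow>
         \<omega> \<in> {\<omega> \<in> space M. \<bar>(\<Sum>i<n. V (p i) \<omega> * (W (p (Suc i)) \<omega> - W (p i) \<omega>)) - I \<omega>\<bar> > \<epsilon>}"
        using std_brownian_motionD(3)[OF V]
        by eventually_elim (simp add: riemann_def sum_incr, simp add: incr_def p_def)
    qed
    ultimately show "prob {\<omega> \<in> space M. \<bar>riemann n (incr t n V \<omega>) (incr t n W \<omega>) - I \<omega>\<bar> > \<epsilon>} < \<epsilon>"
      by simp
  qed
qed

lemma riemann_AE_subseq:
  assumes V: "std_brownian_motion M V" and W: "std_brownian_motion M W"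
    and t: "t > 0" and I: "has_ito_integral M V W t I"
  shows "\<exists>R :: nat \<Rightarrow> nat. \<forall>r. (\<forall>k. R k \<le> r k) \<longrightarrow>
    (AE \<omega> in M. (\<lambda>k. riemann (r k) (incr t (r k) V \<omega>) (incr t (r k) W \<omega>)) \<longlonglongrightarrow> I \<omega>)"
proof -
  interpret prob_space M by (rule std_brownian_motionD[OF V])
  show ?thesis
    by (rule tendsto_prob_imp_AE_subseq[of "\<lambda>n \<omega>. riemann n (incr t n V \<omega>) (incr t n W \<omega>)"])
      (use riemann_tendsto_ito[OF V W t I] measurable_riemann[OF V W t] I in \<open>auto simp: has_ito_integral_def\<close>)
qed

abbreviation normal_vector :: "real \<Rightarrow> nat \<Rightarrow> (nat \<Rightarrow> real) measure" where
  "normal_vector t n \<equiv> PiM {..<n} (\<lambda>_. density lborel (normal_density 0 (sqrt (t / real n))))"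

text \<open>The increments become a function of the path over nonnegative times, which is the object
  whose independence \<open>indep_processes\<close> states.\<close>

lemma incr_path:
  "restrict (incr t n W \<omega>) {..<n} =
    (\<lambda>w. \<lambda>i\<in>{..<n}. w (t * real (Suc i) / real n) - w (t * real i / real n)) (\<lambda>s\<in>{0..}. W s \<omega>)"
  if "t > 0" using that by (auto simp: incr_def fun_eq_iff)

lemma distr_incr:
  assumes W: "std_brownian_motion M W" and t: "t > 0" and n: "n > 0"
  shows "distr M (PiM {..<n} (\<lambda>_. borel)) (\<lambda>\<omega>. restrict (incr t n W \<omega>) {..<n}) = normal_vector t n"
proof -
  interpret prob_space M by (rule std_brownian_motionD[OF W])
  define \<tau> where "\<tau> i = t * real i / real n" for i
  have step: "\<tau> (Suc i) - \<tau> i = t / n" for i by (simp add: \<tau>_def distrib_left add_divide_distrib)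
  have pos: "t / n > 0" using t n by simp
  have le: "\<tau> i < \<tau> (Suc i)" for i using step[of i] pos by linarith
  have "indep_vars (\<lambda>_. borel) (\<lambda>i \<omega>. W (\<tau> (Suc i)) \<omega> - W (\<tau> i) \<omega>) {..<n}"
    by (rule std_brownian_motionD(5)[OF W]) (use le in \<open>auto simp: \<tau>_def less_imp_le\<close>)
  then have iv: "indep_vars (\<lambda>_. borel) (\<lambda>i \<omega>. incr t n W \<omega> i) {..<n}"
    by (simp add: incr_def \<tau>_def)
  have "distr M (PiM {..<n} (\<lambda>_. borel)) (\<lambda>\<omega>. \<lambda>i\<in>{..<n}. incr t n W \<omega> i)
     = PiM {..<n} (\<lambda>i. distr M borel (\<lambda>\<omega>. incr t n W \<omega> i))"
    by (rule indep_vars_iff_distr_eq_PiM[THEN iffD1, OF _ _ iv])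
      (use n in \<open>auto intro: measurable_incr[OF W t]\<close>)
  also have "\<dots> = normal_vector t n"
  proof (rule PiM_cong[OF refl])
    fix i
    have "distributed M lborel (\<lambda>\<omega>. W (\<tau> (Suc i)) \<omega> - W (\<tau> i) \<omega>) (normal_density 0 (sqrt (\<tau> (Suc i) - \<tau> i)))"
      by (rule std_brownian_motionD(4)[OF W _ le]) (use t in \<open>auto simp: \<tau>_def\<close>)
    then have "distr M lborel (\<lambda>\<omega>. W (\<tau> (Suc i)) \<omega> - W (\<tau> i) \<omega>) = density lborel (normal_density 0 (sqrt (t / n)))"
      unfolding step by (rule distributed_distr_eq_density)
    moreover have "distr M lborel (\<lambda>\<omega>. W (\<tau> (Suc i)) \<omega> - W (\<tau> i) \<omega>) = distr M borel (\<lambda>\<omega>. incr t n W \<omega> i)"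
      by (rule distr_cong) (auto simp: incr_def \<tau>_def)
    ultimately show "distr M borel (\<lambda>\<omega>. incr t n W \<omega> i) = density lborel (normal_density 0 (sqrt (t / n)))"
      by simp
  qed
  finally show ?thesis .
qed

lemma indep_var_incr:
  assumes V: "std_brownian_motion M V" and W: "std_brownian_motion M W"
    and ind: "indep_processes M V W" and t: "t > 0"
  shows "prob_space.indep_var M (PiM {..<n} (\<lambda>_. borel)) (\<lambda>\<omega>. restrict (incr t n V \<omega>) {..<n})
    (PiM {..<n} (\<lambda>_. borel)) (\<lambda>\<omega>. restrict (incr t n W \<omega>) {..<n})"
proof -
  interpret prob_space M by (rule std_brownian_motionD[OF V])
  let ?Y = "\<lambda>w::real \<Rightarrow> real. \<lambda>i\<in>{..<n}. w (t * real (Suc i) / real n) - w (t * real i / real n)"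
  have Y: "?Y \<in> measurable (PiM {0..} (\<lambda>_. borel)) (PiM {..<n} (\<lambda>_. borel))"
  proof (rule measurable_restrict)
    fix i
    show "(\<lambda>w::real \<Rightarrow> real. w (t * real (Suc i) / real n) - w (t * real i / real n)) \<in> borel_measurable (PiM {0..} (\<lambda>_. borel))"
    proof (rule borel_measurable_diff)
      show "(\<lambda>w::real \<Rightarrow> real. w (t * real (Suc i) / real n)) \<in> borel_measurable (PiM {0..} (\<lambda>_. borel))"
        "(\<lambda>w::real \<Rightarrow> real. w (t * real i / real n)) \<in> borel_measurable (PiM {0..} (\<lambda>_. borel))"
        using t by (auto intro!: measurable_component_singleton)
    qed
  qed
  from indep_var_compose[OF ind[unfolded indep_processes_def] Y Y]
  show ?thesis unfolding o_def incr_path[OF t] .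
qed

lemma heis_walk_measurable:
  "(\<lambda>q. heis_walk n (fst q) (snd q)) \<in> borel_measurable (normal_vector t n \<Otimes>\<^sub>M normal_vector t n)"
proof -
  have "sets (normal_vector t n \<Otimes>\<^sub>M normal_vector t n)
     = sets (PiM {..<n} (\<lambda>_. borel :: real measure) \<Otimes>\<^sub>M PiM {..<n} (\<lambda>_. borel :: real measure))"
    by (intro sets_pair_measure_cong sets_PiM_cong) auto
  moreover have "(\<lambda>q. heis_walk n (fst q) (snd q)) \<in>
     borel_measurable (PiM {..<n} (\<lambda>_. borel :: real measure) \<Otimes>\<^sub>M PiM {..<n} (\<lambda>_. borel :: real measure))"
  proof -
    have [measurable]: "(\<lambda>q. fst q i) \<in> borel_measurable (PiM {..<n} (\<lambda>_. borel :: real measure) \<Otimes>\<^sub>M PiM {..<n} (\<lambda>_. borel :: real measure))"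
      "(\<lambda>q. snd q i) \<in> borel_measurable (PiM {..<n} (\<lambda>_. borel :: real measure) \<Otimes>\<^sub>M PiM {..<n} (\<lambda>_. borel :: real measure))"
      if "i < n" for i
      by (rule measurable_compose[OF measurable_fst measurable_component_singleton]
          measurable_compose[OF measurable_snd measurable_component_singleton], use that in simp)+
    have [measurable]: "(\<lambda>q. \<Sum>j<i. fst q j) \<in> borel_measurable (PiM {..<n} (\<lambda>_. borel :: real measure) \<Otimes>\<^sub>M PiM {..<n} (\<lambda>_. borel :: real measure))"
      "(\<lambda>q. \<Sum>j<i. snd q j) \<in> borel_measurable (PiM {..<n} (\<lambda>_. borel :: real measure) \<Otimes>\<^sub>M PiM {..<n} (\<lambda>_. borel :: real measure))"
      if "i \<le> n" for i using that by (auto intro!: borel_measurable_sum)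
    show ?thesis unfolding heis_walk_def riemann_def
      by (intro borel_measurable_Pair borel_measurable_divide borel_measurable_diff borel_measurable_sum
         borel_measurable_times) auto
  qed
  ultimately show ?thesis by (simp cong: measurable_cong_sets)
qed

text \<open>The right-hand side mentions neither \<open>M\<close> nor the two motions, which makes
  canonical processes on different probability spaces comparable.\<close>

lemma expectation_heis_walk:
  fixes f :: "heis \<Rightarrow> real"
  assumes V: "std_brownian_motion M V" and W: "std_brownian_motion M W"
    and ind: "indep_processes M V W" and t: "t > 0" and n: "n > 0" and f: "f \<in> borel_measurable borel"
  shows "(\<integral>\<omega>. f (heis_walk n (incr t n V \<omega>) (incr t n W \<omega>)) \<partial>M) =
    (\<integral>q. f (heis_walk n (fst q) (snd q)) \<partial>(normal_vector t n \<Otimes>\<^sub>M normal_vector t n))"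
proof -
  interpret prob_space M by (rule std_brownian_motionD[OF V])
  let ?B = "PiM {..<n} (\<lambda>_. borel :: real measure)"
  let ?V = "\<lambda>\<omega>. restrict (incr t n V \<omega>) {..<n}" and ?W = "\<lambda>\<omega>. restrict (incr t n W \<omega>) {..<n}"
  note iv = indep_var_incr[OF V W ind t, of n, unfolded indep_var_distribution_eq]
  have d: "normal_vector t n \<Otimes>\<^sub>M normal_vector t n = distr M (?B \<Otimes>\<^sub>M ?B) (\<lambda>\<omega>. (?V \<omega>, ?W \<omega>))"
    using iv distr_incr[OF V t n] distr_incr[OF W t n] by metis
  have hw: "heis_walk n (?V \<omega>) (?W \<omega>) = heis_walk n (incr t n V \<omega>) (incr t n W \<omega>)" for \<omega>
    unfolding heis_walk_def riemann_def by (auto intro!: sum.cong arg_cong2[where f="(-)"] arg_cong2[where f="(*)"])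
  have m: "(\<lambda>q. heis_walk n (fst q) (snd q)) \<in> borel_measurable (?B \<Otimes>\<^sub>M ?B)"
    using heis_walk_measurable[of n t] unfolding d by simp
  show ?thesis unfolding d
    by (subst integral_distr) (use iv in \<open>auto simp: hw intro!: measurable_compose[OF m f]\<close>)
qed

text \<open>The law of the canonical process at a fixed time is determined because it is a limit of laws of
  walks, which only involve independent Gaussian increments.\<close>

lemma canonical_heis_bm_walk_limit:
  assumes X: "canonical_heis_bm M X" and t: "t > 0"
  shows "\<exists>R :: nat \<Rightarrow> nat. \<forall>r f. (\<forall>k. R k \<le> r k \<and> 0 < r k) \<longrightarrow> continuous_on UNIV f \<longrightarrow>
     (\<forall>x. 0 \<le> f x \<and> f x \<le> (1::real)) \<longrightarrow>
     (\<lambda>k. \<integral>q. f (heis_walk (r k) (fst q) (snd q)) \<partial>(normal_vector t (r k) \<Otimes>\<^sub>M normal_vector t (r k)))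
        \<longlonglongrightarrow> (\<integral>\<omega>. f (X t \<omega>) \<partial>M)"
proof -
  from X t obtain V W I J where V: "std_brownian_motion M V" and W: "std_brownian_motion M W"
    and ind: "indep_processes M V W" and I: "has_ito_integral M V W t I" and J: "has_ito_integral M W V t J"
    and XX: "\<forall>\<omega>\<in>space M. X t \<omega> = (V t \<omega>, W t \<omega>, (I \<omega> - J \<omega>) / 2)"
    unfolding canonical_heis_bm_def by (metis less_imp_le)
  interpret prob_space M by (rule std_brownian_motionD[OF V])
  from riemann_AE_subseq[OF V W t I] obtain R1 :: "nat \<Rightarrow> nat" where R1: "\<And>r. (\<And>k. R1 k \<le> r k) \<Longrightarrow>
    (AE \<omega> in M. (\<lambda>k. riemann (r k) (incr t (r k) V \<omega>) (incr t (r k) W \<omega>)) \<longlonglongrightarrow> I \<omega>)" by blast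
  from riemann_AE_subseq[OF W V t J] obtain R2 :: "nat \<Rightarrow> nat" where R2: "\<And>r. (\<And>k. R2 k \<le> r k) \<Longrightarrow>
    (AE \<omega> in M. (\<lambda>k. riemann (r k) (incr t (r k) W \<omega>) (incr t (r k) V \<omega>)) \<longlonglongrightarrow> J \<omega>)" by blast
  \<comment> \<open>Above both thresholds the two Riemann sums converge almost surely along the same
    sequence, hence so does the walk.\<close>
  show ?thesis
  proof (intro exI[of _ "\<lambda>k. max (R1 k) (R2 k)"] allI impI)
    fix r :: "nat \<Rightarrow> nat" and f :: "heis \<Rightarrow> real"
    assume r: "\<forall>k. max (R1 k) (R2 k) \<le> r k \<and> 0 < r k" and f: "continuous_on UNIV f"
      and f01: "\<forall>x. 0 \<le> f x \<and> f x \<le> 1"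
    have fm[measurable]: "f \<in> borel_measurable borel" by (rule borel_measurable_continuous_onI[OF f])
    let ?S = "\<lambda>k \<omega>. heis_walk (r k) (incr t (r k) V \<omega>) (incr t (r k) W \<omega>)"
    have R1': "AE \<omega> in M. (\<lambda>k. riemann (r k) (incr t (r k) V \<omega>) (incr t (r k) W \<omega>)) \<longlonglongrightarrow> I \<omega>"
      by (rule R1) (use r in auto)
    have R2': "AE \<omega> in M. (\<lambda>k. riemann (r k) (incr t (r k) W \<omega>) (incr t (r k) V \<omega>)) \<longlonglongrightarrow> J \<omega>"
      by (rule R2) (use r in auto)
    have "AE \<omega> in M. (\<lambda>k. ?S k \<omega>) \<longlonglongrightarrow> X t \<omega>"
      using R1' R2' std_brownian_motionD(3)[OF V] std_brownian_motionD(3)[OF W] AE_space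
    proof eventually_elim
      case (elim \<omega>)
      have "t * real (r k) / real (r k) = t" for k using r by (metis nonzero_mult_div_cancel_right of_nat_0_less_iff less_irrefl)
      then have "(\<Sum>i<r k. incr t (r k) V \<omega> i) = V t \<omega>" "(\<Sum>i<r k. incr t (r k) W \<omega> i) = W t \<omega>" for k
        using elim by (simp_all add: sum_incr)
      then show ?case using elim XX unfolding heis_walk_def
        by (auto intro!: tendsto_intros)
    qed
    then have ae: "AE \<omega> in M. (\<lambda>k. f (?S k \<omega>)) \<longlonglongrightarrow> f (X t \<omega>)"
    proof eventually_elim
      case (elim \<omega>)
      then show ?case using f by (auto intro: continuous_on_tendsto_compose)
    qed
    have Sm: "?S k \<in> borel_measurable M" for k
      unfolding heis_walk_def using measurable_riemann[OF V W t] measurable_riemann[OF W V t]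
        measurable_incr[OF V t] measurable_incr[OF W t]
      by (intro borel_measurable_Pair borel_measurable_sum borel_measurable_divide borel_measurable_diff) auto
    have Xm: "X t \<in> borel_measurable M"
    proof -
      have "(\<lambda>\<omega>. (V t \<omega>, W t \<omega>, (I \<omega> - J \<omega>) / 2)) \<in> borel_measurable M"
        using I J t by (intro borel_measurable_Pair borel_measurable_divide borel_measurable_diff
            std_brownian_motionD(2)[OF V] std_brownian_motionD(2)[OF W]) (auto simp: has_ito_integral_def)
      then show ?thesis using XX by (simp cong: measurable_cong)
    qed
    have "(\<lambda>k. \<integral>\<omega>. f (?S k \<omega>) \<partial>M) \<longlonglongrightarrow> (\<integral>\<omega>. f (X t \<omega>) \<partial>M)"
    proof (rule integral_dominated_convergence[where w="\<lambda>_. 1"])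
      show "AE \<omega> in M. norm (f (?S k \<omega>)) \<le> 1" for k using f01 by (intro AE_I2) (metis abs_of_nonneg real_norm_def)
    qed (use ae measurable_compose[OF Sm fm] measurable_compose[OF Xm fm] in auto)
    then show "(\<lambda>k. \<integral>q. f (heis_walk (r k) (fst q) (snd q)) \<partial>(normal_vector t (r k) \<Otimes>\<^sub>M normal_vector t (r k)))
        \<longlonglongrightarrow> (\<integral>\<omega>. f (X t \<omega>) \<partial>M)"
      using expectation_heis_walk[OF V W ind t _ fm] r by simp
  qed
qed

lemma canonical_heis_bm_prob_space: "canonical_heis_bm M X \<Longrightarrow> prob_space M"
  unfolding canonical_heis_bm_def using std_brownian_motionD(1) by blast

lemma canonical_heis_bm_measurable:
  assumes X: "canonical_heis_bm M X" and t: "t \<ge> 0"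
  shows "X t \<in> borel_measurable M"
proof -
  from X t obtain V W I J where V: "std_brownian_motion M V" and W: "std_brownian_motion M W"
    and I: "has_ito_integral M V W t I" and J: "has_ito_integral M W V t J"
    and XX: "\<forall>\<omega>\<in>space M. X t \<omega> = (V t \<omega>, W t \<omega>, (I \<omega> - J \<omega>) / 2)"
    unfolding canonical_heis_bm_def by metis
  have "(\<lambda>\<omega>. (V t \<omega>, W t \<omega>, (I \<omega> - J \<omega>) / 2)) \<in> borel_measurable M"
    using I J t by (intro borel_measurable_Pair borel_measurable_divide borel_measurable_diff
        std_brownian_motionD(2)[OF V] std_brownian_motionD(2)[OF W]) (auto simp: has_ito_integral_def)
  then show ?thesis using XX by (simp cong: measurable_cong)
qed

text \<open>Along \<open>Suc (R1 k + R2 k)\<close>, which is positive and exceeds both thresholds,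
  the same sequence of walk expectations converges to the expectations under both processes.\<close>

lemma canonical_heis_bm_law_unique:
  assumes X: "canonical_heis_bm M X" and Y: "canonical_heis_bm N Y" and t: "t > 0"
  shows "distr M borel (X t) = distr N borel (Y t)"
proof (rule prob_borel_measure_eqI)
  interpret M: prob_space M by (rule canonical_heis_bm_prob_space[OF X])
  interpret N: prob_space N by (rule canonical_heis_bm_prob_space[OF Y])
  have mX[measurable]: "X t \<in> borel_measurable M" and mY[measurable]: "Y t \<in> borel_measurable N"
    by (rule canonical_heis_bm_measurable[OF X less_imp_le[OF t]] canonical_heis_bm_measurable[OF Y less_imp_le[OF t]])+
  show "prob_space (distr M borel (X t))" "prob_space (distr N borel (Y t))"
    by (rule M.prob_space_distr[OF mX] N.prob_space_distr[OF mY])+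
  fix f :: "heis \<Rightarrow> real" assume f: "continuous_on UNIV f" and f01: "\<And>x. 0 \<le> f x" "\<And>x. f x \<le> 1"
  have fm[measurable]: "f \<in> borel_measurable borel" by (rule borel_measurable_continuous_onI[OF f])
  from canonical_heis_bm_walk_limit[OF X t] obtain R1 :: "nat \<Rightarrow> nat" where
    R1: "\<And>r. (\<And>k. R1 k \<le> r k \<and> 0 < r k) \<Longrightarrow>
     (\<lambda>k. \<integral>q. f (heis_walk (r k) (fst q) (snd q)) \<partial>(normal_vector t (r k) \<Otimes>\<^sub>M normal_vector t (r k)))
        \<longlonglongrightarrow> (\<integral>\<omega>. f (X t \<omega>) \<partial>M)" using f f01 by meson
  from canonical_heis_bm_walk_limit[OF Y t] obtain R2 :: "nat \<Rightarrow> nat" where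
    R2: "\<And>r. (\<And>k. R2 k \<le> r k \<and> 0 < r k) \<Longrightarrow>
     (\<lambda>k. \<integral>q. f (heis_walk (r k) (fst q) (snd q)) \<partial>(normal_vector t (r k) \<Otimes>\<^sub>M normal_vector t (r k)))
        \<longlonglongrightarrow> (\<integral>\<omega>. f (Y t \<omega>) \<partial>N)" using f f01 by meson
  have "(\<integral>\<omega>. f (X t \<omega>) \<partial>M) = (\<integral>\<omega>. f (Y t \<omega>) \<partial>N)"
    by (rule LIMSEQ_unique[OF R1 R2, of "\<lambda>k. Suc (R1 k + R2 k)"]) auto
  then show "(\<integral>x. f x \<partial>distr M borel (X t)) = (\<integral>x. f x \<partial>distr N borel (Y t))"
    by (simp add: integral_distr)
qed auto

text \<open>Uniqueness of the law is what allows the definite description to be evaluated; any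
  canonical process may serve as its witness.\<close>

lemma heis_law_eq:
  fixes N :: "(real \<Rightarrow> heis) measure"
  assumes X: "canonical_heis_bm N X" and t: "t > 0"
  shows "heis_law t a = distr (distr N borel (X t)) borel (\<lambda>q. a \<odot> q)"
proof -
  have d: "distr N' borel (\<lambda>\<omega>. a \<odot> Y t \<omega>) = distr (distr N borel (X t)) borel (\<lambda>q. a \<odot> q)"
    if Y: "canonical_heis_bm N' Y" for N' :: "(real \<Rightarrow> heis) measure" and Y
  proof -
    note [measurable] = canonical_heis_bm_measurable[OF Y less_imp_le[OF t]]
    have "distr N' borel (\<lambda>\<omega>. a \<odot> Y t \<omega>) = distr (distr N' borel (Y t)) borel (\<lambda>q. a \<odot> q)"
      by (subst distr_distr) (auto simp: o_def)
    then show ?thesis using canonical_heis_bm_law_unique[OF Y X t] by simp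
  qed
  show ?thesis unfolding heis_law_def
    by (rule the_equality) (use d X in \<open>metis+\<close>)
qed

section \<open>Second moments of the Ito integrals and of the Levy area\<close>

lemma indep_incr_functionals:
  fixes f g :: "(nat \<Rightarrow> real) \<Rightarrow> real"
  assumes V: "std_brownian_motion M V" and W: "std_brownian_motion M W"
    and ind: "indep_processes M V W" and t: "t > 0"
    and f: "f \<in> borel_measurable (PiM {..<n} (\<lambda>_. borel))" "\<And>u. f (restrict u {..<n}) = f u"
    and g: "g \<in> borel_measurable (PiM {..<n} (\<lambda>_. borel))" "\<And>u. g (restrict u {..<n}) = g u"
  shows "prob_space.indep_var M borel (\<lambda>\<omega>. f (incr t n V \<omega>)) borel (\<lambda>\<omega>. g (incr t n W \<omega>))"
proof -
  interpret prob_space M by (rule std_brownian_motionD[OF V])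
  show ?thesis
    using indep_var_compose[OF indep_var_incr[OF V W ind t] f(1) g(1)] by (simp add: o_def f g)
qed

lemma measurable_sum_PiM:
  "i \<le> n \<Longrightarrow> (\<lambda>u. \<Sum>k<i::nat. u k) \<in> borel_measurable (PiM {..<n} (\<lambda>_. borel :: real measure))"
  by (intro borel_measurable_sum measurable_component_singleton) auto

lemma incr_mult_moments:
  assumes W: "std_brownian_motion M W" and t: "t > 0" and ij: "i < n" "j < n"
  shows "has_bochner_integral M (\<lambda>\<omega>. incr t n W \<omega> i * incr t n W \<omega> j) (if i = j then t / n else 0)"
proof -
  interpret prob_space M by (rule std_brownian_motionD[OF W])
  define \<tau> where "\<tau> i = t * real i / real n" for i
  have step: "\<tau> (Suc i) - \<tau> i = t / n" for i by (simp add: \<tau>_def distrib_left add_divide_distrib)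
  have pos: "t / n > 0" using t ij by simp
  have le: "\<tau> i < \<tau> (Suc i)" for i using step[of i] pos by linarith
  have \<tau>0: "0 \<le> \<tau> i" for i using t by (simp add: \<tau>_def)
  have eq: "incr t n W \<omega> i = W (\<tau> (Suc i)) \<omega> - W (\<tau> i) \<omega>" for \<omega> i by (simp add: incr_def \<tau>_def)
  note m = brownian_increment_moments[OF W \<tau>0 le, unfolded eq[symmetric] step]
  show ?thesis
  proof (cases "i = j")
    case True
    then show ?thesis using m(2)[of j] by (simp add: power2_eq_square)
  next
    case False
    have "indep_vars (\<lambda>_. borel) (\<lambda>i \<omega>. W (\<tau> (Suc i)) \<omega> - W (\<tau> i) \<omega>) {..<n}"
      by (rule std_brownian_motionD(5)[OF W]) (use le \<tau>0 in \<open>auto simp: less_imp_le\<close>)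
    then have iv: "indep_vars (\<lambda>_. borel) (\<lambda>i \<omega>. incr t n W \<omega> i) {i, j}"
      unfolding eq[symmetric] by (rule indep_vars_subset) (use ij in auto)
    have int: "integrable M (\<lambda>\<omega>. incr t n W \<omega> k)" for k
      using m(1)[of k] by (rule integrable.intros)
    have "integral\<^sup>L M (\<lambda>\<omega>. incr t n W \<omega> k) = 0" for k
      using m(1)[of k] by (rule has_bochner_integral_integral_eq)
    then have "(\<integral>\<omega>. (\<Prod>k\<in>{i,j}. incr t n W \<omega> k) \<partial>M) = 0"
      using indep_vars_lebesgue_integral[OF _ iv int] False by simp
    moreover have "integrable M (\<lambda>\<omega>. \<Prod>k\<in>{i,j}. incr t n W \<omega> k)"
      by (rule indep_vars_integrable[OF _ iv int]) simp
    ultimately show ?thesis using False by (simp add: has_bochner_integral_iff)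
  qed
qed

text \<open>A discrete Ito isometry, with an upper bound for the value. In the expanded square the
  factors from \<open>V\<close> are independent of those from \<open>W\<close>, whose increments are
  orthogonal, so only the diagonal survives. Each partial sum \<open>a i\<close> with
  \<open>i < n\<close> has second moment at most \<open>t\<close>.\<close>

lemma riemann_square_bound:
  assumes V: "std_brownian_motion M V" and W: "std_brownian_motion M W"
    and ind: "indep_processes M V W" and t: "t > 0" and n: "n > 0"
  shows "integrable M (\<lambda>\<omega>. (riemann n (incr t n V \<omega>) (incr t n W \<omega>))\<^sup>2)"
    "(\<integral>\<omega>. (riemann n (incr t n V \<omega>) (incr t n W \<omega>))\<^sup>2 \<partial>M) \<le> t\<^sup>2"
proof -
  interpret prob_space M by (rule std_brownian_motionD[OF V])
  define a where "a i \<omega> = (\<Sum>k<i. incr t n V \<omega> k)" for i \<omega>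
  define v where "v i \<omega> = incr t n W \<omega> i" for i \<omega>
  have am[measurable]: "a i \<in> borel_measurable M" for i
    unfolding a_def by (intro borel_measurable_sum measurable_incr[OF V t])
  have a2: "integrable M (\<lambda>\<omega>. (a i \<omega>)\<^sup>2) \<and> (\<integral>\<omega>. (a i \<omega>)\<^sup>2 \<partial>M) \<le> t" if "i < n" for i
  proof (cases "i = 0")
    case True then show ?thesis using t by (simp add: a_def)
  next
    case False
    have "0 < t * real i / real n" using False n t by simp
    from brownian_increment_moments(2)[OF V order_refl this]
    have "has_bochner_integral M (\<lambda>\<omega>. (a i \<omega>)\<^sup>2) (t * real i / real n)"
      by (simp add: a_def sum_incr)
    moreover have "t * real i / real n \<le> t" using t that by (simp add: field_simps)
    ultimately show ?thesis by (simp add: has_bochner_integral_iff)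
  qed
  have hb: "has_bochner_integral M (\<lambda>\<omega>. (a i \<omega> * a j \<omega>) * (v i \<omega> * v j \<omega>))
     (if i = j then (\<integral>\<omega>. (a i \<omega>)\<^sup>2 \<partial>M) * (t / n) else 0)" if ij: "i < n" "j < n" for i j
  proof -
    have iv: "indep_var borel (\<lambda>\<omega>. a i \<omega> * a j \<omega>) borel (\<lambda>\<omega>. v i \<omega> * v j \<omega>)"
      unfolding a_def v_def
    proof (rule indep_incr_functionals[OF V W ind t,
          where f="\<lambda>u. (\<Sum>k<i. u k) * (\<Sum>k<j. u k)" and g="\<lambda>u. u i * u j"])
      show "(\<lambda>u. (\<Sum>k<i. u k) * (\<Sum>k<j. u k)) \<in> borel_measurable (PiM {..<n} (\<lambda>_. borel :: real measure))"
        using ij by (intro borel_measurable_times measurable_sum_PiM) auto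
      show "(\<lambda>u. u i * u j) \<in> borel_measurable (PiM {..<n} (\<lambda>_. borel :: real measure))"
        using ij by (intro borel_measurable_times measurable_component_singleton) auto
    qed (use ij in auto)
    note vv = incr_mult_moments[OF W t ij, folded v_def]
    have i1: "integrable M (\<lambda>\<omega>. a i \<omega> * a j \<omega>)"
      using a2 ij by (intro integrable_mult_square am) auto
    have i2: "integrable M (\<lambda>\<omega>. v i \<omega> * v j \<omega>)" using vv by (rule integrable.intros)
    have "(\<integral>\<omega>. (a i \<omega> * a j \<omega>) * (v i \<omega> * v j \<omega>) \<partial>M) = (\<integral>\<omega>. a i \<omega> * a j \<omega> \<partial>M) * (if i = j then t / n else 0)"
      using indep_var_lebesgue_integral[OF iv i1 i2] has_bochner_integral_integral_eq[OF vv] by simp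
    then show ?thesis
      using indep_var_integrable[OF iv i1 i2] by (auto simp: has_bochner_integral_iff power2_eq_square)
  qed
  have eq: "(riemann n (incr t n V \<omega>) (incr t n W \<omega>))\<^sup>2 = (\<Sum>i<n. \<Sum>j<n. (a i \<omega> * a j \<omega>) * (v i \<omega> * v j \<omega>))" for \<omega>
    unfolding riemann_def a_def[symmetric] v_def[symmetric] power2_eq_square sum_product
    by (simp add: algebra_simps)
  have H: "has_bochner_integral M (\<lambda>\<omega>. (riemann n (incr t n V \<omega>) (incr t n W \<omega>))\<^sup>2)
     (\<Sum>i<n. \<Sum>j<n. if i = j then (\<integral>\<omega>. (a i \<omega>)\<^sup>2 \<partial>M) * (t / n) else 0)"
    unfolding eq by (intro has_bochner_integral_sum hb) auto
  show "integrable M (\<lambda>\<omega>. (riemann n (incr t n V \<omega>) (incr t n W \<omega>))\<^sup>2)"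
    using H by (rule integrable.intros)
  have "(\<integral>\<omega>. (riemann n (incr t n V \<omega>) (incr t n W \<omega>))\<^sup>2 \<partial>M) = (\<Sum>i<n. (\<integral>\<omega>. (a i \<omega>)\<^sup>2 \<partial>M) * (t / n))"
    using has_bochner_integral_integral_eq[OF H] by simp
  also have "\<dots> \<le> (\<Sum>i<n. t * (t / n))"
    using a2 t by (intro sum_mono mult_right_mono) auto
  also have "\<dots> = t\<^sup>2" using n by (simp add: power2_eq_square)
  finally show "(\<integral>\<omega>. (riemann n (incr t n V \<omega>) (incr t n W \<omega>))\<^sup>2 \<partial>M) \<le> t\<^sup>2" .
qed

text \<open>Convergence in probability does not by itself bound moments; Fatou's lemma along an
  almost surely convergent sequence of Riemann sums carries their uniform bound over to the
  limit.\<close>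

lemma ito_square_bound:
  assumes V: "std_brownian_motion M V" and W: "std_brownian_motion M W"
    and ind: "indep_processes M V W" and t: "t > 0" and I: "has_ito_integral M V W t I"
  shows "integrable M (\<lambda>\<omega>. (I \<omega>)\<^sup>2)" "(\<integral>\<omega>. (I \<omega>)\<^sup>2 \<partial>M) \<le> t\<^sup>2"
proof -
  interpret prob_space M by (rule std_brownian_motionD[OF V])
  have [measurable]: "I \<in> borel_measurable M" using I by (simp add: has_ito_integral_def)
  from riemann_AE_subseq[OF V W t I] obtain R :: "nat \<Rightarrow> nat" where R: "\<And>r. (\<And>k. R k \<le> r k) \<Longrightarrow>
    (AE \<omega> in M. (\<lambda>k. riemann (r k) (incr t (r k) V \<omega>) (incr t (r k) W \<omega>)) \<longlonglongrightarrow> I \<omega>)" by blast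
  define S where "S k \<omega> = riemann (Suc (R k)) (incr t (Suc (R k)) V \<omega>) (incr t (Suc (R k)) W \<omega>)" for k \<omega>
  have [measurable]: "S k \<in> borel_measurable M" for k
    unfolding S_def by (rule measurable_riemann[OF V W t])
  have lim: "AE \<omega> in M. (\<lambda>k. S k \<omega>) \<longlonglongrightarrow> I \<omega>"
    unfolding S_def by (rule R[of "\<lambda>k. Suc (R k)"]) simp
  have Sn: "(\<integral>\<^sup>+\<omega>. ennreal ((S k \<omega>)\<^sup>2) \<partial>M) \<le> ennreal (t\<^sup>2)" for k
    using riemann_square_bound[OF V W ind t, of "Suc (R k)"]
    by (subst nn_integral_eq_integral) (auto simp: S_def intro: ennreal_leI)
  have "(\<integral>\<^sup>+\<omega>. ennreal ((I \<omega>)\<^sup>2) \<partial>M) = (\<integral>\<^sup>+\<omega>. liminf (\<lambda>k. ennreal ((S k \<omega>)\<^sup>2)) \<partial>M)"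
  proof (rule nn_integral_cong_AE)
    show "AE \<omega> in M. ennreal ((I \<omega>)\<^sup>2) = liminf (\<lambda>k. ennreal ((S k \<omega>)\<^sup>2))"
      using lim
    proof eventually_elim
      case (elim \<omega>)
      then have "(\<lambda>k. ennreal ((S k \<omega>)\<^sup>2)) \<longlonglongrightarrow> ennreal ((I \<omega>)\<^sup>2)"
        by (intro tendsto_ennrealI tendsto_power)
      then show ?case by (metis lim_imp_Liminf sequentially_bot)
    qed
  qed
  also have "\<dots> \<le> liminf (\<lambda>k. \<integral>\<^sup>+\<omega>. ennreal ((S k \<omega>)\<^sup>2) \<partial>M)"
    by (rule nn_integral_liminf) measurable
  also have "\<dots> \<le> liminf (\<lambda>k::nat. ennreal (t\<^sup>2))"
    by (rule Liminf_mono) (use Sn in auto)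
  also have "\<dots> = ennreal (t\<^sup>2)" by (simp add: Liminf_const)
  finally have b: "(\<integral>\<^sup>+\<omega>. ennreal ((I \<omega>)\<^sup>2) \<partial>M) \<le> ennreal (t\<^sup>2)" .
  show i: "integrable M (\<lambda>\<omega>. (I \<omega>)\<^sup>2)"
    using b by (intro integrableI_bounded) (auto simp: le_less_trans)
  show "(\<integral>\<omega>. (I \<omega>)\<^sup>2 \<partial>M) \<le> t\<^sup>2"
    using b i by (subst (asm) nn_integral_eq_integral) auto
qed

lemma (in prob_space) indep_var_sym:
  assumes "indep_var S X T Y"
  shows "indep_var T Y S X"
proof -
  note a = assms[unfolded indep_var_eq indep_sets2_eq]
  show ?thesis
    unfolding indep_var_eq indep_sets2_eq
  proof (intro conjI ballI)
    fix b c
    assume "b \<in> sigma_sets (space M) {Y -` A \<inter> space M |A. A \<in> sets T}"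
      and "c \<in> sigma_sets (space M) {X -` A \<inter> space M |A. A \<in> sets S}"
    then have "prob (c \<inter> b) = prob c * prob b" using a by simp
    then show "prob (b \<inter> c) = prob b * prob c" by (simp only: Int_commute mult.commute)
  qed (use a in simp_all)
qed

lemma indep_processes_sym:
  "prob_space M \<Longrightarrow> indep_processes M V W \<Longrightarrow> indep_processes M W V"
  unfolding indep_processes_def by (rule prob_space.indep_var_sym)

text \<open>For the area a bound of order \<open>t\<^sup>2\<close> is enough, since in a short step
  the drift to be exhibited is of order \<open>t\<close>.\<close>

lemma canonical_heis_bm_moments:
  assumes X: "canonical_heis_bm M X" and t: "t > 0"
  shows "has_bochner_integral M (\<lambda>\<omega>. fst (X t \<omega>)) 0"
    "has_bochner_integral M (\<lambda>\<omega>. fst (snd (X t \<omega>))) 0"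
    "has_bochner_integral M (\<lambda>\<omega>. (fst (X t \<omega>))\<^sup>2) t"
    "has_bochner_integral M (\<lambda>\<omega>. (fst (snd (X t \<omega>)))\<^sup>2) t"
    "has_bochner_integral M (\<lambda>\<omega>. fst (X t \<omega>) * fst (snd (X t \<omega>))) 0"
    "has_bochner_integral M (\<lambda>\<omega>. (fst (X t \<omega>)) ^ 4) (3 * t\<^sup>2)"
    "has_bochner_integral M (\<lambda>\<omega>. (fst (snd (X t \<omega>))) ^ 4) (3 * t\<^sup>2)"
    "integrable M (\<lambda>\<omega>. (snd (snd (X t \<omega>)))\<^sup>2)"
    "(\<integral>\<omega>. (snd (snd (X t \<omega>)))\<^sup>2 \<partial>M) \<le> t\<^sup>2"
proof -
  from X t obtain V W I J where V: "std_brownian_motion M V" and W: "std_brownian_motion M W"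
    and ind: "indep_processes M V W" and I: "has_ito_integral M V W t I" and J: "has_ito_integral M W V t J"
    and XX: "\<And>\<omega>. \<omega>\<in>space M \<Longrightarrow> X t \<omega> = (V t \<omega>, W t \<omega>, (I \<omega> - J \<omega>) / 2)"
    unfolding canonical_heis_bm_def by (metis less_imp_le)
  interpret prob_space M by (rule std_brownian_motionD[OF V])
  note [measurable] = std_brownian_motionD(2)[OF V less_imp_le[OF t]] std_brownian_motionD(2)[OF W less_imp_le[OF t]]
    std_brownian_motionD(2)[OF V order_refl] std_brownian_motionD(2)[OF W order_refl]
  have [measurable]: "I \<in> borel_measurable M" "J \<in> borel_measurable M"
    using I J by (auto simp: has_ito_integral_def)
  have cong: "has_bochner_integral M f c" if "has_bochner_integral M g c" "\<And>\<omega>. \<omega> \<in> space M \<Longrightarrow> f \<omega> = g \<omega>"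
    for f g :: "'a \<Rightarrow> real" and c
    using that by (simp cong: has_bochner_integral_cong)
  show "has_bochner_integral M (\<lambda>\<omega>. fst (X t \<omega>)) 0"
    by (rule cong[OF brownian_moments(1)[OF V t]]) (simp add: XX)
  show "has_bochner_integral M (\<lambda>\<omega>. fst (snd (X t \<omega>))) 0"
    by (rule cong[OF brownian_moments(1)[OF W t]]) (simp add: XX)
  show "has_bochner_integral M (\<lambda>\<omega>. (fst (X t \<omega>))\<^sup>2) t"
    by (rule cong[OF brownian_moments(2)[OF V t]]) (simp add: XX)
  show "has_bochner_integral M (\<lambda>\<omega>. (fst (snd (X t \<omega>)))\<^sup>2) t"
    by (rule cong[OF brownian_moments(2)[OF W t]]) (simp add: XX)
  show "has_bochner_integral M (\<lambda>\<omega>. (fst (X t \<omega>)) ^ 4) (3 * t\<^sup>2)"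
    by (rule cong[OF brownian_moments(3)[OF V t]]) (simp add: XX)
  show "has_bochner_integral M (\<lambda>\<omega>. (fst (snd (X t \<omega>))) ^ 4) (3 * t\<^sup>2)"
    by (rule cong[OF brownian_moments(3)[OF W t]]) (simp add: XX)
  show "has_bochner_integral M (\<lambda>\<omega>. fst (X t \<omega>) * fst (snd (X t \<omega>))) 0"
  proof (rule cong)
    \<comment> \<open>The partition with a single interval: its only increment is the one over
      \<open>[0, t]\<close>.\<close>
    have iv: "indep_var borel (\<lambda>\<omega>. incr t 1 V \<omega> 0) borel (\<lambda>\<omega>. incr t 1 W \<omega> 0)"
      by (rule indep_incr_functionals[OF V W ind t, where f="\<lambda>u. u 0" and g="\<lambda>u. u 0"])
         (auto intro!: measurable_component_singleton)
    then have iv: "indep_var borel (\<lambda>\<omega>. V t \<omega> - V 0 \<omega>) borel (\<lambda>\<omega>. W t \<omega> - W 0 \<omega>)"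
      by (simp add: incr_def)
    note mV = brownian_increment_moments(1)[OF V order_refl t] and mW = brownian_increment_moments(1)[OF W order_refl t]
    have "has_bochner_integral M (\<lambda>\<omega>. (V t \<omega> - V 0 \<omega>) * (W t \<omega> - W 0 \<omega>)) 0"
      using indep_var_lebesgue_integral[OF iv] indep_var_integrable[OF iv] mV mW
      by (simp add: has_bochner_integral_iff)
    then show "has_bochner_integral M (\<lambda>\<omega>. V t \<omega> * W t \<omega>) 0"
    proof (rule has_bochner_integral_cong_AE[THEN iffD1, rotated 3])
      show "AE \<omega> in M. (V t \<omega> - V 0 \<omega>) * (W t \<omega> - W 0 \<omega>) = V t \<omega> * W t \<omega>"
        using std_brownian_motionD(3)[OF V] std_brownian_motionD(3)[OF W] by eventually_elim simp
    qed measurable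
  qed (simp add: XX)
  note bI = ito_square_bound[OF V W ind t I]
    and bJ = ito_square_bound[OF W V indep_processes_sym[OF prob_space_axioms ind] t J]
  \<comment> \<open>This pointwise inequality avoids computing the covariance of the two
    integrals.\<close>
  have le: "((I \<omega> - J \<omega>) / 2)\<^sup>2 \<le> ((I \<omega>)\<^sup>2 + (J \<omega>)\<^sup>2) / 2" for \<omega>
    using zero_le_power2[of "I \<omega> + J \<omega>"] by (simp add: power2_eq_square algebra_simps)
  have int: "integrable M (\<lambda>\<omega>. ((I \<omega> - J \<omega>) / 2)\<^sup>2)"
    by (rule Bochner_Integration.integrable_bound[of M "\<lambda>\<omega>. ((I \<omega>)\<^sup>2 + (J \<omega>)\<^sup>2) / 2"])
       (use bI bJ le in auto)
  have eq: "(snd (snd (X t \<omega>)))\<^sup>2 = ((I \<omega> - J \<omega>) / 2)\<^sup>2" if "\<omega> \<in> space M" for \<omega> by (simp add: XX[OF that])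
  show "integrable M (\<lambda>\<omega>. (snd (snd (X t \<omega>)))\<^sup>2)"
    using int by (simp add: eq cong: Bochner_Integration.integrable_cong)
  have "(\<integral>\<omega>. (snd (snd (X t \<omega>)))\<^sup>2 \<partial>M) = (\<integral>\<omega>. ((I \<omega> - J \<omega>) / 2)\<^sup>2 \<partial>M)"
    by (rule Bochner_Integration.integral_cong) (simp_all add: eq)
  also have "\<dots> \<le> (\<integral>\<omega>. ((I \<omega>)\<^sup>2 + (J \<omega>)\<^sup>2) / 2 \<partial>M)"
    by (rule integral_mono[OF int]) (use bI bJ le in auto)
  also have "\<dots> \<le> t\<^sup>2" using bI bJ by simp
  finally show "(\<integral>\<omega>. (snd (snd (X t \<omega>)))\<^sup>2 \<partial>M) \<le> t\<^sup>2" .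
qed

section \<open>Independence of the increments from the past\<close>

definition heis_inv :: "heis \<Rightarrow> heis" where
  "heis_inv p = (- fst p, - fst (snd p), - snd (snd p))"

lemma heis_inv_mult_cancel: "heis_inv p \<odot> (p \<odot> q) = q"
  by (simp add: heis_inv_def heis_mult_eq prod_eq_iff field_simps)

lemma measurable_heis_inv [measurable]:
  assumes "f \<in> borel_measurable M"
  shows "(\<lambda>x. heis_inv (f x)) \<in> borel_measurable M"
proof -
  have "continuous_on UNIV heis_inv" unfolding heis_inv_def by (intro continuous_intros)
  from measurable_compose[OF assms borel_measurable_continuous_onI[OF this]] show ?thesis .
qed

text \<open>The last coordinate of \<open>heis_inv p \<odot> q\<close>, that is, the quantity
  \<open>A\<close> of the overview.\<close>

definition rel_area :: "heis \<Rightarrow> heis \<Rightarrow> real" where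
  "rel_area p q = snd (snd q) - snd (snd p) - (fst p * fst (snd q) - fst (snd p) * fst q) / 2"

lemma heis_inv_mult:
  "heis_inv p \<odot> q = (fst q - fst p, fst (snd q) - fst (snd p), rel_area p q)"
  by (simp add: heis_inv_def heis_mult_eq rel_area_def field_simps)

lemma heis_semigroup_indicator:
  fixes N :: "(real \<Rightarrow> heis) measure"
  assumes X: "canonical_heis_bm N X" and h: "h > 0" and C: "C \<in> sets borel"
  shows "heis_semigroup h (indicator C) p = measure (distr N borel (X h)) {q. p \<odot> q \<in> C}"
proof -
  have m: "(\<lambda>q. p \<odot> q) \<in> borel_measurable borel"
    by (rule borel_measurable_continuous_onI[OF continuous_on_heis_mult])
  have "heis_semigroup h (indicator C) p = measure (distr (distr N borel (X h)) borel (\<lambda>q. p \<odot> q)) C"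
    unfolding heis_semigroup_def heis_law_eq[OF X h] using C by simp
  also have "\<dots> = measure (distr N borel (X h)) {q. p \<odot> q \<in> C}"
    using m C by (subst measure_distr) (auto simp: vimage_def)
  finally show ?thesis .
qed

text \<open>Regarding the identity as a random variable with values in \<open>(\<Omega>, F s)\<close>, the Markov property
  says that \<open>(\<omega>, B (s + h))\<close> and \<open>(\<omega>, B s \<odot> q)\<close> with \<open>q\<close> independent have the same law;
  cancelling \<open>B s\<close> gives independence of the increment.\<close>

lemma heis_markov_increment:
  fixes N :: "(real \<Rightarrow> heis) measure"
  assumes "prob_space M" and F: "filtration_on M F"
    and ad: "\<forall>t\<ge>0. B t \<in> borel_measurable (F t)" and mk: "heis_markov M F B"
    and X: "canonical_heis_bm N X" and s: "s \<ge> 0" and h: "h > 0"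
    and G: "G \<in> sets (F s)" and C: "C \<in> sets borel"
  shows "measure M {\<omega> \<in> G. heis_inv (B s \<omega>) \<odot> B (s + h) \<omega> \<in> C} = measure M G * measure (distr N borel (X h)) C"
proof -
  interpret prob_space M by fact
  define \<nu> where "\<nu> = distr N borel (X h)"
  interpret N: prob_space N by (rule canonical_heis_bm_prob_space[OF X])
  interpret \<nu>: prob_space \<nu> unfolding \<nu>_def
    by (rule N.prob_space_distr[OF canonical_heis_bm_measurable[OF X less_imp_le[OF h]]])
  have s\<nu>[measurable_cong]: "sets \<nu> = sets borel" by (simp add: \<nu>_def)
  have sub: "subalgebra M (F s)" "subalgebra M (F (s + h))"
    using F s h by (auto simp: filtration_on_def)
  have sp: "space (F s) = space M" using sub by (simp add: subalgebra_def)
  interpret sigma_finite_subalgebra M "F s"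
    by (rule finite_measure_subalgebra_is_sigma_finite) (unfold_locales, rule sub)
  define R where "R = restr_to_subalg M (F s)"
  have sR[measurable_cong]: "sets R = sets (F s)" unfolding R_def by (rule sets_restr_to_subalg[OF sub(1)])
  interpret R: prob_space R unfolding R_def by (rule prob_space_restr_to_subalg[OF sub(1) prob_space_axioms])
  interpret R\<nu>: pair_prob_space R \<nu> ..
  have BF[measurable]: "B s \<in> borel_measurable (F s)" by (rule ad[rule_format, OF s])
  have BM[measurable]: "B s \<in> borel_measurable M" "B (s + h) \<in> borel_measurable M"
    using measurable_from_subalg[OF sub(1) ad[rule_format, OF s]] measurable_from_subalg[OF sub(2) ad[rule_format]] s h by auto
  have idF[measurable]: "(\<lambda>\<omega>. \<omega>) \<in> measurable M (F s)"
    using sub(1) by (auto simp: subalgebra_def measurable_def)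
  define \<mu>1 where "\<mu>1 = distr M (F s \<Otimes>\<^sub>M borel) (\<lambda>\<omega>. (\<omega>, B (s + h) \<omega>))"
  define \<mu>2 where "\<mu>2 = distr (R \<Otimes>\<^sub>M \<nu>) (F s \<Otimes>\<^sub>M borel) (\<lambda>q. (fst q, B s (fst q) \<odot> snd q))"
  have m1[measurable]: "(\<lambda>\<omega>. (\<omega>, B (s + h) \<omega>)) \<in> measurable M (F s \<Otimes>\<^sub>M borel)" by measurable
  have m2[measurable]: "(\<lambda>q. (fst q, B s (fst q) \<odot> snd q)) \<in> measurable (R \<Otimes>\<^sub>M \<nu>) (F s \<Otimes>\<^sub>M borel)"
    by measurable
  \<comment> \<open>On a rectangle both sides equal the integral over \<open>G\<close> of the
    conditional expectation: for \<open>\<mu>1\<close> by its defining property, for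
    \<open>\<mu>2\<close> because the Markov property identifies it almost surely with the measures
    of the sections.\<close>
  have rect: "emeasure \<mu>1 (G \<times> C) = emeasure \<mu>2 (G \<times> C)" if G: "G \<in> sets (F s)" and C: "C \<in> sets borel" for G C
  proof -
    have GM: "G \<in> sets M" using G sub(1) by (auto simp: subalgebra_def)
    have [measurable]: "C \<in> sets borel" "G \<in> sets M" by fact+
    have iC: "(indicator C :: heis \<Rightarrow> real) \<in> borel_measurable borel" by measurable
    have bnd: "bounded (range (indicator C :: heis \<Rightarrow> real))"
      by (rule boundedI[of _ 1]) (auto simp: indicator_def)
    have ce: "AE \<omega> in M. real_cond_exp M (F s) (\<lambda>\<omega>. indicator C (B (s + h) \<omega>)) \<omega>
                     = measure \<nu> {q. B s \<omega> \<odot> q \<in> C}"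
      using mk[unfolded heis_markov_def, rule_format, OF s less_imp_le[OF h] iC bnd]
      unfolding heis_semigroup_indicator[OF X h C] \<nu>_def .
    have int: "integrable M (\<lambda>\<omega>. indicator C (B (s + h) \<omega>) :: real)"
      by (rule integrable_const_bound[of _ 1]) (auto simp: indicator_def)
    have "{q \<in> space M. q \<in> G \<and> B (s + h) q \<in> C} \<in> sets M" by measurable
    then have "emeasure \<mu>1 (G \<times> C) = emeasure M {\<omega> \<in> space M. \<omega> \<in> G \<and> B (s + h) \<omega> \<in> C}"
      unfolding \<mu>1_def using G C by (subst emeasure_distr[OF m1]) (auto intro!: arg_cong[where f="emeasure M"])
    also have "\<dots> = ennreal (\<integral>\<omega>. indicator {\<omega> \<in> space M. \<omega> \<in> G \<and> B (s + h) \<omega> \<in> C} \<omega> \<partial>M)"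
      by (simp add: emeasure_eq_measure Int_absorb2)
    also have "(\<integral>\<omega>. indicator {\<omega> \<in> space M. \<omega> \<in> G \<and> B (s + h) \<omega> \<in> C} \<omega> \<partial>M) = (\<integral>\<omega>\<in>G. indicator C (B (s + h) \<omega>) \<partial>M)"
      unfolding set_lebesgue_integral_def
      by (rule Bochner_Integration.integral_cong) (auto simp: indicator_def)
    also have "\<dots> = (\<integral>\<omega>\<in>G. real_cond_exp M (F s) (\<lambda>\<omega>. indicator C (B (s + h) \<omega>)) \<omega> \<partial>M)"
      by (rule real_cond_exp_intA[OF int G])
    finally have 1: "emeasure \<mu>1 (G \<times> C) = ennreal (\<integral>\<omega>\<in>G. real_cond_exp M (F s) (\<lambda>\<omega>. indicator C (B (s + h) \<omega>)) \<omega> \<partial>M)" .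
    define Q where "Q = {q \<in> space (R \<Otimes>\<^sub>M \<nu>). fst q \<in> G \<and> B s (fst q) \<odot> snd q \<in> C}"
    have Qm: "Q \<in> sets (R \<Otimes>\<^sub>M \<nu>)" unfolding Q_def using G by measurable
    have "emeasure \<mu>2 (G \<times> C) = emeasure (R \<Otimes>\<^sub>M \<nu>) Q"
      unfolding \<mu>2_def using G C by (subst emeasure_distr[OF m2]) (auto simp: Q_def intro!: arg_cong[where f="emeasure (R \<Otimes>\<^sub>M \<nu>)"])
    also have "\<dots> = (\<integral>\<^sup>+\<omega>. emeasure \<nu> (Pair \<omega> -` Q) \<partial>R)"
      by (rule \<nu>.emeasure_pair_measure_alt[OF Qm])
    also have "\<dots> = (\<integral>\<^sup>+\<omega>. emeasure \<nu> (Pair \<omega> -` Q) \<partial>M)"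
    proof -
      have "(\<lambda>\<omega>. emeasure \<nu> (Pair \<omega> -` Q)) \<in> borel_measurable R"
        by (rule \<nu>.measurable_emeasure_Pair[OF Qm])
      then show ?thesis unfolding R_def
        by (intro nn_integral_subalgebra2[OF sub(1)] measurable_in_subalg'[OF sub(1)])
    qed
    also have "\<dots> = (\<integral>\<^sup>+\<omega>. ennreal (indicator G \<omega> * real_cond_exp M (F s) (\<lambda>\<omega>. indicator C (B (s + h) \<omega>)) \<omega>) \<partial>M)"
    proof (rule nn_integral_cong_AE)
      show "AE \<omega> in M. emeasure \<nu> (Pair \<omega> -` Q)
        = ennreal (indicator G \<omega> * real_cond_exp M (F s) (\<lambda>\<omega>. indicator C (B (s + h) \<omega>)) \<omega>)"
        using ce AE_space
      proof eventually_elim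
        case (elim \<omega>)
        have "Pair \<omega> -` Q = (if \<omega> \<in> G then {q. B s \<omega> \<odot> q \<in> C} else {})"
          using elim(2) sp sets_eq_imp_space_eq[OF sR] sets_eq_imp_space_eq[OF s\<nu>]
          by (auto simp: Q_def space_pair_measure)
        then show ?case using elim(1) by (simp add: \<nu>.emeasure_eq_measure)
      qed
    qed
    also have "\<dots> = ennreal (\<integral>\<omega>. indicator G \<omega> * real_cond_exp M (F s) (\<lambda>\<omega>. indicator C (B (s + h) \<omega>)) \<omega> \<partial>M)"
    proof (rule nn_integral_eq_integral)
      show "integrable M (\<lambda>\<omega>. indicator G \<omega> * real_cond_exp M (F s) (\<lambda>\<omega>. indicator C (B (s + h) \<omega>)) \<omega>)"
        using integrable_mult_indicator[OF GM real_cond_exp_int(1)[OF int]] by simp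
      show "AE \<omega> in M. 0 \<le> indicator G \<omega> * real_cond_exp M (F s) (\<lambda>\<omega>. indicator C (B (s + h) \<omega>)) \<omega>"
        using ce by eventually_elim simp
    qed
    also have "\<dots> = emeasure \<mu>1 (G \<times> C)" unfolding 1 set_lebesgue_integral_def by simp
    finally show ?thesis by simp
  qed
  have eq: "\<mu>1 = \<mu>2"
  proof (rule measure_eqI_generator_eq[OF Int_stable_pair_measure_generator[of "F s" borel]])
    show "{a \<times> b |a b. a \<in> sets (F s) \<and> b \<in> sets borel} \<subseteq> Pow (space (F s) \<times> UNIV)"
      using sets.space_closed[of "F s"] by auto
    show "sets \<mu>1 = sigma_sets (space (F s) \<times> UNIV) {a \<times> b |a b. a \<in> sets (F s) \<and> b \<in> sets borel}"
      "sets \<mu>2 = sigma_sets (space (F s) \<times> UNIV) {a \<times> b |a b. a \<in> sets (F s) \<and> b \<in> sets borel}"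
      by (simp_all add: \<mu>1_def \<mu>2_def sets_pair_measure)
    show "range (\<lambda>_::nat. space (F s) \<times> UNIV) \<subseteq> {a \<times> b |a b. a \<in> sets (F s) \<and> b \<in> sets (borel :: heis measure)}"
    proof (rule image_subsetI, unfold mem_Collect_eq, intro exI conjI)
      show "space (F s) \<times> UNIV = space (F s) \<times> (UNIV :: heis set)" ..
    qed auto
    interpret \<mu>1: prob_space \<mu>1 unfolding \<mu>1_def by (rule prob_space_distr[OF m1])
    show "emeasure \<mu>1 (space (F s) \<times> UNIV) \<noteq> \<infinity>" by simp
  qed (use rect in auto)
  \<comment> \<open>The preimage of \<open>D\<close> is the event of the claim under the first map
    and exactly \<open>G \<times> C\<close> under the second.\<close>
  define D where "D = {q \<in> space (F s \<Otimes>\<^sub>M borel). fst q \<in> G \<and> heis_inv (B s (fst q)) \<odot> snd q \<in> C}"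
  have Dm: "D \<in> sets (F s \<Otimes>\<^sub>M borel)" unfolding D_def using G C by measurable
  have Gsp: "G \<subseteq> space M" using G sets.sets_into_space sp by metis
  have "emeasure M {\<omega> \<in> G. heis_inv (B s \<omega>) \<odot> B (s + h) \<omega> \<in> C} = emeasure \<mu>1 D"
    unfolding \<mu>1_def using Gsp
    by (subst emeasure_distr[OF m1 Dm]) (auto simp: D_def space_pair_measure sp intro!: arg_cong[where f="emeasure M"])
  also have "\<dots> = emeasure (R \<Otimes>\<^sub>M \<nu>) (G \<times> C)"
    unfolding eq \<mu>2_def using Gsp sets_eq_imp_space_eq[OF sR] sets_eq_imp_space_eq[OF s\<nu>]
    by (subst emeasure_distr[OF m2 Dm])
      (auto simp: D_def space_pair_measure sp heis_inv_mult_cancel intro!: arg_cong[where f="emeasure (R \<Otimes>\<^sub>M \<nu>)"])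
  also have "\<dots> = emeasure R G * emeasure \<nu> C"
    by (rule \<nu>.emeasure_pair_measure_Times) (use G C sR s\<nu> in auto)
  also have "emeasure R G = emeasure M G"
    unfolding R_def by (rule emeasure_restr_to_subalg[OF sub(1) G])
  finally show ?thesis
    by (simp add: emeasure_eq_measure \<nu>.emeasure_eq_measure \<nu>_def[symmetric] ennreal_mult[symmetric])
qed

text \<open>Taking the whole space for \<open>G\<close> shows that the increment has the law of
  \<open>X h\<close>; taking for \<open>G\<close> the preimages of Borel sets under \<open>V\<close>
  shows that it is independent of \<open>V\<close>. The expectation of the product then
  factorises.\<close>

lemma heis_markov_increment_expectation:
  fixes N :: "(real \<Rightarrow> heis) measure" and V :: "'w \<Rightarrow> real" and \<phi> :: "heis \<Rightarrow> real"
  assumes M: "prob_space M" and F: "filtration_on M F"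
    and ad: "\<forall>t\<ge>0. B t \<in> borel_measurable (F t)" and mk: "heis_markov M F B"
    and X: "canonical_heis_bm N X" and s: "s \<ge> 0" and h: "h > 0"
    and VF: "V \<in> borel_measurable (F s)" and V: "integrable M V"
    and \<phi>: "\<phi> \<in> borel_measurable borel" and c: "has_bochner_integral N (\<lambda>\<omega>. \<phi> (X h \<omega>)) c"
  shows "has_bochner_integral M (\<lambda>\<omega>. V \<omega> * \<phi> (heis_inv (B s \<omega>) \<odot> B (s + h) \<omega>)) (integral\<^sup>L M V * c)"
proof -
  interpret prob_space M by fact
  interpret N: prob_space N by (rule canonical_heis_bm_prob_space[OF X])
  note Xm[measurable] = canonical_heis_bm_measurable[OF X less_imp_le[OF h]]
  define \<xi> where "\<xi> \<omega> = heis_inv (B s \<omega>) \<odot> B (s + h) \<omega>" for \<omega>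
  have sub: "subalgebra M (F s)" "subalgebra M (F (s + h))"
    using F s h by (auto simp: filtration_on_def)
  have [measurable]: "B s \<in> borel_measurable M" "B (s + h) \<in> borel_measurable M"
    using measurable_from_subalg[OF sub(1) ad[rule_format, OF s]] measurable_from_subalg[OF sub(2) ad[rule_format]] s h by auto
  have [measurable]: "V \<in> borel_measurable M" using V by simp
  have \<xi>m[measurable]: "\<xi> \<in> borel_measurable M" unfolding \<xi>_def by measurable
  have sp: "space (F s) = space M" using sub by (simp add: subalgebra_def)
  note inc = heis_markov_increment[OF M F ad mk X s h, folded \<xi>_def]
  have d\<xi>: "distr M borel \<xi> = distr N borel (X h)"
  proof (rule measure_eqI)
    fix C assume "C \<in> sets (distr M borel \<xi>)"
    then have C: "C \<in> sets borel" by simp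
    have "space M \<in> sets (F s)" using sp by (metis sets.top)
    from inc[OF this C] have "measure (distr M borel \<xi>) C = measure (distr N borel (X h)) C"
      using C by (simp add: measure_distr prob_space vimage_def Int_def conj_commute)
    then show "emeasure (distr M borel \<xi>) C = emeasure (distr N borel (X h)) C"
      by (simp only: finite_measure.emeasure_eq_measure[OF finite_measure_distr[OF \<xi>m]]
          finite_measure.emeasure_eq_measure[OF N.finite_measure_distr[OF Xm]])
  qed simp
  have \<phi>\<xi>[measurable]: "(\<lambda>\<omega>. \<phi> (\<xi> \<omega>)) \<in> borel_measurable M" using \<phi> by measurable
  have iv\<phi>: "indep_var borel V borel (\<lambda>\<omega>. \<phi> (\<xi> \<omega>))"
    unfolding indep_var_distribution_eq
  proof (intro conjI pair_measure_eqI)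
    show "sigma_finite_measure (distr M borel V)" "sigma_finite_measure (distr M borel (\<lambda>\<omega>. \<phi> (\<xi> \<omega>)))"
      by (auto intro!: prob_space_imp_sigma_finite prob_space_distr)
    show "sets (distr M borel V \<Otimes>\<^sub>M distr M borel (\<lambda>\<omega>. \<phi> (\<xi> \<omega>))) = sets (distr M (borel \<Otimes>\<^sub>M borel) (\<lambda>x. (V x, \<phi> (\<xi> x))))"
      by simp
    fix A C assume "A \<in> sets (distr M borel V)" "C \<in> sets (distr M borel (\<lambda>\<omega>. \<phi> (\<xi> \<omega>)))"
    then have A: "A \<in> sets borel" and C: "C \<in> sets borel" by auto
    have G: "V -` A \<inter> space M \<in> sets (F s)" using measurable_sets[OF VF A] sp by simp
    have \<phi>C: "\<phi> -` C \<in> sets borel" using measurable_sets[OF \<phi> C] by simp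
    have "measure M {\<omega> \<in> V -` A \<inter> space M. \<xi> \<omega> \<in> \<phi> -` C}
       = measure M (V -` A \<inter> space M) * measure (distr M borel \<xi>) (\<phi> -` C)"
      unfolding d\<xi> by (rule inc[OF G \<phi>C])
    also have "measure (distr M borel \<xi>) (\<phi> -` C) = measure M ((\<lambda>\<omega>. \<phi> (\<xi> \<omega>)) -` C \<inter> space M)"
      by (subst measure_distr[OF \<xi>m \<phi>C]) (auto intro!: arg_cong[where f="measure M"])
    finally have "emeasure M {\<omega> \<in> V -` A \<inter> space M. \<xi> \<omega> \<in> \<phi> -` C}
       = emeasure M (V -` A \<inter> space M) * emeasure M ((\<lambda>\<omega>. \<phi> (\<xi> \<omega>)) -` C \<inter> space M)"
      by (simp add: emeasure_eq_measure ennreal_mult[symmetric])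
    moreover have "emeasure (distr M (borel \<Otimes>\<^sub>M borel) (\<lambda>x. (V x, \<phi> (\<xi> x)))) (A \<times> C)
       = emeasure M {\<omega> \<in> V -` A \<inter> space M. \<xi> \<omega> \<in> \<phi> -` C}"
      using A C by (subst emeasure_distr) (auto intro!: arg_cong[where f="emeasure M"])
    ultimately show "emeasure (distr M borel V) A * emeasure (distr M borel (\<lambda>\<omega>. \<phi> (\<xi> \<omega>))) C
      = emeasure (distr M (borel \<Otimes>\<^sub>M borel) (\<lambda>x. (V x, \<phi> (\<xi> x)))) (A \<times> C)"
      using A C by (simp add: emeasure_distr)
  qed measurable
  have "integrable (distr N borel (X h)) \<phi> \<and> (\<integral>p. \<phi> p \<partial>distr N borel (X h)) = c"
    using c \<phi> by (simp add: integrable_distr_eq integral_distr has_bochner_integral_iff)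
  then have i\<phi>: "integrable M (\<lambda>\<omega>. \<phi> (\<xi> \<omega>))" "(\<integral>\<omega>. \<phi> (\<xi> \<omega>) \<partial>M) = c"
    unfolding d\<xi>[symmetric] using \<phi> by (simp_all add: integrable_distr_eq integral_distr)
  show ?thesis
    using indep_var_integrable[OF iv\<phi> V i\<phi>(1)] indep_var_lebesgue_integral[OF iv\<phi> V i\<phi>(1)] i\<phi>(2)
    by (simp add: has_bochner_integral_iff \<xi>_def)
qed

text \<open>The motions start at zero only almost surely, and this on the space of the canonical
  process; equality of the path laws transfers it to \<open>M\<close>. The horizontal coordinates
  are the ones that enter the initial value of the second moment of \<open>U\<close>.\<close>

lemma heis_brownian_motion_start:
  assumes B: "heis_brownian_motion M a B"
  shows "AE \<omega> in M. fst (B 0 \<omega>) = fst a \<and> fst (snd (B 0 \<omega>)) = fst (snd a)"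
proof -
  from B obtain N :: "(real \<Rightarrow> heis) measure" and X where M: "prob_space M"
    and Bm: "\<And>t. t \<ge> 0 \<Longrightarrow> B t \<in> borel_measurable M" and X: "canonical_heis_bm N X"
    and law: "process_law M B = process_law N (\<lambda>t \<omega>. a \<odot> X t \<omega>)"
    unfolding heis_brownian_motion_def by blast
  have Xm: "(\<lambda>\<omega>. a \<odot> X t \<omega>) \<in> borel_measurable N" if "t \<ge> 0" for t
    using canonical_heis_bm_measurable[OF X that] by measurable
  have pM: "(\<lambda>\<omega>. \<lambda>t\<in>{0..}. B t \<omega>) \<in> measurable M (PiM {0..} (\<lambda>_. borel))"
    by (rule measurable_restrict) (use Bm in auto)
  have pN: "(\<lambda>\<omega>. \<lambda>t\<in>{0..}. a \<odot> X t \<omega>) \<in> measurable N (PiM {0..} (\<lambda>_. borel))"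
    by (rule measurable_restrict) (use Xm in auto)
  let ?P = "\<lambda>w::real \<Rightarrow> heis. fst (w 0) = fst a \<and> fst (snd (w 0)) = fst (snd a)"
  have ev: "(\<lambda>w. w 0) \<in> measurable (PiM {0::real..} (\<lambda>_. borel)) (borel :: heis measure)"
    by (rule measurable_component_singleton) simp
  have [measurable]: "(\<lambda>w. fst (w 0)) \<in> borel_measurable (PiM {0::real..} (\<lambda>_. borel :: heis measure))"
    "(\<lambda>w. fst (snd (w 0))) \<in> borel_measurable (PiM {0::real..} (\<lambda>_. borel :: heis measure))"
    by (rule measurable_compose[OF ev], rule measurable_heis_coords)+
  have Pm: "{w \<in> space (PiM {0..} (\<lambda>_. borel)). ?P w} \<in> sets (PiM {0..} (\<lambda>_. borel))"
    by measurable
  from X obtain V W I J where V: "std_brownian_motion N V" and W: "std_brownian_motion N W"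
    and XX: "\<And>\<omega>. \<omega>\<in>space N \<Longrightarrow> X 0 \<omega> = (V 0 \<omega>, W 0 \<omega>, (I \<omega> - J \<omega>) / 2)"
    unfolding canonical_heis_bm_def by blast
  have "AE \<omega> in N. ?P (\<lambda>t\<in>{0..}. a \<odot> X t \<omega>)"
    using std_brownian_motionD(3)[OF V] std_brownian_motionD(3)[OF W] AE_space
    by eventually_elim (simp add: XX heis_mult_eq)
  then have "AE w in process_law M B. ?P w"
    unfolding law unfolding process_law_def AE_distr_iff[OF pN Pm] .
  then have "AE \<omega> in M. ?P (\<lambda>t\<in>{0..}. B t \<omega>)"
    unfolding process_law_def AE_distr_iff[OF pM Pm] .
  then show ?thesis by simp
qed

section \<open>A Lyapunov function for the coupling\<close>

text \<open>The value of \<open>K\<close> is the one for which the terms quadratic in the horizontal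
  displacement \<open>(f1 - e1, f2 - e2)\<close> cancel.\<close>

lemma lyapunov_pointwise:
  fixes A U1 U2 e1 e2 f1 f2 z w a b l :: real
  assumes a: "\<bar>A\<bar> \<le> a" and b: "\<bar>U1\<bar> \<le> b" "\<bar>U2\<bar> \<le> b" and l: "l > 0"
    and K: "K = a / (2 * l) + 3 / 2 * b\<^sup>2"
    and A': "A' = A + w - z + (U1 * (e2 + f2) - U2 * (e1 + f1)) / 2 - (e1 * f2 - e2 * f1) / 2"
  shows "A\<^sup>2 + K * (U1\<^sup>2 + U2\<^sup>2)
     + (A * U1 * e2 - A * U2 * e1 + A * U1 * f2 - A * U2 * f1)
     + 2 * (A * w - A * z) + 2 * K * (U1 * f1 - U1 * e1 + U2 * f2 - U2 * e2)
     + 1 / 2 * (U1\<^sup>2 * e2\<^sup>2 - 2 * (U1 * U2 * (e1 * e2)) + U2\<^sup>2 * e1\<^sup>2)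
     - a * l / 2 * (e1\<^sup>2 + e2\<^sup>2) - 6 * (z\<^sup>2 + w\<^sup>2) - 3 / 4 * (e1 ^ 4 + e2 ^ 4 + f1 ^ 4 + f2 ^ 4)
    \<le> A'\<^sup>2 + K * ((U1 + f1 - e1)\<^sup>2 + (U2 + f2 - e2)\<^sup>2)"
proof -
  define X where "X = U1 * e2 - U2 * e1"
  define d1 d2 where "d1 = f1 - e1" and "d2 = f2 - e2"
  define R1 where "R1 = (U1 * d2 - U2 * d1) / 2"
  define R3 where "R3 = (e1 * f2 - e2 * f1) / 2"
  define R where "R = R1 + (w - z) - R3"
  have A'eq: "A' = A + X + R"
    by (simp add: A' X_def R_def R1_def R3_def d1_def d2_def field_simps)
  \<comment> \<open>The product of \<open>X\<close> and \<open>R\<close> mixes the two increments,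
    so half of the square of \<open>X\<close> is given up to remove it.\<close>
  have sq: "1 / 2 * X\<^sup>2 - R\<^sup>2 \<le> (X + R)\<^sup>2"
    using zero_le_power2[of "X + 2 * R"] by (simp add: power2_eq_square algebra_simps)
  have R2: "R\<^sup>2 \<le> 3 * (R1\<^sup>2 + (w - z)\<^sup>2 + R3\<^sup>2)"
    using zero_le_power2[of "R1 - (w - z)"] zero_le_power2[of "R1 + R3"] zero_le_power2[of "w - z + R3"]
    by (simp add: R_def power2_eq_square algebra_simps)
  have cs: "(p * r - q * s)\<^sup>2 \<le> (p\<^sup>2 + q\<^sup>2) * (r\<^sup>2 + s\<^sup>2)" for p q r s :: real
    using zero_le_power2[of "p * s + q * r"] by (simp add: power2_eq_square algebra_simps)
  have "2 * R1 = U1 * d2 - U2 * d1" by (simp add: R1_def)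
  then have "(2 * R1)\<^sup>2 \<le> (U1\<^sup>2 + U2\<^sup>2) * (d2\<^sup>2 + d1\<^sup>2)" using cs[of U1 d2 U2 d1] by metis
  also have "\<dots> \<le> (b\<^sup>2 + b\<^sup>2) * (d2\<^sup>2 + d1\<^sup>2)"
    using b by (intro mult_right_mono add_mono) (auto simp: abs_le_square_iff[symmetric])
  finally have R1b: "3 * R1\<^sup>2 \<le> 3 / 2 * b\<^sup>2 * (d1\<^sup>2 + d2\<^sup>2)" by (simp add: power_mult_distrib algebra_simps)
  have zw: "(w - z)\<^sup>2 \<le> 2 * (z\<^sup>2 + w\<^sup>2)"
    using zero_le_power2[of "w + z"] by (simp add: power2_eq_square algebra_simps)
  \<comment> \<open>\<open>R3\<close> is a product of two steps, so its square is paid for by fourth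
    moments, which are of order \<open>h\<^sup>2\<close>. The product of \<open>A\<close> and
    \<open>R3\<close> is only of order \<open>h\<close> and is treated separately below.\<close>
  have "2 * R3 = e1 * f2 - e2 * f1" by (simp add: R3_def)
  then have "(2 * R3)\<^sup>2 \<le> (e1\<^sup>2 + e2\<^sup>2) * (f2\<^sup>2 + f1\<^sup>2)" using cs[of e1 f2 e2 f1] by metis
  also have "\<dots> \<le> ((e1\<^sup>2 + e2\<^sup>2)\<^sup>2 + (f2\<^sup>2 + f1\<^sup>2)\<^sup>2) / 2"
    using zero_le_power2[of "(e1\<^sup>2 + e2\<^sup>2) - (f2\<^sup>2 + f1\<^sup>2)"] by (simp add: power2_eq_square algebra_simps)
  also have "\<dots> \<le> e1 ^ 4 + e2 ^ 4 + f1 ^ 4 + f2 ^ 4"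
  proof -
    have "(p\<^sup>2 + q\<^sup>2)\<^sup>2 \<le> 2 * (p ^ 4 + q ^ 4)" for p q :: real
      using zero_le_power2[of "p\<^sup>2 - q\<^sup>2"] by (simp add: power2_eq_square power4_eq_xxxx algebra_simps)
    from this[of e1 e2] this[of f2 f1] show ?thesis by simp
  qed
  finally have R3b: "3 * R3\<^sup>2 \<le> 3 / 4 * (e1 ^ 4 + e2 ^ 4 + f1 ^ 4 + f2 ^ 4)" by (simp add: power_mult_distrib)
  \<comment> \<open>Young's inequality with weight \<open>l\<close>: a small \<open>l\<close> makes
    the first term cheap, and the large second term will be absorbed by \<open>K\<close>.\<close>
  have am: "\<bar>p * q\<bar> \<le> l / 2 * p\<^sup>2 + q\<^sup>2 / (2 * l)" for p q :: real
  proof -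
    have "2 * l * \<bar>p * q\<bar> \<le> l\<^sup>2 * p\<^sup>2 + q\<^sup>2"
      using sum_squares_bound[of "l * \<bar>p\<bar>" "\<bar>q\<bar>"] l by (simp add: abs_mult power_mult_distrib)
    then show ?thesis using l by (simp add: field_simps power2_eq_square)
  qed
  \<comment> \<open>The area spanned by \<open>e\<close> and \<open>f\<close> is also the area
    spanned by \<open>e\<close> and \<open>f - e\<close>, so it is small when the coupling moves
    both processes alike.\<close>
  have "A * (2 * R3) = A * (e1 * d2 - e2 * d1)" by (simp add: R3_def d1_def d2_def field_simps)
  also have "\<dots> \<le> \<bar>A\<bar> * \<bar>e1 * d2 - e2 * d1\<bar>" by (metis abs_ge_self abs_mult)
  also have "\<dots> \<le> a * (\<bar>e1 * d2\<bar> + \<bar>e2 * d1\<bar>)"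
    using a by (intro mult_mono) auto
  also have "\<dots> \<le> a * ((l / 2 * e1\<^sup>2 + d2\<^sup>2 / (2 * l)) + (l / 2 * e2\<^sup>2 + d1\<^sup>2 / (2 * l)))"
    using a am[of e1 d2] am[of e2 d1] by (intro mult_left_mono add_mono) auto
  also have "\<dots> = a * l / 2 * (e1\<^sup>2 + e2\<^sup>2) + a / (2 * l) * (d1\<^sup>2 + d2\<^sup>2)"
    by (simp add: add_divide_distrib algebra_simps)
  finally have AR3: "2 * A * R3 \<le> \<dots>" by simp
  have K': "K * (d1\<^sup>2 + d2\<^sup>2) = a / (2 * l) * (d1\<^sup>2 + d2\<^sup>2) + 3 / 2 * b\<^sup>2 * (d1\<^sup>2 + d2\<^sup>2)"
    by (simp add: K distrib_right)
  have A_sq: "A'\<^sup>2 = A\<^sup>2 + 2 * A * X + 2 * A * R1 + 2 * (A * w - A * z) - 2 * A * R3 + (X + R)\<^sup>2"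
    by (simp add: A'eq R_def power2_eq_square algebra_simps)
  have U_sq: "K * ((U1 + f1 - e1)\<^sup>2 + (U2 + f2 - e2)\<^sup>2) =
      K * (U1\<^sup>2 + U2\<^sup>2) + 2 * K * (U1 * f1 - U1 * e1 + U2 * f2 - U2 * e2) + K * (d1\<^sup>2 + d2\<^sup>2)"
    by (simp add: d1_def d2_def power2_eq_square algebra_simps)
  \<comment> \<open>All contributions of first order to the square of \<open>A'\<close> that are
    linear in the steps; their coefficients are known at the start of the step, so they have mean
    zero.\<close>
  have AX: "A * U1 * e2 - A * U2 * e1 + A * U1 * f2 - A * U2 * f1 = 2 * A * X + 2 * A * R1"
    by (simp add: X_def R1_def d1_def d2_def field_simps)
  have X_sq: "U1\<^sup>2 * e2\<^sup>2 - 2 * (U1 * U2 * (e1 * e2)) + U2\<^sup>2 * e1\<^sup>2 = X\<^sup>2"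
    by (simp add: X_def power2_eq_square algebra_simps)
  \<comment> \<open>With the nonlinear terms named, the claim is a linear combination of the seven
    facts collected above.\<close>
  have lin: "p + k1 + (2 * ax + 2 * ar) + aw + k2 + 1 / 2 * x2 - E - 6 * Z - 3 / 4 * Q
      \<le> p + 2 * ax + 2 * ar + aw - ar3 + xr + (k1 + k2 + kd)"
    if "1 / 2 * x2 - r \<le> xr" "r \<le> 3 * (r1 + wz + r3)" "3 * r1 \<le> D2" "wz \<le> 2 * Z" "3 * r3 \<le> 3 / 4 * Q"
      "ar3 \<le> E + D1" "kd = D1 + D2"
    for p k1 ax ar aw k2 x2 E Z Q ar3 xr kd r r1 wz r3 D1 D2 :: real
    using that by argo
  show ?thesis unfolding A_sq U_sq AX X_sq mult.assoc[of 2 A X] mult.assoc[of 2 A R1]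
    by (rule lin[OF sq R2 R1b zw R3b AR3 K'])
qed


text \<open>These are the only consequences of independence from \<open>G\<close> and of the law of a Heisenberg Brownian
  increment that enter the Lyapunov estimate.\<close>

definition heis_increment ::
    "'w measure \<Rightarrow> 'w measure \<Rightarrow> real \<Rightarrow> real \<Rightarrow> real \<Rightarrow> ('w \<Rightarrow> real) \<Rightarrow> ('w \<Rightarrow> real) \<Rightarrow> ('w \<Rightarrow> real) \<Rightarrow> bool" where
  "heis_increment M G h m \<sigma> e1 e2 z \<longleftrightarrow> (\<forall>V. V \<in> borel_measurable G \<longrightarrow> integrable M V \<longrightarrow>
     has_bochner_integral M (\<lambda>\<omega>. V \<omega> * e1 \<omega>) 0 \<and>
     has_bochner_integral M (\<lambda>\<omega>. V \<omega> * e2 \<omega>) 0 \<and>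
     has_bochner_integral M (\<lambda>\<omega>. V \<omega> * z \<omega>) (integral\<^sup>L M V * m) \<and>
     has_bochner_integral M (\<lambda>\<omega>. V \<omega> * (e1 \<omega>)\<^sup>2) (integral\<^sup>L M V * h) \<and>
     has_bochner_integral M (\<lambda>\<omega>. V \<omega> * (e2 \<omega>)\<^sup>2) (integral\<^sup>L M V * h) \<and>
     has_bochner_integral M (\<lambda>\<omega>. V \<omega> * (e1 \<omega> * e2 \<omega>)) 0 \<and>
     has_bochner_integral M (\<lambda>\<omega>. V \<omega> * (z \<omega>)\<^sup>2) (integral\<^sup>L M V * \<sigma>) \<and>
     has_bochner_integral M (\<lambda>\<omega>. V \<omega> * e1 \<omega> ^ 4) (integral\<^sup>L M V * (3 * h\<^sup>2)) \<and>
     has_bochner_integral M (\<lambda>\<omega>. V \<omega> * e2 \<omega> ^ 4) (integral\<^sup>L M V * (3 * h\<^sup>2)))"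

lemma heis_incrementD:
  assumes "heis_increment M G h m \<sigma> e1 e2 z" "V \<in> borel_measurable G" "integrable M V"
  shows "has_bochner_integral M (\<lambda>\<omega>. V \<omega> * e1 \<omega>) 0"
     "has_bochner_integral M (\<lambda>\<omega>. V \<omega> * e2 \<omega>) 0"
     "has_bochner_integral M (\<lambda>\<omega>. V \<omega> * z \<omega>) (integral\<^sup>L M V * m)"
     "has_bochner_integral M (\<lambda>\<omega>. V \<omega> * (e1 \<omega>)\<^sup>2) (integral\<^sup>L M V * h)"
     "has_bochner_integral M (\<lambda>\<omega>. V \<omega> * (e2 \<omega>)\<^sup>2) (integral\<^sup>L M V * h)"
     "has_bochner_integral M (\<lambda>\<omega>. V \<omega> * (e1 \<omega> * e2 \<omega>)) 0"
     "has_bochner_integral M (\<lambda>\<omega>. V \<omega> * (z \<omega>)\<^sup>2) (integral\<^sup>L M V * \<sigma>)"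
     "has_bochner_integral M (\<lambda>\<omega>. V \<omega> * e1 \<omega> ^ 4) (integral\<^sup>L M V * (3 * h\<^sup>2))"
     "has_bochner_integral M (\<lambda>\<omega>. V \<omega> * e2 \<omega> ^ 4) (integral\<^sup>L M V * (3 * h\<^sup>2))"
  using assms unfolding heis_increment_def by blast+

text \<open>Each clause is the factorisation of expectations for a monomial in the coordinates. The
  first two moments of the area increment stay unevaluated: the first will cancel and the second is
  merely bounded.\<close>

lemma heis_markov_heis_increment:
  fixes N :: "(real \<Rightarrow> heis) measure"
  assumes M: "prob_space M" and F: "filtration_on M F"
    and ad: "\<forall>t\<ge>0. B t \<in> borel_measurable (F t)" and mk: "heis_markov M F B"
    and X: "canonical_heis_bm N X" and s: "s \<ge> 0" and h: "h > 0"
  shows "heis_increment M (F s) h (\<integral>\<omega>. snd (snd (X h \<omega>)) \<partial>N) (\<integral>\<omega>. (snd (snd (X h \<omega>)))\<^sup>2 \<partial>N)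
    (\<lambda>\<omega>. fst (B (s + h) \<omega>) - fst (B s \<omega>)) (\<lambda>\<omega>. fst (snd (B (s + h) \<omega>)) - fst (snd (B s \<omega>)))
    (\<lambda>\<omega>. rel_area (B s \<omega>) (B (s + h) \<omega>))"
proof -
  interpret N: prob_space N by (rule canonical_heis_bm_prob_space[OF X])
  note [measurable] = canonical_heis_bm_measurable[OF X less_imp_le[OF h]]
  note mom = canonical_heis_bm_moments[OF X h]
  have [measurable]: "(\<lambda>\<omega>. snd (snd (X h \<omega>))) \<in> borel_measurable N"
    by (rule measurable_compose[OF _ measurable_heis_coords(3)]) measurable
  have iz: "integrable N (\<lambda>\<omega>. snd (snd (X h \<omega>)))"
    using integrable_mult_square[of "\<lambda>\<omega>. snd (snd (X h \<omega>))" N "\<lambda>_. 1"] mom(8) by simp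
  note E = heis_markov_increment_expectation[OF M F ad mk X s h, unfolded heis_inv_mult]
  show ?thesis
    unfolding heis_increment_def
  proof (intro allI impI conjI)
    fix V :: "'a \<Rightarrow> real" assume V: "V \<in> borel_measurable (F s)" "integrable M V"
    note E' = E[OF V]
    note meas = measurable_heis_coords
    show "has_bochner_integral M (\<lambda>\<omega>. V \<omega> * (fst (B (s + h) \<omega>) - fst (B s \<omega>))) 0"
      using E'[of fst 0] mom(1) meas by simp
    show "has_bochner_integral M (\<lambda>\<omega>. V \<omega> * (fst (snd (B (s + h) \<omega>)) - fst (snd (B s \<omega>)))) 0"
      using E'[of "\<lambda>p. fst (snd p)" 0] mom(2) meas by simp
    show "has_bochner_integral M (\<lambda>\<omega>. V \<omega> * rel_area (B s \<omega>) (B (s + h) \<omega>)) (integral\<^sup>L M V * (\<integral>\<omega>. snd (snd (X h \<omega>)) \<partial>N))"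
      using E'[of "\<lambda>p. snd (snd p)"] iz meas by (simp add: has_bochner_integral_iff)
    show "has_bochner_integral M (\<lambda>\<omega>. V \<omega> * (fst (B (s + h) \<omega>) - fst (B s \<omega>))\<^sup>2) (integral\<^sup>L M V * h)"
      using E'[of "\<lambda>p. (fst p)\<^sup>2"] mom(3) meas by simp
    show "has_bochner_integral M (\<lambda>\<omega>. V \<omega> * (fst (snd (B (s + h) \<omega>)) - fst (snd (B s \<omega>)))\<^sup>2) (integral\<^sup>L M V * h)"
      using E'[of "\<lambda>p. (fst (snd p))\<^sup>2"] mom(4) meas by simp
    show "has_bochner_integral M (\<lambda>\<omega>. V \<omega> * ((fst (B (s + h) \<omega>) - fst (B s \<omega>)) * (fst (snd (B (s + h) \<omega>)) - fst (snd (B s \<omega>))))) 0"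
      using E'[of "\<lambda>p. fst p * fst (snd p)" 0] mom(5) meas by simp
    show "has_bochner_integral M (\<lambda>\<omega>. V \<omega> * (rel_area (B s \<omega>) (B (s + h) \<omega>))\<^sup>2) (integral\<^sup>L M V * (\<integral>\<omega>. (snd (snd (X h \<omega>)))\<^sup>2 \<partial>N))"
      using E'[of "\<lambda>p. (snd (snd p))\<^sup>2"] mom(8) meas by (simp add: has_bochner_integral_iff)
    show "has_bochner_integral M (\<lambda>\<omega>. V \<omega> * (fst (B (s + h) \<omega>) - fst (B s \<omega>)) ^ 4) (integral\<^sup>L M V * (3 * h\<^sup>2))"
      using E'[of "\<lambda>p. (fst p) ^ 4"] mom(6) meas by simp
    show "has_bochner_integral M (\<lambda>\<omega>. V \<omega> * (fst (snd (B (s + h) \<omega>)) - fst (snd (B s \<omega>))) ^ 4) (integral\<^sup>L M V * (3 * h\<^sup>2))"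
      using E'[of "\<lambda>p. (fst (snd p)) ^ 4"] mom(7) meas by simp
  qed
qed

text \<open>Every term of the pointwise lower bound is a constant times a bounded factor measurable
  with respect to \<open>G\<close> and a function of the increment of only one process. Its
  expectation is therefore determined by \<open>heis_increment\<close>, however the two increments
  are coupled.\<close>

lemma (in prob_space) lyapunov_step:
  fixes A U1 U2 A' e1 e2 z f1 f2 w :: "'a \<Rightarrow> real"
  assumes G: "subalgebra M G"
    and AG: "A \<in> borel_measurable G" and U1G: "U1 \<in> borel_measurable G" and U2G: "U2 \<in> borel_measurable G"
    and A'm[measurable]: "A' \<in> borel_measurable M"
    and em[measurable]: "e1 \<in> borel_measurable M" "e2 \<in> borel_measurable M" "f1 \<in> borel_measurable M" "f2 \<in> borel_measurable M"
    and bnd: "AE \<omega> in M. \<bar>A \<omega>\<bar> \<le> a" "AE \<omega> in M. \<bar>U1 \<omega>\<bar> \<le> b" "AE \<omega> in M. \<bar>U2 \<omega>\<bar> \<le> b"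
    and bnd': "AE \<omega> in M. \<bar>A' \<omega>\<bar> \<le> a" "AE \<omega> in M. \<bar>U1 \<omega> + f1 \<omega> - e1 \<omega>\<bar> \<le> b" "AE \<omega> in M. \<bar>U2 \<omega> + f2 \<omega> - e2 \<omega>\<bar> \<le> b"
    and e: "heis_increment M G h m \<sigma> e1 e2 z" and f: "heis_increment M G h m \<sigma> f1 f2 w"
    and \<sigma>: "\<sigma> \<le> h\<^sup>2" and l: "l > 0" and K: "K = a / (2 * l) + 3 / 2 * b\<^sup>2"
    and A': "\<And>\<omega>. A' \<omega> = A \<omega> + w \<omega> - z \<omega> + (U1 \<omega> * (e2 \<omega> + f2 \<omega>) - U2 \<omega> * (e1 \<omega> + f1 \<omega>)) / 2
       - (e1 \<omega> * f2 \<omega> - e2 \<omega> * f1 \<omega>) / 2"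
  shows "expectation (\<lambda>\<omega>. (U1 \<omega>)\<^sup>2 + (U2 \<omega>)\<^sup>2)
      \<le> expectation (\<lambda>\<omega>. (U1 \<omega> + f1 \<omega> - e1 \<omega>)\<^sup>2 + (U2 \<omega> + f2 \<omega> - e2 \<omega>)\<^sup>2)" (is ?mart)
    and "expectation (\<lambda>\<omega>. (A \<omega>)\<^sup>2 + K * ((U1 \<omega>)\<^sup>2 + (U2 \<omega>)\<^sup>2))
       + (h / 2 * expectation (\<lambda>\<omega>. (U1 \<omega>)\<^sup>2 + (U2 \<omega>)\<^sup>2) - a * l * h - 21 * h\<^sup>2)
      \<le> expectation (\<lambda>\<omega>. (A' \<omega>)\<^sup>2 + K * ((U1 \<omega> + f1 \<omega> - e1 \<omega>)\<^sup>2 + (U2 \<omega> + f2 \<omega> - e2 \<omega>)\<^sup>2))" (is ?lyap)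
proof -
  note [measurable] = AG U1G U2G
  have Mm[measurable]: "A \<in> borel_measurable M" "U1 \<in> borel_measurable M" "U2 \<in> borel_measurable M"
    by (rule measurable_from_subalg[OF G AG] measurable_from_subalg[OF G U1G] measurable_from_subalg[OF G U2G])+
  have bmult: "AE \<omega> in M. \<bar>f \<omega> * g \<omega>\<bar> \<le> c * d" if "AE \<omega> in M. \<bar>f \<omega>\<bar> \<le> c" "AE \<omega> in M. \<bar>g \<omega>\<bar> \<le> d"
    for f g :: "'a \<Rightarrow> real" and c d
    using that by eventually_elim (simp add: abs_mult mult_mono')
  have bint: "integrable M f" if "AE \<omega> in M. \<bar>f \<omega>\<bar> \<le> c" "f \<in> borel_measurable M" for f :: "'a \<Rightarrow> real" and c
    using that by (intro integrable_const_bound[of f c]) auto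
  have i: "integrable M A" "integrable M U1" "integrable M U2" "integrable M (\<lambda>\<omega>. A \<omega> * U1 \<omega>)"
    "integrable M (\<lambda>\<omega>. A \<omega> * U2 \<omega>)" "integrable M (\<lambda>\<omega>. U1 \<omega> * U2 \<omega>)"
    "integrable M (\<lambda>\<omega>. (A \<omega>)\<^sup>2)" "integrable M (\<lambda>\<omega>. (U1 \<omega>)\<^sup>2)" "integrable M (\<lambda>\<omega>. (U2 \<omega>)\<^sup>2)"
    "integrable M (\<lambda>\<omega>. (A' \<omega>)\<^sup>2)" "integrable M (\<lambda>\<omega>. (U1 \<omega> + f1 \<omega> - e1 \<omega>)\<^sup>2)"
    "integrable M (\<lambda>\<omega>. (U2 \<omega> + f2 \<omega> - e2 \<omega>)\<^sup>2)"
    unfolding power2_eq_square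
    by (rule bint[OF bnd(1)] bint[OF bnd(2)] bint[OF bnd(3)] bint[OF bmult[OF bnd(1) bnd(2)]]
       bint[OF bmult[OF bnd(1) bnd(3)]] bint[OF bmult[OF bnd(2) bnd(3)]] bint[OF bmult[OF bnd(1) bnd(1)]]
       bint[OF bmult[OF bnd(2) bnd(2)]] bint[OF bmult[OF bnd(3) bnd(3)]] bint[OF bmult[OF bnd'(1) bnd'(1)]]
       bint[OF bmult[OF bnd'(2) bnd'(2)]] bint[OF bmult[OF bnd'(3) bnd'(3)]], measurable)+
  have scale: "has_bochner_integral M (\<lambda>\<omega>. c * f \<omega>) (c * v)" if "has_bochner_integral M f v"
    for c v :: real and f :: "'a \<Rightarrow> real" using that by (intro has_bochner_integral_mult_right)
  have one: "(\<lambda>_. 1 :: real) \<in> borel_measurable G" "integrable M (\<lambda>_. 1 :: real)" by auto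
  note [simp] = prob_space
  note e1 = heis_incrementD[OF e one, simplified] and f1 = heis_incrementD[OF f one, simplified]
  note eU1 = heis_incrementD[OF e U1G i(2)] and fU1 = heis_incrementD[OF f U1G i(2)]
  note eU2 = heis_incrementD[OF e U2G i(3)] and fU2 = heis_incrementD[OF f U2G i(3)]
  note eA = heis_incrementD(3)[OF e AG i(1)] and fA = heis_incrementD(3)[OF f AG i(1)]
  note eAU1 = heis_incrementD(2)[OF e _ i(4)] and fAU1 = heis_incrementD(2)[OF f _ i(4)]
  note eAU2 = heis_incrementD(1)[OF e _ i(5)] and fAU2 = heis_incrementD(1)[OF f _ i(5)]
  note eU11 = heis_incrementD(5)[OF e _ i(8)] and eU22 = heis_incrementD(4)[OF e _ i(9)]
    and eU12 = heis_incrementD(6)[OF e _ i(6)]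
  note hI = has_bochner_integral_integrable
  \<comment> \<open>The inner product of \<open>U\<close> with its own increment has mean zero,
    which is all of the martingale property that the argument uses.\<close>
  have lin: "has_bochner_integral M (\<lambda>\<omega>. U1 \<omega> * f1 \<omega> - U1 \<omega> * e1 \<omega> + U2 \<omega> * f2 \<omega> - U2 \<omega> * e2 \<omega>) (0 - 0 + 0 - 0)"
    by (intro has_bochner_integral_add has_bochner_integral_diff eU1 fU1 eU2 fU2)
  show ?mart
  proof -
    have "has_bochner_integral M (\<lambda>\<omega>. (U1 \<omega>)\<^sup>2 + (U2 \<omega>)\<^sup>2
       + 2 * (U1 \<omega> * f1 \<omega> - U1 \<omega> * e1 \<omega> + U2 \<omega> * f2 \<omega> - U2 \<omega> * e2 \<omega>))
       (expectation (\<lambda>\<omega>. (U1 \<omega>)\<^sup>2) + expectation (\<lambda>\<omega>. (U2 \<omega>)\<^sup>2) + 2 * (0 - 0 + 0 - 0))"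
      by (intro has_bochner_integral_add lin scale hI i)
    then have "expectation (\<lambda>\<omega>. (U1 \<omega>)\<^sup>2 + (U2 \<omega>)\<^sup>2) = expectation (\<lambda>\<omega>. (U1 \<omega>)\<^sup>2 + (U2 \<omega>)\<^sup>2
       + 2 * (U1 \<omega> * f1 \<omega> - U1 \<omega> * e1 \<omega> + U2 \<omega> * f2 \<omega> - U2 \<omega> * e2 \<omega>))"
      using i(8,9) by (simp add: has_bochner_integral_iff)
    also have "\<dots> \<le> expectation (\<lambda>\<omega>. (U1 \<omega> + f1 \<omega> - e1 \<omega>)\<^sup>2 + (U2 \<omega> + f2 \<omega> - e2 \<omega>)\<^sup>2)"
    proof (rule integral_mono)
      show "integrable M (\<lambda>\<omega>. (U1 \<omega>)\<^sup>2 + (U2 \<omega>)\<^sup>2 + 2 * (U1 \<omega> * f1 \<omega> - U1 \<omega> * e1 \<omega> + U2 \<omega> * f2 \<omega> - U2 \<omega> * e2 \<omega>))"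
        by (rule integrable.intros) fact
      show "integrable M (\<lambda>\<omega>. (U1 \<omega> + f1 \<omega> - e1 \<omega>)\<^sup>2 + (U2 \<omega> + f2 \<omega> - e2 \<omega>)\<^sup>2)"
        using i(11,12) by simp
      have "p\<^sup>2 + q\<^sup>2 + 2 * (p * r - p * s + q * t - q * u) \<le> (p + r - s)\<^sup>2 + (q + t - u)\<^sup>2" for p q r s t u :: real
        using zero_le_power2[of "r - s"] zero_le_power2[of "t - u"] by (simp add: power2_eq_square algebra_simps)
      then show "(U1 \<omega>)\<^sup>2 + (U2 \<omega>)\<^sup>2 + 2 * (U1 \<omega> * f1 \<omega> - U1 \<omega> * e1 \<omega> + U2 \<omega> * f2 \<omega> - U2 \<omega> * e2 \<omega>)
        \<le> (U1 \<omega> + f1 \<omega> - e1 \<omega>)\<^sup>2 + (U2 \<omega> + f2 \<omega> - e2 \<omega>)\<^sup>2" for \<omega> .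
    qed
    finally show ?thesis .
  qed
  define \<Phi> where "\<Phi> \<omega> = (A \<omega>)\<^sup>2 + K * ((U1 \<omega>)\<^sup>2 + (U2 \<omega>)\<^sup>2)
     + (A \<omega> * U1 \<omega> * e2 \<omega> - A \<omega> * U2 \<omega> * e1 \<omega> + A \<omega> * U1 \<omega> * f2 \<omega> - A \<omega> * U2 \<omega> * f1 \<omega>)
     + 2 * (A \<omega> * w \<omega> - A \<omega> * z \<omega>) + 2 * K * (U1 \<omega> * f1 \<omega> - U1 \<omega> * e1 \<omega> + U2 \<omega> * f2 \<omega> - U2 \<omega> * e2 \<omega>)
     + 1 / 2 * ((U1 \<omega>)\<^sup>2 * (e2 \<omega>)\<^sup>2 - 2 * (U1 \<omega> * U2 \<omega> * (e1 \<omega> * e2 \<omega>)) + (U2 \<omega>)\<^sup>2 * (e1 \<omega>)\<^sup>2)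
     - a * l / 2 * ((e1 \<omega>)\<^sup>2 + (e2 \<omega>)\<^sup>2) - 6 * ((z \<omega>)\<^sup>2 + (w \<omega>)\<^sup>2)
     - 3 / 4 * (e1 \<omega> ^ 4 + e2 \<omega> ^ 4 + f1 \<omega> ^ 4 + f2 \<omega> ^ 4)" for \<omega>
  \<comment> \<open>The term by term expectation of \<open>\<Phi>\<close>. The mean \<open>m\<close>
    of the area increment is the same for both processes, so it cancels without being
    computed.\<close>
  define v where "v = expectation (\<lambda>\<omega>. (A \<omega>)\<^sup>2) + K * (expectation (\<lambda>\<omega>. (U1 \<omega>)\<^sup>2) + expectation (\<lambda>\<omega>. (U2 \<omega>)\<^sup>2))
     + (0 - 0 + 0 - 0) + 2 * (expectation A * m - expectation A * m) + 2 * K * (0 - 0 + 0 - 0)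
     + 1 / 2 * (expectation (\<lambda>\<omega>. (U1 \<omega>)\<^sup>2) * h - 2 * 0 + expectation (\<lambda>\<omega>. (U2 \<omega>)\<^sup>2) * h)
     - a * l / 2 * (h + h) - 6 * (\<sigma> + \<sigma>) - 3 / 4 * (3 * h\<^sup>2 + 3 * h\<^sup>2 + 3 * h\<^sup>2 + 3 * h\<^sup>2)"
  have \<Phi>: "has_bochner_integral M \<Phi> v"
    unfolding \<Phi>_def[abs_def] v_def
    by (intro has_bochner_integral_add has_bochner_integral_diff scale lin hI i e1 f1 eA fA eAU1 fAU1 eAU2 fAU2
       eU1 fU1 eU2 fU2 eU11 eU22 eU12 borel_measurable_times borel_measurable_power AG U1G U2G)
  have "expectation \<Phi> \<le> expectation (\<lambda>\<omega>. (A' \<omega>)\<^sup>2 + K * ((U1 \<omega> + f1 \<omega> - e1 \<omega>)\<^sup>2 + (U2 \<omega> + f2 \<omega> - e2 \<omega>)\<^sup>2))"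
  proof (rule integral_mono_AE)
    show "integrable M \<Phi>" using \<Phi> by (rule integrable.intros)
    show "integrable M (\<lambda>\<omega>. (A' \<omega>)\<^sup>2 + K * ((U1 \<omega> + f1 \<omega> - e1 \<omega>)\<^sup>2 + (U2 \<omega> + f2 \<omega> - e2 \<omega>)\<^sup>2))"
      using i(10-12) by simp
    show "AE \<omega> in M. \<Phi> \<omega> \<le> (A' \<omega>)\<^sup>2 + K * ((U1 \<omega> + f1 \<omega> - e1 \<omega>)\<^sup>2 + (U2 \<omega> + f2 \<omega> - e2 \<omega>)\<^sup>2)"
      using bnd
      by eventually_elim (unfold \<Phi>_def, rule lyapunov_pointwise[OF _ _ _ l K A'])
  qed
  moreover have "expectation \<Phi> = v" using \<Phi> by (rule has_bochner_integral_integral_eq)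
  \<comment> \<open>The constant \<open>21\<close> is \<open>12 + 9\<close>: twice
    \<open>6 * \<sigma>\<close> with \<open>\<sigma> \<le> h\<^sup>2\<close>, and
    \<open>3 / 4\<close> of four fourth moments \<open>3 * h\<^sup>2\<close>.\<close>
  moreover have "v \<ge> expectation (\<lambda>\<omega>. (A \<omega>)\<^sup>2 + K * ((U1 \<omega>)\<^sup>2 + (U2 \<omega>)\<^sup>2))
       + (h / 2 * expectation (\<lambda>\<omega>. (U1 \<omega>)\<^sup>2 + (U2 \<omega>)\<^sup>2) - a * l * h - 21 * h\<^sup>2)"
    using i(7-9) \<sigma> by (simp add: v_def algebra_simps)
  ultimately show ?lyap by linarith
qed

text \<open>The last coordinate of the group identity by which the inverse of \<open>p'\<close>
  times \<open>q'\<close> is the product of three factors: the inverse of the increment from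
  \<open>p\<close> to \<open>p'\<close>, the old relative position, and the increment from
  \<open>q\<close> to \<open>q'\<close>.\<close>

lemma rel_area_step:
  "rel_area p' q' = rel_area p q + rel_area q q' - rel_area p p'
     + ((fst q - fst p) * ((fst (snd p') - fst (snd p)) + (fst (snd q') - fst (snd q)))
        - (fst (snd q) - fst (snd p)) * ((fst p' - fst p) + (fst q' - fst q))) / 2
     - ((fst p' - fst p) * (fst (snd q') - fst (snd q)) - (fst (snd p') - fst (snd p)) * (fst q' - fst q)) / 2"
  by (simp add: rel_area_def field_simps)

theorem theorem1p4:
  fixes M :: "'w measure" and F :: "real \<Rightarrow> 'w measure"
    and B B' :: "real \<Rightarrow> 'w \<Rightarrow> heis"
    and x y z x' y' z' :: real
  assumes "heis_brownian_motion M (x, y, z) B"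
    and "heis_brownian_motion M (x', y', z') B'"
    and "co_adapted M F B B'"
    and "(x' - x)\<^sup>2 + (y' - y)\<^sup>2 > 0"
  shows "\<forall>C>0. \<not> (AE \<omega> in M. \<forall>t\<ge>0. cc_dist (B t \<omega>) (B' t \<omega>) \<le> C)"
proof (intro allI impI notI)
  fix C :: real assume C: "C > 0" and cc: "AE \<omega> in M. \<forall>t\<ge>0. cc_dist (B t \<omega>) (B' t \<omega>) \<le> C"
  from assms(3) have M: "prob_space M" and F: "filtration_on M F"
    and ad: "\<forall>t\<ge>0. B t \<in> borel_measurable (F t)" and ad': "\<forall>t\<ge>0. B' t \<in> borel_measurable (F t)"
    and mk: "heis_markov M F B" and mk': "heis_markov M F B'"
    unfolding co_adapted_def by auto
  interpret prob_space M by (rule M)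
  \<comment> \<open>One canonical process serves both motions, because the increments of each are
    governed by the same semigroup; this gives them common moments \<open>m\<close> and
    \<open>\<sigma>\<close>.\<close>
  from assms(1) obtain N :: "(real \<Rightarrow> heis) measure" and X where X: "canonical_heis_bm N X"
    unfolding heis_brownian_motion_def by blast
  define u0 where "u0 = (x' - x)\<^sup>2 + (y' - y)\<^sup>2"
  have u0: "u0 > 0" using assms(4) by (simp add: u0_def)
  \<comment> \<open>The bounds \<open>b\<close> and \<open>a\<close> are those of
    \<open>cc_dist_bounds\<close>. The choice of \<open>l\<close> gives
    \<open>a * l * h = h * u0 / 4\<close>, and that of \<open>h\<close> gives
    \<open>21 * h\<^sup>2 = h * u0 / 8\<close>. Of the gain \<open>h * u0 / 2\<close> of one step,
    \<open>h * u0 / 8\<close> is left.\<close>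
  define b where "b = C + 1"
  define a where "a = b\<^sup>2"
  define l where "l = u0 / (4 * a)"
  define h where "h = u0 / 168"
  define K where "K = a / (2 * l) + 3 / 2 * b\<^sup>2"
  have ab: "a > 0" "b > 0" using C by (auto simp: a_def b_def)
  have l: "l > 0" and h: "h > 0" using u0 ab by (auto simp: l_def h_def)
  have K0: "K \<ge> 0" using l ab by (simp add: K_def)
  define s where "s k = real k * h" for k
  have s0: "s k \<ge> 0" and sS: "s (Suc k) = s k + h" for k using h by (auto simp: s_def algebra_simps)
  define U1 where "U1 k \<omega> = fst (B' (s k) \<omega>) - fst (B (s k) \<omega>)" for k \<omega>
  define U2 where "U2 k \<omega> = fst (snd (B' (s k) \<omega>)) - fst (snd (B (s k) \<omega>))" for k \<omega>
  define A where "A k \<omega> = rel_area (B (s k) \<omega>) (B' (s k) \<omega>)" for k \<omega>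
  define u where "u k = expectation (\<lambda>\<omega>. (U1 k \<omega>)\<^sup>2 + (U2 k \<omega>)\<^sup>2)" for k
  define L where "L k = expectation (\<lambda>\<omega>. (A k \<omega>)\<^sup>2 + K * ((U1 k \<omega>)\<^sup>2 + (U2 k \<omega>)\<^sup>2))" for k
  have G: "subalgebra M (F (s k))" for k using F s0 by (simp add: filtration_on_def)
  have cF: "(\<lambda>\<omega>. fst (B (s k) \<omega>)) \<in> borel_measurable (F (s k))" "(\<lambda>\<omega>. fst (snd (B (s k) \<omega>))) \<in> borel_measurable (F (s k))"
    "(\<lambda>\<omega>. snd (snd (B (s k) \<omega>))) \<in> borel_measurable (F (s k))"
    "(\<lambda>\<omega>. fst (B' (s k) \<omega>)) \<in> borel_measurable (F (s k))" "(\<lambda>\<omega>. fst (snd (B' (s k) \<omega>))) \<in> borel_measurable (F (s k))"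
    "(\<lambda>\<omega>. snd (snd (B' (s k) \<omega>))) \<in> borel_measurable (F (s k))" for k
    by (rule measurable_compose[OF ad[rule_format, OF s0]] measurable_compose[OF ad'[rule_format, OF s0]], rule measurable_heis_coords)+
  note cM[measurable] = measurable_from_subalg[OF G cF(1)] measurable_from_subalg[OF G cF(2)]
    measurable_from_subalg[OF G cF(3)] measurable_from_subalg[OF G cF(4)] measurable_from_subalg[OF G cF(5)]
    measurable_from_subalg[OF G cF(6)]
  have AF: "A k \<in> borel_measurable (F (s k))" and U1F: "U1 k \<in> borel_measurable (F (s k))"
    and U2F: "U2 k \<in> borel_measurable (F (s k))" for k
    unfolding A_def U1_def U2_def rel_area_def using cF[of k]
    by (intro borel_measurable_diff borel_measurable_divide borel_measurable_times; simp)+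
  note AM[measurable] = measurable_from_subalg[OF G AF] measurable_from_subalg[OF G U1F] measurable_from_subalg[OF G U2F]
  have bnd: "AE \<omega> in M. \<bar>A k \<omega>\<bar> \<le> a \<and> \<bar>U1 k \<omega>\<bar> \<le> b \<and> \<bar>U2 k \<omega>\<bar> \<le> b" for k
    using cc
  proof eventually_elim
    case (elim \<omega>)
    obtain p1 p2 p3 where p: "B (s k) \<omega> = (p1, p2, p3)" by (cases "B (s k) \<omega>")
    obtain q1 q2 q3 where q: "B' (s k) \<omega> = (q1, q2, q3)" by (cases "B' (s k) \<omega>")
    have "cc_dist (p1, p2, p3) (q1, q2, q3) \<le> C" using elim[rule_format, OF s0[of k]] by (simp add: p q)
    from cc_dist_bounds[OF this] show ?case
      by (simp add: A_def U1_def U2_def rel_area_def p q a_def b_def)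
  qed
  then have bA: "AE \<omega> in M. \<bar>A k \<omega>\<bar> \<le> a" and bU1: "AE \<omega> in M. \<bar>U1 k \<omega>\<bar> \<le> b" and bU2: "AE \<omega> in M. \<bar>U2 k \<omega>\<bar> \<le> b" for k
    by (auto elim: eventually_mono[OF bnd[of k]])
  have step: "u k \<le> u (Suc k)" "L k + (h / 2 * u k - a * l * h - 21 * h\<^sup>2) \<le> L (Suc k)" for k
  proof -
    let ?e1 = "\<lambda>\<omega>. fst (B (s k + h) \<omega>) - fst (B (s k) \<omega>)" and ?e2 = "\<lambda>\<omega>. fst (snd (B (s k + h) \<omega>)) - fst (snd (B (s k) \<omega>))"
    let ?f1 = "\<lambda>\<omega>. fst (B' (s k + h) \<omega>) - fst (B' (s k) \<omega>)" and ?f2 = "\<lambda>\<omega>. fst (snd (B' (s k + h) \<omega>)) - fst (snd (B' (s k) \<omega>))"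
    have U1S: "U1 k \<omega> + ?f1 \<omega> - ?e1 \<omega> = U1 (Suc k) \<omega>" and U2S: "U2 k \<omega> + ?f2 \<omega> - ?e2 \<omega> = U2 (Suc k) \<omega>" for \<omega>
      by (simp_all add: U1_def U2_def sS)
    have AS: "A (Suc k) \<omega> = A k \<omega> + rel_area (B' (s k) \<omega>) (B' (s k + h) \<omega>) - rel_area (B (s k) \<omega>) (B (s k + h) \<omega>)
       + (U1 k \<omega> * (?e2 \<omega> + ?f2 \<omega>) - U2 k \<omega> * (?e1 \<omega> + ?f1 \<omega>)) / 2
       - (?e1 \<omega> * ?f2 \<omega> - ?e2 \<omega> * ?f1 \<omega>) / 2" for \<omega>
      unfolding A_def U1_def U2_def sS by (rule rel_area_step)
    have em: "?e1 \<in> borel_measurable M" "?e2 \<in> borel_measurable M" "?f1 \<in> borel_measurable M" "?f2 \<in> borel_measurable M"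
      unfolding sS[symmetric] by measurable
    \<comment> \<open>The two premises left open bound \<open>U\<close> after the step; rewriting
      with \<open>U1S\<close> and \<open>U2S\<close> turns them into the bounds at
      \<open>Suc k\<close>.\<close>
    note st = lyapunov_step[OF G AF U1F U2F AM(1)[of "Suc k"] em bA bU1 bU2 bA[of "Suc k"] _ _
        heis_markov_heis_increment[OF M F ad mk X s0 h] heis_markov_heis_increment[OF M F ad' mk' X s0 h]
        canonical_heis_bm_moments(9)[OF X h] l K_def AS, unfolded U1S U2S, OF bU1 bU2]
    show "u k \<le> u (Suc k)" unfolding u_def by (rule st(1))
    show "L k + (h / 2 * u k - a * l * h - 21 * h\<^sup>2) \<le> L (Suc k)" unfolding u_def L_def by (rule st(2))
  qed
  have "u 0 = u0"
  proof -
    have "AE \<omega> in M. (U1 0 \<omega>)\<^sup>2 + (U2 0 \<omega>)\<^sup>2 = u0"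
      using heis_brownian_motion_start[OF assms(1)] heis_brownian_motion_start[OF assms(2)]
      by eventually_elim (simp add: U1_def U2_def s_def u0_def)
    then have "u 0 = expectation (\<lambda>_. u0)" unfolding u_def by (intro integral_cong_AE) auto
    then show ?thesis by (simp add: prob_space)
  qed
  \<comment> \<open>A coupling may bring the projections together along some paths, but the second
    moment of their difference never falls below its initial value.\<close>
  then have uk: "u0 \<le> u k" for k
    by (induction k) (use step(1) order_trans in \<open>auto\<close>)
  have grow: "L k + h * u0 / 8 \<le> L (Suc k)" for k
  proof -
    have "h / 2 * u0 \<le> h / 2 * u k" using uk h by (intro mult_left_mono) auto
    moreover have "a * l * h = h * u0 / 4" using ab by (simp add: l_def)
    moreover have "21 * h\<^sup>2 = h * u0 / 8" by (simp add: h_def power2_eq_square)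
    ultimately show ?thesis using step(2)[of k] by linarith
  qed
  have lin: "L 0 + real k * (h * u0 / 8) \<le> L k" for k
  proof (induction k)
    case (Suc k)
    have "real (Suc k) * (h * u0 / 8) = real k * (h * u0 / 8) + h * u0 / 8"
      by (simp only: of_nat_Suc distrib_right mult_1)
    then show ?case using Suc grow[of k] by linarith
  qed simp
  have "L k \<le> a\<^sup>2 + K * (b\<^sup>2 + b\<^sup>2)" for k
  proof -
    have le: "AE \<omega> in M. (A k \<omega>)\<^sup>2 + K * ((U1 k \<omega>)\<^sup>2 + (U2 k \<omega>)\<^sup>2) \<le> a\<^sup>2 + K * (b\<^sup>2 + b\<^sup>2)"
      using bnd[of k]
    proof eventually_elim
      case (elim \<omega>)
      then have "(A k \<omega>)\<^sup>2 \<le> a\<^sup>2" "(U1 k \<omega>)\<^sup>2 \<le> b\<^sup>2" "(U2 k \<omega>)\<^sup>2 \<le> b\<^sup>2"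
        using ab by (auto simp: abs_le_square_iff[symmetric])
      then show ?case using K0 by (intro add_mono mult_left_mono) auto
    qed
    have "integrable M (\<lambda>\<omega>. (A k \<omega>)\<^sup>2 + K * ((U1 k \<omega>)\<^sup>2 + (U2 k \<omega>)\<^sup>2))"
      by (rule integrable_const_bound[of _ "a\<^sup>2 + K * (b\<^sup>2 + b\<^sup>2)"]) (use le K0 in auto)
    then have "L k \<le> expectation (\<lambda>_. a\<^sup>2 + K * (b\<^sup>2 + b\<^sup>2))"
      unfolding L_def by (rule integral_mono_AE) (use le in auto)
    then show ?thesis by (simp add: prob_space)
  qed
  moreover have "L 0 \<ge> 0" unfolding L_def using K0 by (intro integral_nonneg_AE) auto
  \<comment> \<open>\<open>L\<close> starts nonnegative and is bounded uniformly in
    \<open>k\<close>, so the accumulated gain is bounded too, against its linear growth.\<close>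
  ultimately have bd: "real k * (h * u0 / 8) \<le> a\<^sup>2 + K * (b\<^sup>2 + b\<^sup>2)" for k
    using lin[of k] by (smt (verit))
  have "h * u0 / 8 > 0" using h u0 by simp
  then obtain k :: nat where "a\<^sup>2 + K * (b\<^sup>2 + b\<^sup>2) < real k * (h * u0 / 8)"
    using ex_less_of_nat_mult by blast
  then show False using bd[of k] by simp
qed

end
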